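(* Let either $M$ be a positive integer and $m=-1$, or $M$ a positive odd integer and $m\in\mathbb Z_{\le-2}$ coprime to $M$. Let $\epsilon,\epsilon'\in\{0,\frac12\}$ and $j,k\in\epsilon'+\mathbb Z$. Then for $\alpha=0$ or $1$ one has $$\chi^{(\alpha)[M,-m;\epsilon]}_{j,k;\epsilon'}\Big(-\frac1\tau,\frac z\tau\Big)=-(-1)^{(1-2\epsilon)(1-2\epsilon')}\frac{\tau^\alpha}M e^{-\frac{2\pi i}\tau(\frac mM+1)z^2}\sum_{(a,b)\in(\epsilon+\mathbb Z/M\mathbb Z)^2}e^{\frac{2\pi im}M(ak+bj)}\chi^{(\alpha)[M,-m;\epsilon']}_{a,b;\epsilon}(\tau,z),$$ $$\chi^{(\alpha)[M,-m;\epsilon]}_{j,k;\epsilon'}(\tau+1,z)=e^{-\frac{2\pi im}Mjk-\pi i\epsilon'}\chi^{(\alpha)[M,-m;|\epsilon-\epsilon'|]}_{j,k;\epsilon'}(\tau,z).$$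
   Context: Throughout $\operatorname{Im}\tau>0$, $q=e^{2\pi i\tau}$. For a positive integer $\ell$: $\Theta_{j,\ell}(\tau,z)=\sum_{r\in\mathbb Z+\frac{j}{2\ell}}q^{\ell r^2}e^{2\pi i\ell rz}$; $\Phi_1^{[\ell;0]}(\tau,z_1,z_2)=\sum_{j\in\mathbb Z}\frac{e^{2\pi i\ell j(z_1+z_2)}q^{j^2\ell}}{1-e^{2\pi iz_1}q^j}$; $\Phi^{[\ell;0]}(\tau,z_1,z_2)=\Phi_1^{[\ell;0]}(\tau,z_1,z_2)-\Phi_1^{[\ell;0]}(\tau,-z_2,-z_1)$; $E(x)=2\int_0^xe^{-\pi u^2}du$; $R_{j;\ell}(\tau,v)=\sum_{r\in\mathbb Z,\ r\equiv j\,(2\ell)}\big(\mathrm{sgn}(r-\tfrac12-j+2\ell)-E((r-2\ell\tfrac{\operatorname{Im}v}{\operatorname{Im}\tau})\sqrt{\tfrac{\operatorname{Im}\tau}{\ell}})\big)e^{-\frac{\pi ir^2}{2\ell}\tau+2\pi irv}$; $\tilde\Phi^{[\ell;0]}(\tau,z_1,z_2)=\Phi^{[\ell;0]}(\tau,z_1,z_2)+\frac12\sum_{j=0}^{2\ell-1}R_{j;\ell}(\tau,\tfrac{z_1-z_2}2)(\Theta_{-j,\ell}-\Theta_{j,\ell})(\tau,z_1+z_2)$. With $D_0=\frac1{2\pi i}(\frac{\partial}{\partial z_1}-\frac{\partial}{\partial z_2})$ and $j,k\in\epsilon'+\mathbb Z$: $\tilde\Psi^{[M,-m;0;\epsilon]}_{j,k;\epsilon'}(\tau,z_1,z_2)=q^{-\frac{m}Mjk}e^{-\frac{2\pi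 im}M(kz_1+jz_2)}\tilde\Phi^{[-m;0]}(M\tau,z_1+j\tau+\epsilon,z_2+k\tau+\epsilon)$, $P^{[M,-m;\epsilon]}_{j,k;\epsilon'}(\tau,z_1,z_2)=\big(D_0+\frac{m(z_1-z_2)}{2M\tau}\big)\tilde\Psi^{[M,-m;0;\epsilon]}_{j,k;\epsilon'}(\tau,z_1,z_2)$. With $\vartheta_{00}=\Theta_{2,2}+\Theta_{0,2}$, $\vartheta_{01}=-\Theta_{2,2}+\Theta_{0,2}$, $\vartheta_{10}=\Theta_{1,2}+\Theta_{-1,2}$, $\vartheta_{11}=i\Theta_{1,2}-i\Theta_{-1,2}$ and the Dedekind $\eta$, put $R^{(\epsilon)}_{\epsilon'}(\tau,z)=\eta(\tau)^3\frac{\vartheta_{11}(\tau,2z)}{\vartheta_{1-2\epsilon',1-2\epsilon}(\tau,z)^2}$ and $$\chi^{(1)[M,-m;\epsilon]}_{j,k;\epsilon'}(\tau,z)=\frac{P^{[M,-m;\epsilon]}_{j,k;\epsilon'}(\tau,z,z)}{R^{(\epsilon)}_{\epsilon'}(\tau,z)},\qquad \chi^{(0)[M,-m;\epsilon]}_{j,k;\epsilon'}(\tau,z)=\frac{\tilde\Psi^{[M,-m;0;\epsilon]}_{j,k;\epsilon'}(\tau,z,z)}{R^{(\epsilon)}_{\epsilon'}(\tau,z)}.$$ *)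

theory Defs
  imports "HOL-Analysis.Analysis" "HOL-Number_Theory.Cong"
begin

text \<open>
  \<^term>\<open>ee x\<close> is $e^{2\pi i x}$. All powers $q^x$ of the nome are written
  \<open>ee (x * \<tau>)\<close>, which fixes the branch of fractional powers.
\<close>

definition ee :: "complex \<Rightarrow> complex" where
  "ee x = exp (2 * of_real pi * \<i> * x)"

definition int_shift :: "real \<Rightarrow> real set" where
  "int_shift x = {x + of_int n | n :: int. True}"

text \<open>\<open>S\<close> is a system of representatives of $(\epsilon + \mathbb{Z}/M\mathbb{Z})^2$.\<close>

definition coset_representatives :: "nat \<Rightarrow> real \<Rightarrow> (real \<times> real) set \<Rightarrow> bool" where
  "coset_representatives M \<epsilon> S \<longleftrightarrow>
     S \<subseteq> int_shift \<epsilon> \<times> int_shift \<epsilon> \<and>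
     (\<forall>(x, y) \<in> int_shift \<epsilon> \<times> int_shift \<epsilon>.
        \<exists>!p. p \<in> S \<and> (x - fst p) / of_nat M \<in> \<int> \<and> (y - snd p) / of_nat M \<in> \<int>)"

lemma coset_representatives_box:
  assumes "M > 0"
  shows "coset_representatives M \<epsilon> ((\<lambda>(a, b). (\<epsilon> + real a, \<epsilon> + real b)) ` ({..<M} \<times> {..<M}))"
proof -
  define A where "A = (\<lambda>a. \<epsilon> + real a) ` {..<M}"
  have box: "(\<lambda>(a, b). (\<epsilon> + real a, \<epsilon> + real b)) ` ({..<M} \<times> {..<M}) = A \<times> A"
    by (auto simp: A_def image_iff)
  have sub: "A \<subseteq> int_shift \<epsilon>"
    unfolding A_def int_shift_def by (auto intro: exI[of _ "int _"])
  have uniq: "\<exists>!p. p \<in> A \<and> (x - p) / of_nat M \<in> \<int>" if "x \<in> int_shift \<epsilon>" for x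
  proof -
    from that obtain n :: int where n: "x = \<epsilon> + of_int n" by (auto simp: int_shift_def)
    define a where "a = nat (n mod int M)"
    have a: "int a = n mod int M" using assms by (simp add: a_def)
    have "a < M" using a assms by (metis of_nat_0_less_iff of_nat_less_iff pos_mod_bound)
    have "n - int a = int M * (n div int M)" using a by (simp add: minus_mod_eq_mult_div)
    hence "real_of_int n - real a = real M * of_int (n div int M)"
      by (metis of_int_diff of_int_mult of_int_of_nat_eq)
    hence "(x - (\<epsilon> + real a)) / of_nat M = of_int (n div int M)"
      using assms by (simp add: n field_simps)
    hence ex: "\<epsilon> + real a \<in> A \<and> (x - (\<epsilon> + real a)) / of_nat M \<in> \<int>"
      using \<open>a < M\<close> by (auto simp: A_def)
    show ?thesis
    proof (rule ex1I[of _ "\<epsilon> + real a"])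
      show "\<epsilon> + real a \<in> A \<and> (x - (\<epsilon> + real a)) / of_nat M \<in> \<int>" by (fact ex)
    next
      fix p assume p: "p \<in> A \<and> (x - p) / of_nat M \<in> \<int>"
      then obtain b where b: "b < M" "p = \<epsilon> + real b" by (auto simp: A_def)
      from p obtain c :: int where "(x - p) / of_nat M = of_int c" by (auto elim: Ints_cases)
      hence "real_of_int n - real b = of_int c * real M"
        using assms by (simp add: n b(2) field_simps)
      hence "real_of_int (n - int b) = real_of_int (c * int M)" by simp
      hence "n = int b + c * int M" by linarith
      hence "n mod int M = int b" using b(1) by simp
      thus "p = \<epsilon> + real a" using a b(2) by simp
    qed
  qed
  show ?thesis
    unfolding box coset_representatives_def
  proof (intro conjI ballI, goal_cases)
    case 1 show ?case using sub by auto
  next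
    case (2 z)
    obtain x y where z: "z = (x, y)" by (cases z)
    have "\<exists>!p. p \<in> A \<and> (x - p) / of_nat M \<in> \<int>" "\<exists>!p. p \<in> A \<and> (y - p) / of_nat M \<in> \<int>"
      using 2 uniq by (auto simp: z)
    then show ?case
      unfolding z prod.case by (auto simp: Ex1_def) (metis surj_pair)?
  qed
qed

definition Theta :: "int \<Rightarrow> nat \<Rightarrow> complex \<Rightarrow> complex \<Rightarrow> complex" where
  "Theta j l \<tau> z =
     (\<Sum>\<^sub>\<infinity>r \<in> int_shift (of_int j / (2 * of_nat l)).
        ee (of_nat l * of_real r ^ 2 * \<tau>) * ee (of_nat l * of_real r * z))"

definition Phi1 :: "nat \<Rightarrow> complex \<Rightarrow> complex \<Rightarrow> complex \<Rightarrow> complex" where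
  "Phi1 l \<tau> z1 z2 =
     (\<Sum>\<^sub>\<infinity>j \<in> (UNIV :: int set).
        ee (of_nat l * of_int j * (z1 + z2)) * ee (of_int j ^ 2 * of_nat l * \<tau>) /
        (1 - ee z1 * ee (of_int j * \<tau>)))"

definition Phi :: "nat \<Rightarrow> complex \<Rightarrow> complex \<Rightarrow> complex \<Rightarrow> complex" where
  "Phi l \<tau> z1 z2 = Phi1 l \<tau> z1 z2 - Phi1 l \<tau> (- z2) (- z1)"

text \<open>The interval integral is signed, so this is the odd function $E$ on all of the reals.\<close>

definition Efun :: "real \<Rightarrow> real" where
  "Efun x = 2 * (LBINT u = ereal 0..ereal x. exp (- pi * u ^ 2))"

definition Rfun :: "int \<Rightarrow> nat \<Rightarrow> complex \<Rightarrow> complex \<Rightarrow> complex" where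
  "Rfun j l \<tau> v =
     (\<Sum>\<^sub>\<infinity>r \<in> {r :: int. [r = j] (mod (2 * int l))}.
        of_real (sgn (of_int r - 1 / 2 - of_int j + 2 * of_nat l)
                 - Efun ((of_int r - 2 * of_nat l * (Im v / Im \<tau>)) * sqrt (Im \<tau> / of_nat l))) *
        exp (- (of_real pi * \<i> * of_int r ^ 2 / (2 * of_nat l)) * \<tau>
             + 2 * of_real pi * \<i> * of_int r * v))"

definition Phi_tilde :: "nat \<Rightarrow> complex \<Rightarrow> complex \<Rightarrow> complex \<Rightarrow> complex" where
  "Phi_tilde l \<tau> z1 z2 =
     Phi l \<tau> z1 z2 +
     1 / 2 * (\<Sum>j = 0..2 * int l - 1.
        Rfun j l \<tau> ((z1 - z2) / 2) * (Theta (- j) l \<tau> (z1 + z2) - Theta j l \<tau> (z1 + z2)))"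

text \<open>
  The parameter \<open>m\<close> is negative and the level is $-m$. The index $\epsilon'$ of the source notation
  only records the coset of \<open>j\<close> and \<open>k\<close>, on which the formula does not otherwise depend.
\<close>

definition Psi_tilde ::
  "nat \<Rightarrow> int \<Rightarrow> real \<Rightarrow> real \<Rightarrow> real \<Rightarrow> complex \<Rightarrow> complex \<Rightarrow> complex \<Rightarrow> complex" where
  "Psi_tilde M m \<epsilon> j k \<tau> z1 z2 =
     ee (- (of_int m / of_nat M) * of_real j * of_real k * \<tau>) *
     ee (- (of_int m / of_nat M) * (of_real k * z1 + of_real j * z2)) *
     Phi_tilde (nat (- m)) (of_nat M * \<tau>)
       (z1 + of_real j * \<tau> + of_real \<epsilon>) (z2 + of_real k * \<tau> + of_real \<epsilon>)"

text \<open>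
  \<^const>\<open>Phi_tilde\<close> is real analytic but not holomorphic in its elliptic variables (it involves
  $\operatorname{Im} v$), so $\partial/\partial z$ is the Wirtinger derivative
  $\frac{1}{2}(\partial_x - i \partial_y)$ and not \<^const>\<open>deriv\<close>.
\<close>

definition wirtinger :: "(complex \<Rightarrow> complex) \<Rightarrow> complex \<Rightarrow> complex" where
  "wirtinger f z = (frechet_derivative f (at z) 1 - \<i> * frechet_derivative f (at z) \<i>) / 2"

definition D0 :: "(complex \<Rightarrow> complex \<Rightarrow> complex) \<Rightarrow> complex \<Rightarrow> complex \<Rightarrow> complex" where
  "D0 F z1 z2 =
     1 / (2 * of_real pi * \<i>) * (wirtinger (\<lambda>w. F w z2) z1 - wirtinger (\<lambda>w. F z1 w) z2)"

definition Pfun ::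
  "nat \<Rightarrow> int \<Rightarrow> real \<Rightarrow> real \<Rightarrow> real \<Rightarrow> complex \<Rightarrow> complex \<Rightarrow> complex \<Rightarrow> complex" where
  "Pfun M m \<epsilon> j k \<tau> z1 z2 =
     D0 (Psi_tilde M m \<epsilon> j k \<tau>) z1 z2 +
     of_int m * (z1 - z2) / (2 * of_nat M * \<tau>) * Psi_tilde M m \<epsilon> j k \<tau> z1 z2"

definition dedekind_eta :: "complex \<Rightarrow> complex" where
  "dedekind_eta \<tau> = ee (\<tau> / 24) * prodinf (\<lambda>n. 1 - ee (of_nat (Suc n) * \<tau>))"

text \<open>Jacobi's $\vartheta_{ab}$ with both indices in $\{0, 1\}$.\<close>

definition vartheta :: "real \<Rightarrow> real \<Rightarrow> complex \<Rightarrow> complex \<Rightarrow> complex" where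
  "vartheta a b \<tau> z =
     (if a = 0
      then if b = 0 then Theta 2 2 \<tau> z + Theta 0 2 \<tau> z
           else - Theta 2 2 \<tau> z + Theta 0 2 \<tau> z
      else if b = 0 then Theta 1 2 \<tau> z + Theta (- 1) 2 \<tau> z
           else \<i> * Theta 1 2 \<tau> z - \<i> * Theta (- 1) 2 \<tau> z)"

definition denom_R :: "real \<Rightarrow> real \<Rightarrow> complex \<Rightarrow> complex \<Rightarrow> complex" where
  "denom_R \<epsilon> \<epsilon>' \<tau> z =
     dedekind_eta \<tau> ^ 3 * vartheta 1 1 \<tau> (2 * z) / vartheta (1 - 2 * \<epsilon>') (1 - 2 * \<epsilon>) \<tau> z ^ 2"

definition chi ::
  "nat \<Rightarrow> nat \<Rightarrow> int \<Rightarrow> real \<Rightarrow> real \<Rightarrow> real \<Rightarrow> real \<Rightarrow> complex \<Rightarrow> complex \<Rightarrow> complex" where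
  "chi \<alpha> M m \<epsilon> \<epsilon>' j k \<tau> z =
     (if \<alpha> = 0 then Psi_tilde M m \<epsilon> j k \<tau> z z else Pfun M m \<epsilon> j k \<tau> z z) / denom_R \<epsilon> \<epsilon>' \<tau> z"

text \<open>
  The points at which all the quotients defining \<^const>\<open>chi\<close> (for half-integral parameters) make
  sense. The zeros of $\vartheta_{11}(\tau, 2z)$ are exactly the $z$ with
  $2z \in \mathbb{Z} + \tau\mathbb{Z}$; all zeros of $\vartheta_{ab}(\tau, z)$ and
  all poles of the numerators lie among them. The condition is invariant under
  $(\tau, z) \mapsto (-1/\tau, z/\tau)$ and $(\tau, z) \mapsto (\tau + 1, z)$.
\<close>

definition regular_point :: "complex \<Rightarrow> complex \<Rightarrow> bool" where
  "regular_point \<tau> z \<longleftrightarrow> (\<forall>a b :: int. 2 * z \<noteq> of_int a + of_int b * \<tau>)"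

end

theory Submission
  imports Defs "HOL-Complex_Analysis.Complex_Analysis" "HOL-Probability.Probability"
begin

text \<open>
  The completed function is a Green kernel: for fixed \<open>z1 - z2\<close>, the non-holomorphic correction turns
  \<open>Phi1 l \<tau> z1 z2\<close> into a sum over the lattice \<open>\<int> \<tau> + \<int>\<close> of Gaussian-damped simple poles,
  \[ \frac{i}{2\pi} \sum_{a,b} e^{2\pi i \ell a z_2}
     \frac{e^{-\frac{\pi\ell}{y} \zeta (\bar\zeta + 2 i\, \mathrm{Im}\, z_2)}}{\zeta},
     \qquad \zeta = z_1 + a\tau + b,\ y = \mathrm{Im}\, \tau . \]
  The inner sum over \<open>b\<close> is evaluated by an identity whose derivative in one real parameter is the theta
  inversion formula. The lattice sum is manifestly covariant under the modular group, so the
  transformation laws of the numerators reduce to relabelling the lattice, together with the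
  orthogonality of the characters of \<open>\<int>/M\<int>\<close>. The derivative \<open>D0\<close> on the diagonal does not see the
  factor \<open>ee (K * z1 * z2)\<close>. The denominators follow from the theta inversion formula, and from
  \<open>2 \<eta>\<^sup>3 = \<theta>\<^sub>0\<^sub>0 \<theta>\<^sub>0\<^sub>1 \<theta>\<^sub>1\<^sub>0\<close> at the origin, which is a consequence of Jacobi's triple product.
\<close>

section \<open>Summation over the integers and the integer lattice\<close>

text \<open>Each summand of \<open>Phi1\<close> already contains a whole row of poles, while \<tau>
  -> -1/\<tau> exchanges rows and columns of the lattice. A double series of bare simple poles does
  not converge absolutely, so it could not be relabelled. The completion supplies the missing decay:
  the exponent of each lattice term is -(pi l / y) |\<zeta>|^2 up to a part linear in \<zeta>. The
  price is that imaginary parts occur, so the terms are not holomorphic in z1 and z2, and identities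
  in these variables cannot be obtained by comparing poles or by analytic continuation. They are
  checked term by term instead, and the inner sum is reached through the real parameter \<theta> = l
  (Im z1 - Im z2) / y, in which both sides are smooth. A shift of \<theta> by 1 then fixes the
  constant of integration without evaluating either side anywhere. For the denominators only the
  cube of the eta function matters. A product formula for the cube suffices, and no root of unity
  has to be determined for eta itself.\<close>

lemma summable_on_exp_neg_abs_int:
  assumes "k > 0"
  shows "(\<lambda>n::int. exp (- k * \<bar>of_int n\<bar>) :: real) summable_on UNIV"
proof -
  have s: "(\<lambda>n::nat. exp (- k * real n)) summable_on UNIV"
  proof -
    have "summable (\<lambda>n::nat. exp (- k) ^ n)"
      using assms by (intro summable_geometric) auto
    then have "summable (\<lambda>n::nat. exp (- k * real n))"
      by (simp add: exp_of_nat_mult [symmetric] mult.commute)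
    then show ?thesis by (subst summable_on_UNIV_nonneg_real_iff) auto
  qed
  have 1: "(\<lambda>n::int. exp (- k * \<bar>of_int n\<bar>) :: real) summable_on (range int)"
    by (subst summable_on_reindex) (use s in \<open>auto simp: o_def\<close>)
  have 2: "(\<lambda>n::int. exp (- k * \<bar>of_int n\<bar>) :: real) summable_on (range (\<lambda>n. - int n))"
    by (subst summable_on_reindex) (use s in \<open>auto simp: o_def inj_on_def\<close>)
  have "range int \<union> range (\<lambda>n. - int n) = UNIV"
    by (metis (no_types, lifting) UNIV_eq_I UnCI int_cases2 rangeI)
  with summable_on_union [OF 1 2] show ?thesis by simp
qed

lemma summable_on_exp_neg_abs_int2:
  assumes "k > 0"
  shows "(\<lambda>(a::int, b::int). exp (- k * (\<bar>of_int a\<bar> + \<bar>of_int b\<bar>)) :: real) summable_on UNIV"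
proof -
  note s = summable_on_exp_neg_abs_int [OF assms]
  have "(\<lambda>(a::int, b::int). exp (- k * \<bar>of_int a\<bar>) * exp (- k * \<bar>of_int b\<bar>) :: real)
      summable_on (UNIV \<times> UNIV)"
    by (rule summable_on_SigmaI [where g = "\<lambda>a. exp (- k * \<bar>of_int a\<bar>) *
            (\<Sum>\<^sub>\<infinity>b::int. exp (- k * \<bar>of_int b\<bar>))"])
       (use s in \<open>auto intro!: has_sum_cmult_right has_sum_infsum summable_on_cmult_left\<close>)
  then show ?thesis
    by (simp add: exp_add [symmetric] algebra_simps case_prod_unfold)
qed

text \<open>Completing the square against the slope \<open>K + 1\<close> leaves a spare
  \<open>- x\<close>. A Gaussian times any exponential is thereby traded for decay of rate 1, and
  the convergence estimates below end in a comparison with exp(-k |n|).\<close>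

lemma quadratic_le_linear:
  fixes c K x :: real
  assumes "c > 0"
  shows "- c * x\<^sup>2 + K * x \<le> (K + 1)\<^sup>2 / (4 * c) - x"
proof -
  have "0 \<le> (2 * c * x - (K + 1))\<^sup>2 / (4 * c)" using assms by simp
  also have "\<dots> = c * x\<^sup>2 - (K + 1) * x + (K + 1)\<^sup>2 / (4 * c)"
    using assms by (simp add: field_simps power2_eq_square)
  finally show ?thesis by (simp add: algebra_simps)
qed

text \<open>Along an enumeration of the countable index type the unconditional sum becomes a series.
  The tails of \<open>B\<close> control the tails of the derivatives simultaneously on all of
  \<open>S\<close>, which is the uniformity that termwise differentiation asks for.\<close>

lemma has_derivative_infsum:
  fixes f :: "'i::countable \<Rightarrow> 'a::real_normed_vector \<Rightarrow> 'b::banach"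
  assumes inf: "infinite (UNIV :: 'i set)" and S: "convex S" "open S" "x \<in> S"
    and deriv: "\<And>i x. x \<in> S \<Longrightarrow> (f i has_derivative f' i x) (at x)"
    and bound: "\<And>i x h. x \<in> S \<Longrightarrow> norm (f' i x h) \<le> B i * norm h"
    and B: "B summable_on UNIV"
    and sm: "\<And>x. x \<in> S \<Longrightarrow> (\<lambda>i. norm (f i x)) summable_on UNIV"
  shows "((\<lambda>x. \<Sum>\<^sub>\<infinity>i. f i x) has_derivative (\<lambda>h. \<Sum>\<^sub>\<infinity>i. f' i x h)) (at x)"
proof -
  define e where "e = from_nat_into (UNIV :: 'i set)"
  have bij: "bij_betw e UNIV UNIV"
    unfolding e_def by (rule bij_betw_from_nat_into) (use inf in auto)
  have to_series: "infsum g UNIV = (\<Sum>n. g (e n))" "(\<lambda>n. g (e n)) sums infsum g UNIV"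
    if "(\<lambda>i. norm (g i)) summable_on UNIV" for g :: "'i \<Rightarrow> 'b"
  proof -
    have "(g has_sum infsum g UNIV) UNIV"
      using that by (simp add: abs_summable_summable)
    then have "((\<lambda>n. g (e n)) has_sum infsum g UNIV) UNIV"
      using has_sum_reindex_bij_betw [OF bij, of g] by simp
    then show "(\<lambda>n. g (e n)) sums infsum g UNIV" by (rule has_sum_imp_sums)
    then show "infsum g UNIV = (\<Sum>n. g (e n))" by (simp add: sums_iff)
  qed
  have Be: "summable (\<lambda>n. B (e n))"
    using summable_on_reindex_bij_betw [OF bij, of B] B
    by (simp add: summable_on_imp_summable)
  have sm': "(\<lambda>i. norm (f' i x h)) summable_on UNIV" if "x \<in> S" for x h
    by (rule summable_on_comparison_test [where f = "\<lambda>i. B i * norm h"])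
       (use that bound B in \<open>auto intro: summable_on_cmult_left\<close>)
  have "\<exists>g. \<forall>x\<in>S. (\<lambda>n. f (e n) x) sums (g x) \<and>
          (g has_derivative (\<lambda>h. \<Sum>\<^sub>\<infinity>i. f' i x h)) (at x within S)"
  proof (rule has_derivative_series [OF S(1) _ _ S(3)])
    show "(f (e n) has_derivative f' (e n) x) (at x within S)" if "x \<in> S" for n x
      using deriv [OF that] has_derivative_at_withinI by blast
    show "(\<lambda>n. f (e n) x) sums (\<Sum>\<^sub>\<infinity>i. f i x)"
      using to_series(2) [OF sm [OF S(3)]] .
    fix \<epsilon> :: real assume "\<epsilon> > 0"
    then obtain N where N: "\<And>n. n \<ge> N \<Longrightarrow> norm (\<Sum>i. B (e (i + n))) < \<epsilon>"
      using suminf_exist_split [OF _ Be, of \<epsilon>] by blast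
    show "\<forall>\<^sub>F n in sequentially. \<forall>x\<in>S. \<forall>h.
        norm ((\<Sum>i<n. f' (e i) x h) - (\<Sum>\<^sub>\<infinity>i. f' i x h)) \<le> \<epsilon> * norm h"
      unfolding eventually_sequentially
    proof (intro exI [of _ N] allI impI ballI)
      fix n x h assume n: "N \<le> n" and x: "x \<in> S"
      have s: "summable (\<lambda>n. f' (e n) x h)" "(\<Sum>\<^sub>\<infinity>i. f' i x h) = (\<Sum>i. f' (e i) x h)"
        using to_series [OF sm' [OF x]] by (auto simp: sums_iff)
      have Bs: "summable (\<lambda>i. B (e (i + n)) * norm h)"
        using Be summable_ignore_initial_segment summable_mult2 by blast
      have "(\<Sum>\<^sub>\<infinity>i. f' i x h) = (\<Sum>i. f' (e (i + n)) x h) + (\<Sum>i<n. f' (e i) x h)"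
        using suminf_split_initial_segment [OF s(1), of n] s(2) by simp
      then have "norm ((\<Sum>i<n. f' (e i) x h) - (\<Sum>\<^sub>\<infinity>i. f' i x h)) = norm (\<Sum>i. f' (e (i + n)) x h)"
        by simp
      also have "\<dots> \<le> (\<Sum>i. B (e (i + n)) * norm h)"
        by (rule norm_suminf_le [OF _ Bs]) (rule bound [OF x])
      also have "\<dots> = (\<Sum>i. B (e (i + n))) * norm h"
        by (rule suminf_mult2 [symmetric]) (use Be summable_ignore_initial_segment in blast)
      also have "\<dots> \<le> \<epsilon> * norm h"
        using N [OF n] by (intro mult_right_mono) auto
      finally show "norm ((\<Sum>i<n. f' (e i) x h) - (\<Sum>\<^sub>\<infinity>i. f' i x h)) \<le> \<epsilon> * norm h" .
    qed
  qed
  then obtain g where g: "\<And>x. x \<in> S \<Longrightarrow> (\<lambda>n. f (e n) x) sums (g x)"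
    "\<And>x. x \<in> S \<Longrightarrow> (g has_derivative (\<lambda>h. \<Sum>\<^sub>\<infinity>i. f' i x h)) (at x within S)" by blast
  have "(g has_derivative (\<lambda>h. \<Sum>\<^sub>\<infinity>i. f' i x h)) (at x)"
    using g(2) [OF S(3)] at_within_open [OF S(3,2)] by simp
  then show ?thesis
  proof (rule has_derivative_transform_within_open [OF _ S(2,3)])
    show "g y = (\<Sum>\<^sub>\<infinity>i. f i y)" if "y \<in> S" for y
      using g(1) [OF that] to_series(2) [OF sm [OF that]] sums_unique2 by blast
  qed
qed

section \<open>The exponential \<open>ee\<close>\<close>

lemma ee_add: "ee (x + y) = ee x * ee y"
  by (simp add: ee_def exp_add algebra_simps)

lemma ee_diff: "ee (x - y) = ee x / ee y"
  by (simp add: ee_def exp_diff algebra_simps)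

lemma ee_minus: "ee (- x) = 1 / ee x"
  by (simp add: ee_def exp_minus field_simps)

lemma ee_0 [simp]: "ee 0 = 1"
  by (simp add: ee_def)

lemma ee_nonzero [simp]: "ee x \<noteq> 0"
  by (simp add: ee_def)

lemma ee_of_int [simp]: "ee (of_int n) = 1"
  using exp_plus_2pin [of 0 n] by (simp add: ee_def mult_ac)

lemma ee_Ints: "x \<in> \<int> \<Longrightarrow> ee x = 1"
  by (auto elim!: Ints_cases)

lemma ee_eq_1_iff: "ee x = 1 \<longleftrightarrow> x \<in> \<int>"
proof
  assume "ee x = 1"
  then obtain n :: int where "Re (2 * of_real pi * \<i> * x) = 0" "Im (2 * of_real pi * \<i> * x) = of_int (2 * n) * pi"
    unfolding ee_def exp_eq_1 by auto
  then have "x = of_int n" by (simp add: complex_eq_iff)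
  then show "x \<in> \<int>" by simp
qed (rule ee_Ints)

lemma ee_power: "ee x ^ n = ee (of_nat n * x)"
  by (simp add: ee_def exp_of_nat_mult [symmetric] mult_ac)

lemma norm_ee: "norm (ee x) = exp (- 2 * pi * Im x)"
  by (simp add: ee_def)

lemma ee_half: "ee (1 / 2) = - 1"
  using exp_pi_i' by (simp add: ee_def)

section \<open>Fourier uniqueness and theta inversion\<close>

lemma ee_eq_ee_imp: 
  assumes "ee x = ee y" shows "\<exists>n::int. x = y + of_int n"
proof -
  have "ee (x - y) = 1" using assms by (simp add: ee_diff)
  then obtain n where "x - y = of_int n" unfolding ee_eq_1_iff by (auto elim: Ints_cases)
  then have "x = y + of_int n" by (simp add: algebra_simps)
  then show ?thesis ..
qed

lemma periodic_int:
  fixes g :: "real \<Rightarrow> 'a"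
  assumes "\<And>x. g (x + 1) = g x"
  shows "g (x + of_int n) = g x"
proof (induction n rule: int_induct [where k = 0])
  case (step1 i)
  then show ?case using assms [of "x + of_int i"] by (simp add: add_ac)
next
  case (step2 i)
  then show ?case using assms [of "x + of_int i - 1"] by (simp add: algebra_simps)
qed simp

text \<open>The argument \<open>Im (Ln z) / (2 * pi)\<close> jumps by 1 across the negative real
  axis, and periodicity of \<open>g\<close> hides the jump. Continuity is glued from two open arcs;
  on the second the argument is taken through \<open>Ln (- z)\<close> and corrected by 1/2.\<close>

lemma continuous_on_circle_lift:
  fixes g :: "real \<Rightarrow> complex"
  assumes per: "\<And>x. g (x + 1) = g x" and cont: "continuous_on UNIV g"
  obtains G where "continuous_on (sphere 0 1) G" "\<And>x. G (ee (of_real x)) = g x"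
proof -
  define G where "G = (\<lambda>z. g (Im (Ln z) / (2 * pi)))"
  have G: "G (ee (of_real x)) = g x" for x
  proof -
    have "ee (of_real (Im (Ln (ee (of_real x))) / (2 * pi))) = exp (\<i> * of_real (Im (Ln (ee (of_real x)))))"
      by (simp add: ee_def)
    also have "\<dots> = exp (Ln (ee (of_real x)))"
      by (rule arg_cong [where f = exp], rule complex_eqI) (auto simp: norm_ee)
    also have "\<dots> = ee (of_real x)" by simp
    finally obtain n :: int where
      "(of_real (Im (Ln (ee (of_real x))) / (2 * pi)) :: complex) = of_real x + of_int n"
      using ee_eq_ee_imp by blast
    then have "Im (Ln (ee (of_real x))) / (2 * pi) = x + of_int n"
      by (metis of_real_add of_real_eq_iff of_real_of_int_eq)
    then show ?thesis using periodic_int [of g x n] per by (simp add: G_def)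
  qed
  define A where "A = sphere 0 1 - (\<real>\<^sub>\<le>\<^sub>0 :: complex set)"
  define B where "B = sphere 0 1 - uminus ` (\<real>\<^sub>\<le>\<^sub>0 :: complex set)"
  have circ: "\<exists>x. z = ee (of_real x)" if "norm z = 1" for z
  proof -
    have "z \<noteq> 0" using that by auto
    then have "z = exp (Ln z)" by simp
    also have "\<dots> = ee (of_real (Im (Ln z) / (2 * pi)))"
      unfolding ee_def
      by (rule arg_cong [where f = exp], rule complex_eqI) (use \<open>z \<noteq> 0\<close> that in auto)
    finally show ?thesis by blast
  qed
  have cont': "continuous_on C (\<lambda>z. g (h z))" if "continuous_on C h" for C :: "complex set" and h
    using continuous_on_compose2 [OF cont that] by auto
  have AB: "A \<union> B = sphere 0 1"
  proof -
    have "z \<in> A \<union> B" if "z \<in> sphere 0 1" for z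
    proof (rule ccontr)
      assume "z \<notin> A \<union> B"
      then have "z \<in> \<real>\<^sub>\<le>\<^sub>0" "z \<in> uminus ` \<real>\<^sub>\<le>\<^sub>0" using that by (auto simp: A_def B_def)
      then have "z = 0" by (auto simp: complex_nonpos_Reals_iff complex_eq_iff)
      then show False using that by simp
    qed
    then show ?thesis unfolding A_def B_def by blast
  qed
  have cl: "closed (uminus ` (\<real>\<^sub>\<le>\<^sub>0 :: complex set))"
    by (rule closed_negations) simp
  have "continuous_on (A \<union> B) G"
  proof (rule continuous_on_Un_local_open)
    show "openin (top_of_set (A \<union> B)) A"
      unfolding AB openin_open
      by (rule exI [of _ "- \<real>\<^sub>\<le>\<^sub>0"]) (auto simp: A_def open_Compl)
    show "openin (top_of_set (A \<union> B)) B"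
      unfolding AB openin_open
      by (rule exI [of _ "- uminus ` \<real>\<^sub>\<le>\<^sub>0"]) (use cl in \<open>auto simp: B_def open_Compl\<close>)
    show "continuous_on A G"
      unfolding G_def by (rule cont') (auto intro!: continuous_intros simp: A_def)
    have "continuous_on B (\<lambda>z. g (Im (Ln (- z)) / (2 * pi) + 1 / 2))"
    proof (rule cont')
      have "- z \<notin> \<real>\<^sub>\<le>\<^sub>0" if "z \<in> B" for z
        using that unfolding B_def by (metis DiffD2 add.inverse_inverse image_eqI)
      then show "continuous_on B (\<lambda>z. Im (Ln (- z)) / (2 * pi) + 1 / 2)"
        by (auto intro!: continuous_intros)
    qed
    moreover have "G z = g (Im (Ln (- z)) / (2 * pi) + 1 / 2)" if "z \<in> B" for z
    proof -
      have "norm z = 1" using that by (auto simp: B_def)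
      then obtain x where "- z = ee (of_real x)" using circ [of "- z"] by auto
      then have "z = ee (of_real (x + 1/2))"
        using ee_half by (metis add.inverse_inverse ee_add mult.commute mult_minus1 of_real_add of_real_1 of_real_divide of_real_numeral)
      then have "G z = g (x + 1/2)" using G [of "x + 1/2"] by simp
      moreover have "g (Im (Ln (- z)) / (2 * pi) + 1 / 2) = g (x + 1/2)"
      proof -
        have *: "- z \<noteq> 0" using \<open>norm z = 1\<close> by auto
        have "ee (of_real (Im (Ln (- z)) / (2 * pi))) = exp (\<i> * of_real (Im (Ln (- z))))"
          by (simp add: ee_def)
        also have "\<dots> = exp (Ln (- z))"
          by (rule arg_cong [where f = exp], rule complex_eqI)
             (use \<open>norm z = 1\<close> in \<open>auto simp: Re_Ln [OF *]\<close>)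
        also have "\<dots> = ee (of_real x)" using \<open>- z = _\<close> by simp
        finally obtain n :: int where
          "(of_real (Im (Ln (- z)) / (2 * pi)) :: complex) = of_real x + of_int n"
          using ee_eq_ee_imp by blast
        then have "Im (Ln (- z)) / (2 * pi) = x + of_int n"
          by (metis of_real_add of_real_eq_iff of_real_of_int_eq)
        then show ?thesis using periodic_int [of g "x + 1/2" n] per by (simp add: add_ac)
      qed
      ultimately show ?thesis by simp
    qed
    ultimately show "continuous_on B G" by (simp cong: continuous_on_cong)
  qed
  then show ?thesis using that G AB by simp
qed

lemma continuous_on_ee [continuous_intros]:
  "continuous_on A f \<Longrightarrow> continuous_on A (\<lambda>x. ee (f x))"
  unfolding ee_def by (intro continuous_intros)

text \<open>The zero set of the Fourier moments is a module over the trigonometric polynomials, which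
  are dense by Stone--Weierstrass.\<close>

lemma fourier_coefficients_zero:
  fixes g :: "real \<Rightarrow> complex"
  assumes per: "\<And>x. g (x + 1) = g x" and cont: "continuous_on UNIV g"
    and zero: "\<And>n::int. integral {0..1} (\<lambda>x. g x * ee (of_int n * of_real x)) = 0"
  shows "g x = 0"
proof -
  define Z where "Z = (\<lambda>\<psi>::real \<Rightarrow> complex. continuous_on UNIV \<psi> \<and>
    (\<forall>n::int. integral {0..1} (\<lambda>x. \<psi> x * ee (of_int n * of_real x)) = 0))"
  have cont01: "continuous_on {0..1} \<psi>" if "continuous_on UNIV \<psi>" for \<psi> :: "real \<Rightarrow> complex"
    using that continuous_on_subset by blast
  have Zg: "Z g" using cont zero by (simp add: Z_def)
  have Z_add: "Z (\<lambda>x. \<phi> x + \<psi> x)" if "Z \<phi>" "Z \<psi>" for \<phi> \<psi>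
  proof -
    have "integral {0..1} (\<lambda>x. (\<phi> x + \<psi> x) * ee (of_int n * of_real x)) = 0" for n :: int
      using that unfolding Z_def distrib_right
      by (subst integral_add) (auto intro!: integrable_continuous_real continuous_intros cont01)
    then show ?thesis using that by (auto simp: Z_def intro!: continuous_intros)
  qed
  have Z_scale: "Z (\<lambda>x. c * \<psi> x)" if "Z \<psi>" for \<psi> c
    using that by (auto simp: Z_def mult.assoc intro!: continuous_intros)
  have Z_shift: "Z (\<lambda>x. ee (of_int m * of_real x) * \<psi> x)" if "Z \<psi>" for \<psi> and m :: int
  proof -
    have "(\<lambda>x. ee (of_int m * of_real x) * \<psi> x * ee (of_int n * of_real x)) =
        (\<lambda>x. \<psi> x * ee (of_int (m + n) * of_real x))" for n :: int
      by (simp add: ee_add distrib_right fun_eq_iff)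
    then show ?thesis using that unfolding Z_def
      by (auto intro!: continuous_intros simp del: of_int_add)
  qed
  \<comment> \<open>\<psi> stays arbitrary in the induction because the product case applies the
    hypothesis for one factor to \<psi> already multiplied by the other.\<close>
  have Z_poly: "Z (\<lambda>x. of_real (P (ee (of_real x))) * \<psi> x)"
    if "real_polynomial_function P" "Z \<psi>" for P :: "complex \<Rightarrow> real" and \<psi>
    using that
  proof (induction arbitrary: \<psi>)
    case (linear f)
    have f: "f z = Re z * f 1 + Im z * f \<i>" for z
    proof -
      have "z = Re z *\<^sub>R 1 + Im z *\<^sub>R \<i>" by (simp add: complex_eq_iff)
      then have "f z = f (Re z *\<^sub>R 1 + Im z *\<^sub>R \<i>)" by (rule arg_cong)
      also have "\<dots> = Re z * f 1 + Im z * f \<i>"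
        using linear.hyps by (simp add: linear_simps)
      finally show ?thesis .
    qed
    \<comment> \<open>A real-linear form on the plane is c z + d cnj z, and on the unit circle cnj z
      = 1/z. So it is a trigonometric polynomial of degree one.\<close>
    define c where "c = (of_real (f 1) - \<i> * of_real (f \<i>)) / 2"
    define d where "d = (of_real (f 1) + \<i> * of_real (f \<i>)) / 2"
    have "of_real (f (ee (of_real x))) =
        c * ee (of_int 1 * of_real x) + d * ee (of_int (- 1) * of_real x)" for x
    proof -
      define y where "y = 2 * pi * x"
      have 1: "ee (of_real x) = cis y" "ee (- of_real x) = cis (- y)"
        by (simp_all add: ee_def cis_conv_exp y_def mult_ac)
      have "of_real (f (cis y)) = c * cis y + d * cis (- y)"
        unfolding f [of "cis y"] c_def d_def by (simp add: complex_eq_iff algebra_simps add_divide_distrib diff_divide_distrib)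
      then show ?thesis by (simp add: 1)
    qed
    then have "(\<lambda>x. of_real (f (ee (of_real x))) * \<psi> x) =
      (\<lambda>x. c * (ee (of_int 1 * of_real x) * \<psi> x) + d * (ee (of_int (- 1) * of_real x) * \<psi> x))"
      by (auto simp: algebra_simps)
    moreover have "Z \<dots>" by (intro Z_add Z_scale Z_shift linear)
    ultimately show ?case by simp
  next
    case (const c)
    then show ?case using Z_scale by blast
  next
    case (add f h)
    then have "Z (\<lambda>x. of_real (f (ee (of_real x))) * \<psi> x + of_real (h (ee (of_real x))) * \<psi> x)"
      by (intro Z_add)
    then show ?case by (simp add: distrib_right)
  next
    case (mult f h)
    then have "Z (\<lambda>x. of_real (f (ee (of_real x))) * (of_real (h (ee (of_real x))) * \<psi> x))"
      by blast
    then show ?case by (simp add: mult.assoc)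
  qed
  \<comment> \<open>The function to be approximated is the conjugate of \<open>g\<close>. Since P(ee
    x) g has mean 0 for every polynomial P, the mean \<open>J\<close> of |g|^2 equals the mean of g
    times the approximation error, which is as small as desired.\<close>
  obtain G where G: "continuous_on (sphere 0 1) G" "\<And>x. G (ee (of_real x)) = cnj (g x)"
    by (rule continuous_on_circle_lift [of "\<lambda>x. cnj (g x)"])
       (use per cont in \<open>auto intro: continuous_on_cnj\<close>)
  have I: "\<psi> integrable_on {0..1}" if "continuous_on UNIV \<psi>" for \<psi> :: "real \<Rightarrow> complex"
    using that by (intro integrable_continuous_real cont01)
  define J where "J = integral {0..1} (\<lambda>x. g x * cnj (g x))"
  obtain K where K: "K > 0" "\<And>x. x \<in> {0..1} \<Longrightarrow> norm (g x) \<le> K"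
  proof -
    have "bounded (g ` {0..1})"
      by (intro compact_imp_bounded compact_continuous_image cont01 cont) auto
    then show ?thesis using that unfolding bounded_pos by blast
  qed
  have "norm J \<le> K * e" if "e > 0" for e
  proof -
    obtain P where P: "polynomial_function P" "\<And>z. z \<in> sphere 0 1 \<Longrightarrow> norm (G z - P z) < e"
      using Stone_Weierstrass_polynomial_function [OF _ G(1) \<open>e > 0\<close>] by auto
    have "real_polynomial_function (Re \<circ> P)" "real_polynomial_function (Im \<circ> P)"
      using P(1) bounded_linear_Re bounded_linear_Im unfolding polynomial_function_def by blast+
    then have "Z (\<lambda>x. of_real ((Re \<circ> P) (ee (of_real x))) * g x +
        \<i> * (of_real ((Im \<circ> P) (ee (of_real x))) * g x))"
      by (intro Z_add Z_scale Z_poly Zg)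
    moreover have "of_real ((Re \<circ> P) z) * g x + \<i> * (of_real ((Im \<circ> P) z) * g x) = P z * g x" for z x
      by (subst complex_eq [of "P z"]) (simp add: distrib_right mult.assoc)
    ultimately have ZP: "Z (\<lambda>x. P (ee (of_real x)) * g x)" by simp
    then have "integral {0..1} (\<lambda>x. P (ee (of_real x)) * g x * ee (of_int 0 * of_real x)) = 0"
      unfolding Z_def by blast
    then have "J = J - integral {0..1} (\<lambda>x. P (ee (of_real x)) * g x)" by simp
    also have "\<dots> = integral {0..1} (\<lambda>x. g x * cnj (g x) - P (ee (of_real x)) * g x)"
      unfolding J_def using ZP cont
      by (subst integral_diff) (auto simp: Z_def intro!: I continuous_intros)
    also have "norm \<dots> \<le> K * e * (1 - 0)"
    proof (rule integral_bound)
      have "continuous_on UNIV (\<lambda>x. P (ee (of_real x)) * g x)" using ZP by (simp add: Z_def)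
      moreover have "continuous_on UNIV (\<lambda>x. g x * cnj (g x))"
        by (intro continuous_intros cont)
      ultimately have "continuous_on UNIV (\<lambda>x. g x * cnj (g x) - P (ee (of_real x)) * g x)"
        by (rule continuous_on_diff [rotated])
      then show "continuous_on {0..1} (\<lambda>x. g x * cnj (g x) - P (ee (of_real x)) * g x)"
        by (rule cont01)
      show "norm (g x * cnj (g x) - P (ee (of_real x)) * g x) \<le> K * e" if "x \<in> {0..1}" for x
      proof -
        have "norm (g x * cnj (g x) - P (ee (of_real x)) * g x) =
            norm (g x) * norm (G (ee (of_real x)) - P (ee (of_real x)))"
          by (simp add: G(2) algebra_simps flip: norm_mult)
        also have "\<dots> \<le> K * e"
          using K(2) [of x] P(2) [of "ee (of_real x)"] that K(1)
          by (intro mult_mono) (auto simp: norm_ee intro: less_imp_le)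
        finally show ?thesis .
      qed
    qed (use K(1) \<open>e > 0\<close> in auto)
    finally show ?thesis by simp
  qed
  note bound = this
  have "norm J \<le> 0 + e" if "e > 0" for e
    using bound [of "e / K"] that K(1) by simp
  then have "norm J \<le> 0" by (rule field_le_epsilon)
  then have "Re J = 0" by simp
  moreover have "Re J = integral {0..1} (\<lambda>x. (norm (g x))\<^sup>2)"
  proof -
    have "(\<lambda>x. g x * cnj (g x)) integrable_on {0..1}"
      by (intro I continuous_intros cont)
    then have "integral {0..1} (\<lambda>x. Re (g x * cnj (g x))) = Re J"
      unfolding J_def by (rule integral_linear [OF _ bounded_linear_Re, unfolded o_def])
    moreover have "Re (g x * cnj (g x)) = (norm (g x))\<^sup>2" for x
      by (simp only: complex_norm_square [symmetric] Re_complex_of_real)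
    ultimately show ?thesis by simp
  qed
  moreover have "continuous_on {0..1} (\<lambda>x. (norm (g x))\<^sup>2)"
    using cont01 [OF cont] by (intro continuous_intros)
  ultimately have "\<forall>x \<in> {0..1}. (norm (g x))\<^sup>2 = 0"
    by (simp add: integral_eq_0_iff)
  then have z: "g x = 0" if "x \<in> {0..1}" for x using that by simp
  have "g x = g (frac x + of_int \<lfloor>x\<rfloor>)" by (simp add: frac_def)
  also have "\<dots> = g (frac x)" by (rule periodic_int) (rule per)
  also have "\<dots> = 0" using frac_ge_0 [of x] frac_lt_1 [of x] by (intro z) simp
  finally show ?thesis .
qed

text \<open>This is the characteristic function of the standard normal law after the substitution x
  -> c x, with c chosen so that (c x)^2 / 2 = pi t x^2 and s so that s c = 2 pi \<xi>.\<close>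

lemma gaussian_fourier:
  fixes t \<xi> :: real
  assumes "t > 0"
  shows "integrable lborel (\<lambda>x. ee (of_real (\<xi> * x)) * of_real (exp (- pi * t * x\<^sup>2)))" (is ?I)
    and "(LINT x|lborel. ee (of_real (\<xi> * x)) * of_real (exp (- pi * t * x\<^sup>2))) =
           of_real (exp (- pi * \<xi>\<^sup>2 / t) / sqrt t)" (is ?V)
proof -
  define c where "c = sqrt (2 * pi * t)"
  define s where "s = 2 * pi * \<xi> / c"
  have c: "c > 0" "c\<^sup>2 = 2 * pi * t" using assms by (simp_all add: c_def)
  define F where "F = (\<lambda>x. std_normal_density x *\<^sub>R iexp (s * x))"
  have F_int: "integrable lborel F"
    unfolding F_def
    by (rule Bochner_Integration.integrable_bound [OF integrable_normal_density [of 1 0]]) auto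
  have Fc: "F (0 + c * x) = of_real (1 / sqrt (2 * pi)) *
      (ee (of_real (\<xi> * x)) * of_real (exp (- pi * t * x\<^sup>2)))" for x
  proof -
    have "- (c * x)\<^sup>2 / 2 = - pi * t * x\<^sup>2" using c(2) by (simp add: power_mult_distrib)
    moreover have "iexp (s * (c * x)) = ee (of_real (\<xi> * x))"
      using c(1) by (simp add: s_def ee_def mult_ac)
    ultimately show ?thesis
      unfolding F_def std_normal_density_def by (simp add: scaleR_conv_of_real mult_ac)
  qed
  have "integrable lborel (\<lambda>x. F (0 + c * x))"
    using F_int c(1) by (subst lborel_integrable_real_affine_iff) auto
  then have "integrable lborel (\<lambda>x. of_real (sqrt (2 * pi)) * F (0 + c * x))" by simp
  then show ?I unfolding Fc by (simp flip: of_real_mult mult.assoc)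
  have "of_real (exp (- s\<^sup>2 / 2)) = char std_normal_distribution s"
    by (simp add: char_std_normal_distribution)
  also have "\<dots> = (LINT x|lborel. F x)"
    unfolding char_def F_def by (subst integral_density) auto
  also have "\<dots> = c *\<^sub>R (LINT x|lborel. F (0 + c * x))"
    using c(1) by (subst lborel_integral_real_affine [of c _ 0]) auto
  also have "\<dots> = of_real (c / sqrt (2 * pi)) *
     (LINT x|lborel. ee (of_real (\<xi> * x)) * of_real (exp (- pi * t * x\<^sup>2)))"
    unfolding Fc by (simp add: scaleR_conv_of_real)
  also have "c / sqrt (2 * pi) = sqrt t" by (simp add: c_def real_sqrt_mult)
  finally have "(LINT x|lborel. ee (of_real (\<xi> * x)) * of_real (exp (- pi * t * x\<^sup>2))) =
      of_real (exp (- s\<^sup>2 / 2) / sqrt t)"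
    using assms by (simp add: field_simps)
  moreover have "- s\<^sup>2 / 2 = - pi * \<xi>\<^sup>2 / t"
    using c assms by (simp add: s_def power_divide power_mult_distrib field_simps power2_eq_square)
  ultimately show ?V by simp
qed

section \<open>Interchange of sums and integrals, and Poisson summation\<close>

lemma continuous_on_infsum:
  fixes f :: "'i \<Rightarrow> 'a::topological_space \<Rightarrow> 'b::banach"
  assumes "\<And>i. continuous_on A (f i)" and "\<And>i x. x \<in> A \<Longrightarrow> norm (f i x) \<le> B i"
    and "B summable_on UNIV"
  shows "continuous_on A (\<lambda>x. \<Sum>\<^sub>\<infinity>i. f i x)"
proof (rule uniform_limit_theorem)
  show "uniform_limit A (\<lambda>X y. \<Sum>x\<in>X. f x y) (\<lambda>y. \<Sum>\<^sub>\<infinity>x. f x y) (finite_subsets_at_top UNIV)"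
    by (rule Weierstrass_m_test_general) (use assms in auto)
qed (auto intro!: always_eventually continuous_on_sum assms)

lemma has_sum_integral_Icc:
  fixes f :: "'i \<Rightarrow> real \<Rightarrow> complex"
  assumes cont: "\<And>i. continuous_on {a..b} (f i)"
    and bound: "\<And>i x. x \<in> {a..b} \<Longrightarrow> norm (f i x) \<le> B i"
    and B: "B summable_on UNIV"
  shows "((\<lambda>i. integral {a..b} (f i)) has_sum integral {a..b} (\<lambda>x. \<Sum>\<^sub>\<infinity>i. f i x)) UNIV"
proof -
  have ul: "uniform_limit {a..b} (\<lambda>X y. \<Sum>x\<in>X. f x y) (\<lambda>y. \<Sum>\<^sub>\<infinity>x. f x y) (finite_subsets_at_top UNIV)"
    by (rule Weierstrass_m_test_general) (use assms in auto)
  obtain I J where I: "\<And>X. ((\<lambda>y. \<Sum>x\<in>X. f x y) has_integral I X) {a..b}"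
    and J: "((\<lambda>y. \<Sum>\<^sub>\<infinity>x. f x y) has_integral J) {a..b}"
    and lim: "(I \<longlongrightarrow> J) (finite_subsets_at_top UNIV)"
    by (rule uniform_limit_integral [OF ul]) (auto intro!: continuous_on_sum cont)
  have "I X = (\<Sum>i\<in>X. integral {a..b} (f i))" if "finite X" for X
    using I [of X] cont integral_sum [OF that, of f "{a..b}"]
    by (simp add: integrable_continuous_real integral_unique)
  then have "((\<lambda>X. \<Sum>i\<in>X. integral {a..b} (f i)) \<longlongrightarrow> J) (finite_subsets_at_top UNIV)"
    by (intro Lim_transform_eventually [OF lim])
       (auto intro: eventually_finite_subsets_at_top_weakI)
  then show ?thesis using J by (simp add: has_sum_def integral_unique)
qed

text \<open>The half-open unit intervals tile the line, and each differs from a closed one by a null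
  set. Countable additivity yields a series in one enumeration only; the summability hypothesis
  promotes it to an unconditional sum.\<close>

lemma has_sum_unit_integrals:
  fixes f :: "real \<Rightarrow> complex"
  assumes int: "integrable lborel f"
    and sm: "(\<lambda>b::int. norm (integral {0..1} (\<lambda>x. f (x + of_int b)))) summable_on UNIV"
  shows "((\<lambda>b::int. integral {0..1} (\<lambda>x. f (x + of_int b))) has_sum (LINT x|lborel. f x)) UNIV"
proof -
  define e where "e = from_nat_into (UNIV :: int set)"
  have bij: "bij_betw e UNIV UNIV"
    unfolding e_def by (rule bij_betw_from_nat_into) auto
  define A where "A = (\<lambda>i. {real_of_int (e i) ..< real_of_int (e i) + 1})"
  have UN: "(\<Union>i. A i) = UNIV"
  proof -
    have "x \<in> (\<Union>i. A i)" for x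
    proof -
      obtain i where "e i = \<lfloor>x\<rfloor>" using bij by (metis bij_betw_def rangeE UNIV_I)
      then have "x \<in> A i" by (simp add: A_def)
      then show ?thesis by blast
    qed
    then show ?thesis by blast
  qed
  have disj: "A i \<inter> A j = {}" if "i \<noteq> j" for i j
  proof -
    have "e i \<noteq> e j" using that bij by (metis bij_betw_def injD)
    moreover have "e i = e j" if "x \<in> A i" "x \<in> A j" for x
      using that unfolding A_def atLeastLessThan_iff by linarith
    ultimately show ?thesis by blast
  qed
  have pc: "(LINT x:A i|lborel. f x) = integral {0..1} (\<lambda>x. f (x + of_int (e i)))" for i
  proof -
    have "set_integrable lborel (A i) f"
      unfolding set_integrable_def by (rule integrable_mult_indicator) (auto simp: A_def int)
    then have "(LINT x:A i|lborel. f x) = integral (A i) f"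
      by (rule set_borel_integral_eq_integral)
    also have "\<dots> = integral {real_of_int (e i) .. real_of_int (e i) + 1} f"
    proof (rule integral_spike_set)
      have "{x \<in> A i - {real_of_int (e i)..real_of_int (e i) + 1}. f x \<noteq> 0} \<subseteq> {real_of_int (e i) + 1}"
        by (auto simp: A_def)
      then show "negligible {x \<in> A i - {real_of_int (e i)..real_of_int (e i) + 1}. f x \<noteq> 0}"
        using negligible_subset negligible_sing by blast
      have "{x \<in> {real_of_int (e i)..real_of_int (e i) + 1} - A i. f x \<noteq> 0} \<subseteq> {real_of_int (e i) + 1}"
        by (auto simp: A_def)
      then show "negligible {x \<in> {real_of_int (e i)..real_of_int (e i) + 1} - A i. f x \<noteq> 0}"
        using negligible_subset negligible_sing by blast
    qed
    also have "\<dots> = integral {0..1} (\<lambda>x. f (x + of_int (e i)))"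
      using integral_shift_Icc_real [of 0 1 f "of_int (e i)"] by (simp add: o_def add_ac)
    finally show ?thesis .
  qed
  have "(LINT x|lborel. f x) = (LINT x:(\<Union>i. A i)|lborel. f x)"
    unfolding UN by (simp add: set_lebesgue_integral_def)
  also have "\<dots> = (\<Sum>i. LINT x:A i|lborel. f x)"
  proof (rule lebesgue_integral_countable_add)
    show "set_integrable lborel (\<Union>i. A i) f"
      unfolding UN using int by (simp add: set_integrable_def)
  qed (use disj in \<open>auto simp: A_def\<close>)
  also have "\<dots> = (\<Sum>i. integral {0..1} (\<lambda>x. f (x + of_int (e i))))" by (simp add: pc)
  finally have eq: "(LINT x|lborel. f x) = (\<Sum>i. integral {0..1} (\<lambda>x. f (x + of_int (e i))))" .
  have hs: "((\<lambda>b::int. integral {0..1} (\<lambda>x. f (x + of_int b))) has_sum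
      infsum (\<lambda>b::int. integral {0..1} (\<lambda>x. f (x + of_int b))) UNIV) UNIV"
    using sm by (simp add: abs_summable_summable)
  then have "((\<lambda>i. integral {0..1} (\<lambda>x. f (x + of_int (e i)))) has_sum
      infsum (\<lambda>b::int. integral {0..1} (\<lambda>x. f (x + of_int b))) UNIV) UNIV"
    using has_sum_reindex_bij_betw [OF bij, of "\<lambda>b. integral {0..1} (\<lambda>x. f (x + of_int b))"] by simp
  then have "infsum (\<lambda>b::int. integral {0..1} (\<lambda>x. f (x + of_int b))) UNIV = (LINT x|lborel. f x)"
    using has_sum_imp_sums eq by (metis sums_unique)
  with hs show ?thesis by simp
qed

lemma exp_neg_quadratic_int_le:
  fixes t u x :: real
  assumes "t > 0" "\<bar>x\<bar> \<le> R"
  shows "exp (- pi * t * (u + x + of_int b)\<^sup>2) \<le> exp (1 / (4 * pi * t) + \<bar>u\<bar> + R) * exp (- 1 * \<bar>of_int b\<bar>)"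
proof -
  have "- (pi * t) * \<bar>u + x + of_int b\<bar>\<^sup>2 + 0 * \<bar>u + x + of_int b\<bar> \<le>
      (0 + 1)\<^sup>2 / (4 * (pi * t)) - \<bar>u + x + of_int b\<bar>"
    by (rule quadratic_le_linear) (use assms in auto)
  moreover have "\<bar>of_int b\<bar> \<le> \<bar>u + x + of_int b\<bar> + \<bar>u\<bar> + R" using assms(2) by linarith
  ultimately show ?thesis by (simp flip: exp_add add: mult_ac)
qed

lemma norm_gaussian_term:
  fixes t \<theta> :: real and w :: complex
  shows "norm (exp (- (of_real (pi * t) * w\<^sup>2) + 2 * of_real pi * \<i> * of_real \<theta> * w)) =
    exp (pi * t * (Im w)\<^sup>2 - 2 * pi * \<theta> * Im w) * exp (- pi * t * (Re w)\<^sup>2)"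
proof -
  have "Re (w\<^sup>2) = (Re w)\<^sup>2 - (Im w)\<^sup>2" by (simp add: power2_eq_square)
  then have *: "(Re w)\<^sup>2 = Re (w\<^sup>2) + (Im w)\<^sup>2" by simp
  have "exp (pi * t * (Im w)\<^sup>2 - 2 * pi * \<theta> * Im w) * exp (- pi * t * (Re w)\<^sup>2) =
      exp (- (pi * t) * Re (w\<^sup>2) - 2 * pi * \<theta> * Im w)"
    unfolding mult_exp_exp * by (simp add: algebra_simps)
  then show ?thesis by simp
qed

text \<open>Poisson summation for a Gaussian with complex translate \<open>w\<close> and twist
  \<open>\<theta>\<close>. The periodization minus its expected Fourier series is continuous and
  1-periodic with vanishing Fourier coefficients, hence zero; the claim is its value at 0.\<close>

lemma theta_inversion_real:
  fixes t \<theta> :: real and w :: complex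
  assumes "t > 0"
  shows "(\<Sum>\<^sub>\<infinity>b::int. exp (- (of_real (pi * t) * (w + of_int b)\<^sup>2) + 2 * of_real pi * \<i> * of_real \<theta> * (w + of_int b))) =
    of_real (1 / sqrt t) * (\<Sum>\<^sub>\<infinity>n::int. of_real (exp (- pi * (of_int n - \<theta>)\<^sup>2 / t)) * ee (of_int n * w))"
proof -
  define u v where "u = Re w" and "v = Im w"
  have w: "w = of_real u + \<i> * of_real v" by (simp add: u_def v_def complex_eq_iff)
  define \<phi> where "\<phi> = (\<lambda>x::real. exp (- (of_real (pi * t) * (w + of_real x)\<^sup>2) +
      2 * of_real pi * \<i> * of_real \<theta> * (w + of_real x)))"
  \<comment> \<open>The integral of \<phi> against ee(n x) over the line. As \<phi> is tested
    against the frequency n, the Fourier series carries the frequency -n, and the index is reflected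
    at the end.\<close>
  define c where "c = (\<lambda>n::int. of_real (exp (- pi * (of_int n + \<theta>)\<^sup>2 / t) / sqrt t) * ee (- of_int n * w))"
  have cont_\<phi>: "continuous_on A (\<lambda>x. \<phi> (x + of_int b))" for A b
    unfolding \<phi>_def by (intro continuous_intros)
  define C where "C = (\<lambda>R. exp (pi * t * v\<^sup>2 - 2 * pi * \<theta> * v) * exp (1 / (4 * pi * t) + \<bar>u\<bar> + R))"
  have bound_\<phi>: "norm (\<phi> (x + of_int b)) \<le> C R * exp (- 1 * \<bar>of_int b\<bar>)" if "\<bar>x\<bar> \<le> R" for x R b
  proof -
    have "norm (\<phi> (x + of_int b)) = exp (pi * t * v\<^sup>2 - 2 * pi * \<theta> * v) *
        exp (- pi * t * (u + x + of_int b)\<^sup>2)"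
      unfolding \<phi>_def norm_gaussian_term by (simp add: u_def v_def add_ac)
    also have "\<dots> \<le> C R * exp (- 1 * \<bar>of_int b\<bar>)"
      unfolding C_def mult.assoc [of "exp (pi * t * v\<^sup>2 - 2 * pi * \<theta> * v)"]
      by (intro mult_left_mono exp_neg_quadratic_int_le assms that) auto
    finally show ?thesis .
  qed
  have sm_C: "(\<lambda>b::int. K * exp (- 1 * \<bar>of_int b\<bar>) :: real) summable_on UNIV" for K
    by (intro summable_on_cmult_right summable_on_exp_neg_abs_int) simp
  define D where "D = exp (pi * t * v\<^sup>2 - 2 * pi * \<theta> * v) * exp (1 / (4 * pi * (1 / t)) + \<bar>\<theta> - t * v\<bar> + 0) / sqrt t"
  have bound_c: "norm (c n * ee (of_int (m - n) * of_real x)) \<le> D * exp (- 1 * \<bar>of_int n\<bar>)" for n m x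
  proof -
    have "norm (c n * ee (of_int (m - n) * of_real x)) =
        exp (- pi * (of_int n + \<theta>)\<^sup>2 / t) * exp (2 * pi * of_int n * v) / sqrt t"
      using assms by (simp add: c_def norm_mult norm_ee v_def norm_divide mult_ac)
    also have "exp (- pi * (of_int n + \<theta>)\<^sup>2 / t) * exp (2 * pi * of_int n * v) =
        exp (pi * t * v\<^sup>2 - 2 * pi * \<theta> * v) * exp (- pi * (1 / t) * ((\<theta> - t * v) + 0 + of_int n)\<^sup>2)"
      unfolding mult_exp_exp
      by (rule arg_cong [where f = exp]) (use assms in \<open>simp add: field_simps power2_eq_square\<close>)
    also have "\<dots> / sqrt t \<le> exp (pi * t * v\<^sup>2 - 2 * pi * \<theta> * v) *
        (exp (1 / (4 * pi * (1 / t)) + \<bar>\<theta> - t * v\<bar> + 0) * exp (- 1 * \<bar>of_int n\<bar>)) / sqrt t"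
      by (intro divide_right_mono mult_left_mono exp_neg_quadratic_int_le) (use assms in auto)
    finally show ?thesis by (simp add: D_def)
  qed
  have hat: "(LINT x|lborel. \<phi> x * ee (of_int m * of_real x)) = c m"
    and hat_int: "integrable lborel (\<lambda>x. \<phi> x * ee (of_int m * of_real x))" for m :: int
  proof -
    \<comment> \<open>In the variable X = Re w + x the exponent is -pi t X^2 + 2 pi i \<xi> X plus a
      constant. \<open>K\<close> is the exponential of that constant, and Im w moves the frequency
      by -t Im w.\<close>
    define K where "K = exp (of_real (pi * t * v\<^sup>2 - 2 * pi * \<theta> * v) - 2 * of_real pi * \<i> * of_int m * of_real u)"
    define \<xi> where "\<xi> = \<theta> + of_int m - t * v"
    define F where "F = (\<lambda>x. ee (of_real (\<xi> * x)) * of_real (exp (- pi * t * x\<^sup>2)))"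
    have eq: "\<phi> x * ee (of_int m * of_real x) = K * F (u + 1 * x)" for x
      unfolding \<phi>_def ee_def K_def F_def \<xi>_def w exp_of_real [symmetric] mult_exp_exp
      by (rule arg_cong [where f = exp]) (simp add: complex_eq_iff algebra_simps power2_eq_square)
    have "integrable lborel (\<lambda>x. F (u + 1 * x))"
      by (subst lborel_integrable_real_affine_iff) (use gaussian_fourier(1) [OF assms, of \<xi>] in \<open>auto simp: F_def\<close>)
    then show "integrable lborel (\<lambda>x. \<phi> x * ee (of_int m * of_real x))" unfolding eq by simp
    have "(LINT x|lborel. \<phi> x * ee (of_int m * of_real x)) = K * (LINT x|lborel. F (u + 1 * x))"
      unfolding eq by simp
    also have "(LINT x|lborel. F (u + 1 * x)) = (LINT x|lborel. F x)"
      by (subst lborel_integral_real_affine [of 1 F u]) auto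
    also have "\<dots> = of_real (exp (- pi * \<xi>\<^sup>2 / t) / sqrt t)"
      unfolding F_def by (rule gaussian_fourier(2) [OF assms])
    also have "K * \<dots> = c m"
    proof -
      have "K * of_real (exp (- pi * \<xi>\<^sup>2 / t)) = of_real (exp (- pi * (of_int m + \<theta>)\<^sup>2 / t)) * ee (- of_int m * w)"
        unfolding K_def ee_def \<xi>_def exp_of_real [symmetric] mult_exp_exp
        by (rule arg_cong [where f = exp])
           (use assms in \<open>simp add: w complex_eq_iff field_simps power2_eq_square\<close>)
      then show ?thesis by (simp add: c_def)
    qed
    finally show "(LINT x|lborel. \<phi> x * ee (of_int m * of_real x)) = c m" .
  qed
  define g where "g = (\<lambda>x. (\<Sum>\<^sub>\<infinity>b::int. \<phi> (x + of_int b)) - (\<Sum>\<^sub>\<infinity>n::int. c n * ee (of_int (0 - n) * of_real x)))"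
  have cont1: "continuous_on {-R..R} (\<lambda>x. \<Sum>\<^sub>\<infinity>b::int. \<phi> (x + of_int b))" for R
    by (rule continuous_on_infsum [OF cont_\<phi> _ sm_C [of "C R"]], rule bound_\<phi>) auto
  have cont1': "continuous_on UNIV (\<lambda>x. \<Sum>\<^sub>\<infinity>b::int. \<phi> (x + of_int b))"
  proof (rule continuous_at_imp_continuous_on, rule ballI)
    fix x :: real
    show "isCont (\<lambda>x. \<Sum>\<^sub>\<infinity>b::int. \<phi> (x + of_int b)) x"
      by (rule continuous_on_interior [OF cont1 [of "\<bar>x\<bar> + 1"]]) (simp, linarith)
  qed
  have cont2: "continuous_on A (\<lambda>x. \<Sum>\<^sub>\<infinity>n::int. c n * ee (of_int (m - n) * of_real x))" for m A
    by (rule continuous_on_infsum [OF _ bound_c sm_C]) (intro continuous_intros)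
  have "g 0 = 0"
  proof (rule fourier_coefficients_zero)
    show "continuous_on UNIV g"
      unfolding g_def by (intro continuous_intros cont1' cont2)
    show "g (x + 1) = g x" for x
    proof -
      have "(\<Sum>\<^sub>\<infinity>b::int. \<phi> (x + 1 + of_int b)) = (\<Sum>\<^sub>\<infinity>b::int. \<phi> (x + of_int b))"
        by (rule infsum_reindex_bij_witness [of _ "\<lambda>b. b - 1" "\<lambda>b. b + 1"]) (auto simp: algebra_simps)
      moreover have "ee (of_int (0 - n) * of_real (x + 1)) = ee (of_int (0 - n) * of_real x)" for n :: int
      proof -
        have "of_int (0 - n) * of_real (x + 1) = of_int (0 - n) * of_real x + (of_int (- n) :: complex)"
          by (simp add: algebra_simps)
        then show ?thesis by (simp only: ee_add ee_of_int mult_1_right)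
      qed
      ultimately show ?thesis unfolding g_def by (simp only:)
    qed
    fix m :: int
    have "integral {0..1} (\<lambda>x. g x * ee (of_int m * of_real x)) =
      integral {0..1} (\<lambda>x. (\<Sum>\<^sub>\<infinity>b::int. \<phi> (x + of_int b) * ee (of_int m * of_real x)) -
        (\<Sum>\<^sub>\<infinity>n::int. c n * ee (of_int (m - n) * of_real x)))"
    proof (rule arg_cong [where f = "integral {0..1}"], rule ext)
      fix x :: real
      have "ee (of_int (0 - n) * of_real x) * ee (of_int m * of_real x) = ee (of_int (m - n) * of_real x)" for n
        unfolding ee_add [symmetric] by (rule arg_cong [where f = ee]) (simp add: algebra_simps)
      then show "g x * ee (of_int m * of_real x) = (\<Sum>\<^sub>\<infinity>b::int. \<phi> (x + of_int b) * ee (of_int m * of_real x)) -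
        (\<Sum>\<^sub>\<infinity>n::int. c n * ee (of_int (m - n) * of_real x))"
        unfolding g_def left_diff_distrib infsum_cmult_left' [symmetric] by (simp only: mult.assoc)
    qed
    also have "\<dots> = integral {0..1} (\<lambda>x. (\<Sum>\<^sub>\<infinity>b::int. \<phi> (x + of_int b) * ee (of_int m * of_real x))) -
        integral {0..1} (\<lambda>x. (\<Sum>\<^sub>\<infinity>n::int. c n * ee (of_int (m - n) * of_real x)))"
    proof (rule integral_diff)
      show "(\<lambda>x. (\<Sum>\<^sub>\<infinity>b::int. \<phi> (x + of_int b) * ee (of_int m * of_real x))) integrable_on {0..1}"
        unfolding infsum_cmult_left'
        by (intro integrable_continuous_real continuous_intros continuous_on_subset [OF cont1']) auto
      show "(\<lambda>x. (\<Sum>\<^sub>\<infinity>n::int. c n * ee (of_int (m - n) * of_real x))) integrable_on {0..1}"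
        by (intro integrable_continuous_real cont2)
    qed
    also have "integral {0..1} (\<lambda>x. (\<Sum>\<^sub>\<infinity>b::int. \<phi> (x + of_int b) * ee (of_int m * of_real x))) = c m"
    proof -
      \<comment> \<open>ee(m x) does not notice a shift by the integer b, so the integrals over
        [0,1] are the unit pieces of a single integral over the line.\<close>
      have *: "\<phi> (x + of_int b) * ee (of_int m * of_real x) =
          \<phi> (x + of_int b) * ee (of_int m * of_real (x + of_int b))" for x and b :: int
      proof -
        have "of_int m * of_real (x + of_int b) = of_int m * of_real x + (of_int (m * b) :: complex)"
          by (simp add: algebra_simps)
        then show ?thesis by (simp only: ee_add ee_of_int mult_1_right)
      qed
      have bd: "norm (\<phi> (x + of_int b) * ee (of_int m * of_real x)) \<le> C 1 * exp (- 1 * \<bar>of_int b\<bar>)"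
        if "x \<in> {0..1}" for x b
        using bound_\<phi> [of x 1 b] that by (simp add: norm_mult norm_ee)
      have hs: "((\<lambda>b::int. integral {0..1} (\<lambda>x. \<phi> (x + of_int b) * ee (of_int m * of_real x))) has_sum
         integral {0..1} (\<lambda>x. (\<Sum>\<^sub>\<infinity>b::int. \<phi> (x + of_int b) * ee (of_int m * of_real x)))) UNIV"
        by (rule has_sum_integral_Icc [OF _ bd sm_C]) (intro continuous_intros cont_\<phi>)
      have sm: "(\<lambda>b::int. norm (integral {0..1} (\<lambda>x. \<phi> (x + of_int b) * ee (of_int m * of_real x)))) summable_on UNIV"
      proof (rule summable_on_comparison_test [OF sm_C [of "C 1"]])
        fix b :: int
        have "norm (integral {0..1} (\<lambda>x. \<phi> (x + of_int b) * ee (of_int m * of_real x)))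
             \<le> C 1 * exp (- 1 * \<bar>of_int b\<bar>) * (1 - 0)"
          by (rule integral_bound) (use bd in \<open>auto intro!: continuous_intros cont_\<phi> simp del: mult_minus1\<close>)
        then show "norm (integral {0..1} (\<lambda>x. \<phi> (x + of_int b) * ee (of_int m * of_real x)))
             \<le> C 1 * exp (- 1 * \<bar>of_int b\<bar>)" by simp
      qed auto
      have "((\<lambda>b::int. integral {0..1} (\<lambda>x. \<phi> (x + of_int b) * ee (of_int m * of_real (x + of_int b))))
        has_sum (LINT x|lborel. \<phi> x * ee (of_int m * of_real x))) UNIV"
        by (rule has_sum_unit_integrals [OF hat_int]) (use sm * in simp)
      then show ?thesis
        using hs has_sum_unique unfolding hat * [symmetric] by blast
    qed
    also have "integral {0..1} (\<lambda>x. (\<Sum>\<^sub>\<infinity>n::int. c n * ee (of_int (m - n) * of_real x))) = c m"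
    proof -
      have hs: "((\<lambda>n. integral {0..1} (\<lambda>x. c n * ee (of_int (m - n) * of_real x))) has_sum
          integral {0..1} (\<lambda>x. (\<Sum>\<^sub>\<infinity>n::int. c n * ee (of_int (m - n) * of_real x)))) UNIV"
        by (rule has_sum_integral_Icc [OF _ bound_c sm_C]) (intro continuous_intros)
      have I: "integral {0..1} (\<lambda>x. ee (of_int k * of_real x)) = (if k = 0 then 1 else 0)" for k :: int
      proof (cases "k = 0")
        case False
        have "((\<lambda>x. ee (of_int k * of_real x)) has_integral
          (\<lambda>x. ee (of_int k * of_real x) / (2 * of_real pi * \<i> * of_int k)) 1 -
          (\<lambda>x. ee (of_int k * of_real x) / (2 * of_real pi * \<i> * of_int k)) 0) {0..1}"
          unfolding ee_def
          by (rule fundamental_theorem_of_calculus)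
             (auto intro!: derivative_eq_intros has_vector_derivative_real_field simp: False field_simps)
        then show ?thesis using False by (simp add: integral_unique)
      qed simp
      have "integral {0..1} (\<lambda>x. c n * ee (of_int (m - n) * of_real x)) = (if n = m then c m else 0)" for n
        by (subst integral_mult_right, subst I) auto
      with hs have "((\<lambda>n. if n = m then c m else 0) has_sum
          integral {0..1} (\<lambda>x. (\<Sum>\<^sub>\<infinity>n::int. c n * ee (of_int (m - n) * of_real x)))) UNIV" by simp
      moreover have "((\<lambda>n. if n = m then c m else 0) has_sum c m) UNIV"
        by (rule has_sum_finite_neutralI [of "{m}"]) auto
      ultimately show ?thesis using has_sum_unique by blast
    qed
    finally show "integral {0..1} (\<lambda>x. g x * ee (of_int m * of_real x)) = 0" by simp
  qed
  then have "(\<Sum>\<^sub>\<infinity>b::int. \<phi> (of_int b)) = (\<Sum>\<^sub>\<infinity>n::int. c n)" by (simp add: g_def)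
  also have "\<dots> = (\<Sum>\<^sub>\<infinity>n::int. c (- n))"
    by (rule infsum_reindex_bij_witness [of _ uminus uminus]) auto
  also have "\<dots> = (\<Sum>\<^sub>\<infinity>n::int. of_real (1 / sqrt t) * (of_real (exp (- pi * (of_int n - \<theta>)\<^sup>2 / t)) * ee (of_int n * w)))"
    by (rule infsum_cong) (simp add: c_def power2_commute [of \<theta>])
  finally show ?thesis unfolding infsum_cmult_right' by (simp add: \<phi>_def)
qed

section \<open>Partial fractions with a Gaussian factor\<close>

lemma Efun_has_derivative:
  "(Efun has_real_derivative 2 * exp (- pi * x\<^sup>2)) (at x)"
proof -
  define a b where "a = - \<bar>x\<bar> - 1" and "b = \<bar>x\<bar> + 1"
  have "((\<lambda>u. LBINT y=0..u. exp (- pi * y\<^sup>2)) has_vector_derivative exp (- pi * x\<^sup>2)) (at x within {a..b})"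
    unfolding zero_ereal_def
    by (rule interval_integral_FTC2) (auto simp: a_def b_def intro!: continuous_intros)
  moreover have "at x within {a..b} = at x"
    by (rule at_within_interior) (simp add: a_def b_def, linarith)
  ultimately have "((\<lambda>u. LBINT y=ereal 0..ereal u. exp (- pi * y\<^sup>2)) has_real_derivative exp (- pi * x\<^sup>2)) (at x)"
    by (simp add: has_real_derivative_iff_has_vector_derivative zero_ereal_def)
  from DERIV_cmult [OF this, of 2] show ?thesis unfolding Efun_def [abs_def] .
qed

lemma Efun_minus: "Efun (- x) = - Efun x"
proof -
  have "(LBINT u = ereal 0..ereal (- x). exp (- pi * u\<^sup>2)) =
      (LBINT u = - ereal (- x)..- ereal 0. exp (- pi * (- u)\<^sup>2))"
    by (rule interval_integral_reflect)
  also have "\<dots> = - (LBINT u = ereal 0..ereal x. exp (- pi * u\<^sup>2))"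
    by (subst interval_integral_endpoints_reverse) (simp add: zero_ereal_def)
  finally show ?thesis by (simp add: Efun_def)
qed

text \<open>1 - Efun x is twice the Gaussian mass beyond x, as the total mass is 1 and the density
  is even. After the translation u -> x + u the inequality (x + u)^2 \<ge> x^2 + u^2 for x, u \<ge>
  0 splits off exp(-pi x^2) and leaves the mass 1/2 of the half line.\<close>

lemma Efun_bound_nonneg:
  assumes "x \<ge> 0"
  shows "0 \<le> 1 - Efun x" "1 - Efun x \<le> exp (- pi * x\<^sup>2)"
proof -
  define g where "g = (\<lambda>u::real. exp (- pi * u\<^sup>2))"
  have eq: "(\<lambda>u. ee (of_real (0 * u)) * of_real (exp (- pi * 1 * u\<^sup>2))) = (\<lambda>u. complex_of_real (g u))"
    by (simp add: g_def)
  have int: "integrable lborel g"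
    using gaussian_fourier(1) [of 1 0] unfolding eq complex_of_real_integrable_eq by simp
  have "complex_of_real (LINT u|lborel. g u) = 1"
    using gaussian_fourier(2) [of 1 0] unfolding eq integral_complex_of_real by simp
  then have int1: "(LINT u|lborel. g u) = 1" by (simp only: of_real_eq_1_iff)
  have si: "set_integrable lborel A g" if "A \<in> sets borel" for A
    unfolding set_integrable_def by (rule integrable_mult_indicator) (use that int in auto)
  define I where "I = (\<lambda>A. LINT u:A|lborel. g u)"
  have even: "I {..<0} = I {0<..}"
  proof -
    have "I {..<0} = (LINT u|lborel. indicator {..<0} (0 + (- 1) * u) *\<^sub>R g (0 + (- 1) * u))"
      unfolding I_def set_lebesgue_integral_def by (subst lborel_integral_real_affine [of "- 1" _ 0]) auto
    also have "\<dots> = I {0<..}"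
      unfolding I_def set_lebesgue_integral_def
      by (intro Bochner_Integration.integral_cong refl) (auto simp: indicator_def g_def)
    finally show ?thesis .
  qed
  have "I ({..<0} \<union> {0<..}) = I {..<0} + I {0<..}"
    unfolding I_def by (rule set_integral_Un) (auto intro!: si)
  moreover have "I ({..<0} \<union> {0<..}) = I UNIV"
    unfolding I_def set_lebesgue_integral_def
  proof (rule integral_cong_AE)
    have "AE u in lborel. u \<noteq> (0::real)" by (rule AE_lborel_singleton)
    then show "AE u in lborel. indicator ({..<0} \<union> {0<..}) u *\<^sub>R g u = indicator UNIV u *\<^sub>R g u"
      by eventually_elim (auto simp: indicator_def)
  qed (auto simp: g_def)
  moreover have "I UNIV = 1" using int1 by (simp add: I_def set_lebesgue_integral_def)
  ultimately have half: "I {0<..} = 1 / 2" using even by simp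
  have "I ({0<..<x} \<union> {x<..}) = I {0<..<x} + I {x<..}"
    unfolding I_def by (rule set_integral_Un) (auto intro!: si)
  moreover have "I ({0<..<x} \<union> {x<..}) = I {0<..}"
    unfolding I_def set_lebesgue_integral_def
  proof (rule integral_cong_AE)
    have "AE u in lborel. u \<noteq> x" by (rule AE_lborel_singleton)
    then show "AE u in lborel. indicator ({0<..<x} \<union> {x<..}) u *\<^sub>R g u = indicator {0<..} u *\<^sub>R g u"
      by eventually_elim (use assms in \<open>auto simp: indicator_def\<close>)
  qed (auto simp: g_def)
  moreover have "2 * I {0<..<x} = Efun x"
    using assms by (simp add: Efun_def I_def g_def interval_lebesgue_integral_def)
  ultimately have E: "1 - Efun x = 2 * I {x<..}" using half by simp
  have "0 \<le> I {x<..}"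
    unfolding I_def set_lebesgue_integral_def
    by (rule Bochner_Integration.integral_nonneg) (auto simp: g_def)
  then show "0 \<le> 1 - Efun x" using E by simp
  have "I {x<..} = (LINT u|lborel. indicator {x<..} (x + 1 * u) *\<^sub>R g (x + 1 * u))"
    unfolding I_def set_lebesgue_integral_def by (subst lborel_integral_real_affine [of 1 _ x]) auto
  also have "\<dots> \<le> (LINT u|lborel. g x * (indicator {0<..} u *\<^sub>R g u))"
  proof (rule Bochner_Integration.integral_mono)
    have "integrable lborel (\<lambda>u. indicator {x<..} u *\<^sub>R g u)"
      using si [of "{x<..}"] by (simp add: set_integrable_def)
    then show "integrable lborel (\<lambda>u. indicator {x<..} (x + 1 * u) *\<^sub>R g (x + 1 * u))"
      by (rule lborel_integrable_real_affine) simp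
    show "integrable lborel (\<lambda>u. g x * (indicator {0<..} u *\<^sub>R g u))"
      using si [of "{0<..}"] by (intro integrable_mult_right) (simp add: set_integrable_def)
    show "indicator {x<..} (x + 1 * u) *\<^sub>R g (x + 1 * u) \<le> g x * (indicator {0<..} u *\<^sub>R g u)" for u
    proof (cases "u > 0")
      case True
      have "- (pi * (x + u)\<^sup>2) \<le> - (pi * x\<^sup>2) + - (pi * u\<^sup>2)"
        using True assms by (simp add: power2_eq_square algebra_simps)
      then show ?thesis using True by (simp add: g_def flip: exp_add)
    qed auto
  qed
  also have "\<dots> = g x * I {0<..}" by (simp add: I_def set_lebesgue_integral_def)
  finally show "1 - Efun x \<le> exp (- pi * x\<^sup>2)" using E half by (simp add: g_def)
qed

lemma Efun_minus_sgn_bound: "\<bar>Efun x - sgn x\<bar> \<le> exp (- pi * x\<^sup>2)"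
proof -
  have *: "\<bar>Efun x - sgn x\<bar> \<le> exp (- pi * x\<^sup>2)" if "x > 0" for x
    using Efun_bound_nonneg [of x] that by simp
  consider "x > 0" | "x < 0" | "x = 0" by linarith
  then show ?thesis
  proof cases
    case 2
    then show ?thesis using * [of "- x"] by (simp add: Efun_minus)
  next
    case 3
    then show ?thesis using Efun_minus [of 0] by simp
  qed (rule *)
qed

text \<open>The sign jumps between n = -1 and n = 0 rather than at \<theta>. Where it disagrees with
  the sign of n - \<theta>, the distance from n to \<theta> is at most |\<theta>| + 1; there the
  left side is at most 2, and the factor exp(pi (|\<theta>| + 1)^2 / t) makes up for the
  Gaussian.\<close>

lemma Efun_minus_sgn_int_bound:
  fixes t \<theta> :: real and n :: int
  assumes "t > 0"
  shows "\<bar>Efun ((of_int n - \<theta>) / sqrt t) - sgn (of_int n + 1 / 2)\<bar> \<le>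
    2 * exp (pi * (\<bar>\<theta>\<bar> + 1)\<^sup>2 / t) * exp (- pi * (of_int n - \<theta>)\<^sup>2 / t)"
proof -
  define x where "x = (of_int n - \<theta>) / sqrt t"
  have x: "- pi * x\<^sup>2 = - pi * (of_int n - \<theta>)\<^sup>2 / t"
    using assms by (simp add: x_def power_divide)
  note E = Efun_minus_sgn_bound [of x, unfolded x]
  have K: "1 \<le> 2 * exp (pi * (\<bar>\<theta>\<bar> + 1)\<^sup>2 / t)"
  proof -
    have "1 \<le> exp (pi * (\<bar>\<theta>\<bar> + 1)\<^sup>2 / t)" using assms by (subst one_le_exp_iff) simp
    then show ?thesis by linarith
  qed
  show ?thesis
  proof (cases "sgn x = sgn (of_int n + 1 / 2)")
    case True
    then have "\<bar>Efun x - sgn (of_int n + 1 / 2)\<bar> \<le> 1 * exp (- pi * (of_int n - \<theta>)\<^sup>2 / t)"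
      using E by simp
    also have "\<dots> \<le> 2 * exp (pi * (\<bar>\<theta>\<bar> + 1)\<^sup>2 / t) * exp (- pi * (of_int n - \<theta>)\<^sup>2 / t)"
      by (rule mult_right_mono [OF K]) simp
    finally show ?thesis by (simp add: x_def)
  next
    case False
    have sgnx: "sgn x = sgn (of_int n - \<theta>)"
      using assms by (simp add: x_def sgn_divide)
    have "\<bar>of_int n - \<theta>\<bar> \<le> \<bar>\<theta>\<bar> + 1"
    proof (cases "n \<ge> 0")
      case True
      then have "of_int n - \<theta> \<le> 0" using False sgnx by (auto simp: sgn_if split: if_splits)
      then show ?thesis using True by simp
    next
      case n: False
      then have "real_of_int n \<le> - 1" by linarith
      then have "of_int n - \<theta> \<ge> 0" using False sgnx by (auto simp: sgn_if split: if_splits)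
      then show ?thesis using \<open>real_of_int n \<le> - 1\<close> by simp
    qed
    then have "(of_int n - \<theta>)\<^sup>2 \<le> (\<bar>\<theta>\<bar> + 1)\<^sup>2" by (metis abs_le_square_iff abs_of_nonneg abs_ge_zero add_nonneg_nonneg zero_le_one)
    then have "0 \<le> pi * (\<bar>\<theta>\<bar> + 1)\<^sup>2 / t + - pi * (of_int n - \<theta>)\<^sup>2 / t"
      using assms by (simp add: divide_right_mono flip: add_divide_distrib)
    then have "1 \<le> exp (pi * (\<bar>\<theta>\<bar> + 1)\<^sup>2 / t) * exp (- pi * (of_int n - \<theta>)\<^sup>2 / t)"
      unfolding mult_exp_exp by simp
    moreover have "\<bar>Efun x\<bar> \<le> 1"
    proof -
      have e: "exp (- pi * y\<^sup>2) \<le> 1" for y by (subst exp_le_one_iff) simp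
      have "\<bar>Efun y\<bar> \<le> 1" if "y \<ge> 0" for y
        using Efun_bound_nonneg [OF that] e [of y] by linarith
      from this [of x] this [of "- x"] show ?thesis by (simp add: Efun_minus) linarith
    qed
    then have "\<bar>Efun x - sgn (of_int n + 1 / 2)\<bar> \<le> 2" by (auto simp: sgn_if)
    ultimately show ?thesis unfolding x_def by linarith
  qed
qed

text \<open>The term \<open>K * of_int n\<close> is going to be the logarithm of |ee(n \<zeta>)|.
  The bound sees \<theta> only through \<open>R\<close>, so it serves as one majorant while \<theta>
  varies in a ball.\<close>

lemma exp_neg_shifted_square_le:
  fixes t \<theta> K R :: real
  assumes "t > 0" "\<bar>\<theta>\<bar> \<le> R"
  shows "exp (- pi * (of_int n - \<theta>)\<^sup>2 / t + K * of_int n) \<le>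
    exp ((\<bar>K\<bar> + 1)\<^sup>2 / (4 * (pi / t)) + \<bar>K\<bar> * R + R) * exp (- 1 * \<bar>of_int n\<bar>)"
proof -
  have "- (pi / t) * \<bar>of_int n - \<theta>\<bar>\<^sup>2 + \<bar>K\<bar> * \<bar>of_int n - \<theta>\<bar> \<le>
      (\<bar>K\<bar> + 1)\<^sup>2 / (4 * (pi / t)) - \<bar>of_int n - \<theta>\<bar>"
    by (rule quadratic_le_linear) (use assms in auto)
  moreover have "K * of_int n \<le> \<bar>K\<bar> * \<bar>of_int n - \<theta>\<bar> + \<bar>K\<bar> * R"
  proof -
    have "K * of_int n \<le> \<bar>K\<bar> * \<bar>of_int n\<bar>" by (simp flip: abs_mult)
    also have "\<dots> \<le> \<bar>K\<bar> * (\<bar>of_int n - \<theta>\<bar> + R)"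
      by (intro mult_left_mono) (use assms(2) in linarith, simp)
    finally show ?thesis by (simp add: distrib_left)
  qed
  moreover have "\<bar>of_int n\<bar> \<le> \<bar>of_int n - \<theta>\<bar> + R" using assms(2) by linarith
  ultimately have "- pi * (of_int n - \<theta>)\<^sup>2 / t + K * of_int n \<le>
     ((\<bar>K\<bar> + 1)\<^sup>2 / (4 * (pi / t)) + \<bar>K\<bar> * R + R) + (- 1 * \<bar>of_int n\<bar>)"
    by simp
  then show ?thesis unfolding mult_exp_exp by simp
qed

lemma norm_diff_Ints_bounded_below:
  assumes "(\<zeta>::complex) \<notin> \<int>"
  obtains d where "d > 0" "\<And>b::int. d \<le> norm (\<zeta> + of_int b)"
proof -
  have "open (- \<int> :: complex set)" by (intro open_Compl closed_Ints)
  then obtain d where d: "d > 0" "ball \<zeta> d \<subseteq> - \<int>" using assms openE by (metis ComplI)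
  have "d \<le> norm (\<zeta> + of_int b)" for b :: int
  proof (rule ccontr)
    assume "\<not> ?thesis"
    then have "of_int (- b) \<in> ball \<zeta> d" by (simp add: dist_norm)
    then show False using d(2) Ints_of_int by blast
  qed
  with d(1) that show ?thesis by blast
qed

text \<open>Both sides have the same derivative in \<open>\<theta>\<close>, by theta inversion, and both are
  multiplied by \<open>ee \<zeta>\<close> when \<open>\<theta>\<close> grows by 1. Hence their difference is a constant
  \<open>c\<close> with \<open>c = ee \<zeta> * c\<close>, and \<open>ee \<zeta> \<noteq> 1\<close>.\<close>

lemma gaussian_partial_fractions:
  fixes t \<theta> :: real and \<zeta> :: complex
  assumes t: "t > 0" and \<zeta>: "\<zeta> \<notin> \<int>"
  shows "\<i> / (2 * of_real pi) * (\<Sum>\<^sub>\<infinity>b::int. exp (- (of_real (pi * t) * (\<zeta> + of_int b)\<^sup>2) +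
            2 * of_real pi * \<i> * of_real \<theta> * (\<zeta> + of_int b)) / (\<zeta> + of_int b)) =
         1 / (1 - ee \<zeta>) + 1 / 2 * (\<Sum>\<^sub>\<infinity>n::int.
           of_real (Efun ((of_int n - \<theta>) / sqrt t) - sgn (of_int n + 1 / 2)) * ee (of_int n * \<zeta>))"
proof -
  define \<phi> where "\<phi> = (\<lambda>(b::int) (\<theta>::real). exp (- (of_real (pi * t) * (\<zeta> + of_int b)\<^sup>2) +
            2 * of_real pi * \<i> * of_real \<theta> * (\<zeta> + of_int b)))"
  define f where "f = (\<lambda>b \<theta>. \<i> / (2 * of_real pi) * (\<phi> b \<theta> / (\<zeta> + of_int b)))"
  define \<rho> where "\<rho> = (\<lambda>(n::int) (\<theta>::real). 1 / 2 *
      (of_real (Efun ((of_int n - \<theta>) / sqrt t) - sgn (of_int n + 1 / 2)) * ee (of_int n * \<zeta>)))"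
  \<comment> \<open>The \<theta>-derivative of \<rho>: the 2 in the derivative of
    \<open>Efun\<close> cancels the 1/2, and the sign comes from n - \<theta>. Summed over n this is
    minus the right side of theta inversion.\<close>
  define \<rho>' where "\<rho>' = (\<lambda>(n::int) (\<theta>::real). - (of_real (1 / sqrt t) * (of_real (exp (- pi * (of_int n - \<theta>)\<^sup>2 / t)) * ee (of_int n * \<zeta>))))"
  obtain d where d: "d > 0" "\<And>b::int. d \<le> norm (\<zeta> + of_int b)"
    using norm_diff_Ints_bounded_below [OF \<zeta>] by blast
  have nz: "\<zeta> + of_int b \<noteq> 0" for b :: int using d(1) d(2) [of b] by auto
  define v where "v = Im \<zeta>"
  define C where "C = (\<lambda>R. exp (pi * t * v\<^sup>2 + 2 * pi * R * \<bar>v\<bar>) * exp (1 / (4 * pi * t) + \<bar>Re \<zeta>\<bar> + 0))"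
  have bound_\<phi>: "norm (\<phi> b \<theta>) \<le> C R * exp (- 1 * \<bar>of_int b\<bar>)" if "\<bar>\<theta>\<bar> \<le> R" for b \<theta> R
  proof -
    have "norm (\<phi> b \<theta>) = exp (pi * t * v\<^sup>2 - 2 * pi * \<theta> * v) * exp (- pi * t * (Re \<zeta> + 0 + of_int b)\<^sup>2)"
      unfolding \<phi>_def norm_gaussian_term by (simp add: v_def)
    also have "\<dots> \<le> exp (pi * t * v\<^sup>2 + 2 * pi * R * \<bar>v\<bar>) *
        (exp (1 / (4 * pi * t) + \<bar>Re \<zeta>\<bar> + 0) * exp (- 1 * \<bar>of_int b\<bar>))"
    proof (intro mult_mono exp_neg_quadratic_int_le)
      have "- (\<theta> * v) \<le> R * \<bar>v\<bar>"
        using mult_right_mono [OF that abs_ge_zero, of v] abs_ge_minus_self [of "\<theta> * v"]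
        unfolding abs_mult by linarith
      then have "2 * pi * - (\<theta> * v) \<le> 2 * pi * (R * \<bar>v\<bar>)" by (intro mult_left_mono) auto
      then show "exp (pi * t * v\<^sup>2 - 2 * pi * \<theta> * v) \<le> exp (pi * t * v\<^sup>2 + 2 * pi * R * \<bar>v\<bar>)" by simp
    qed (use t in auto)
    finally show ?thesis by (simp add: C_def)
  qed
  have bound_f: "norm (f b \<theta>) \<le> C R / (2 * pi * d) * exp (- 1 * \<bar>of_int b\<bar>)" if "\<bar>\<theta>\<bar> \<le> R" for b \<theta> R
  proof -
    have "norm (\<phi> b \<theta>) / norm (\<zeta> + of_int b) \<le> C R * exp (- 1 * \<bar>of_int b\<bar>) / d"
      by (rule frac_le) (use d bound_\<phi> [OF that] in \<open>auto simp: C_def\<close>)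
    then have "1 / (2 * pi) * (norm (\<phi> b \<theta>) / norm (\<zeta> + of_int b)) \<le>
        1 / (2 * pi) * (C R * exp (- 1 * \<bar>of_int b\<bar>) / d)"
      by (rule mult_left_mono) simp
    moreover have "norm (f b \<theta>) = 1 / (2 * pi) * (norm (\<phi> b \<theta>) / norm (\<zeta> + of_int b))"
      unfolding f_def norm_mult norm_divide by simp
    ultimately show ?thesis by simp
  qed
  define D where "D = (\<lambda>R. exp ((\<bar>- 2 * pi * v\<bar> + 1)\<^sup>2 / (4 * (pi / t)) + \<bar>- 2 * pi * v\<bar> * R + R))"
  have bound_e: "exp (- pi * (of_int n - \<theta>)\<^sup>2 / t) * norm (ee (of_int n * \<zeta>)) \<le> D R * exp (- 1 * \<bar>of_int n\<bar>)"
    if "\<bar>\<theta>\<bar> \<le> R" for n \<theta> R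
    using exp_neg_shifted_square_le [OF t that, of n "- 2 * pi * v"]
    by (simp add: D_def norm_ee v_def mult_exp_exp mult_ac)
  have bound_\<rho>': "norm (\<rho>' n \<theta>) \<le> D R / sqrt t * exp (- 1 * \<bar>of_int n\<bar>)" if "\<bar>\<theta>\<bar> \<le> R" for n \<theta> R
  proof -
    have "norm (\<rho>' n \<theta>) = exp (- pi * (of_int n - \<theta>)\<^sup>2 / t) * norm (ee (of_int n * \<zeta>)) / sqrt t"
      using t by (simp add: \<rho>'_def norm_mult norm_divide)
    also have "\<dots> \<le> D R * exp (- 1 * \<bar>of_int n\<bar>) / sqrt t"
      by (rule divide_right_mono [OF bound_e [OF that]]) (use t in simp)
    finally show ?thesis by simp
  qed
  have bound_\<rho>: "norm (\<rho> n \<theta>) \<le> exp (pi * (\<bar>\<theta>\<bar> + 1)\<^sup>2 / t) * D \<bar>\<theta>\<bar> * exp (- 1 * \<bar>of_int n\<bar>)" for n \<theta>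
  proof -
    have "norm (\<rho> n \<theta>) = 1 / 2 * (\<bar>Efun ((of_int n - \<theta>) / sqrt t) - sgn (of_int n + 1 / 2)\<bar> * norm (ee (of_int n * \<zeta>)))"
      unfolding \<rho>_def norm_mult norm_of_real by simp
    also have "\<dots> \<le> 1 / 2 * (2 * exp (pi * (\<bar>\<theta>\<bar> + 1)\<^sup>2 / t) * exp (- pi * (of_int n - \<theta>)\<^sup>2 / t) * norm (ee (of_int n * \<zeta>)))"
      by (intro mult_left_mono mult_right_mono Efun_minus_sgn_int_bound t) auto
    also have "\<dots> = exp (pi * (\<bar>\<theta>\<bar> + 1)\<^sup>2 / t) * (exp (- pi * (of_int n - \<theta>)\<^sup>2 / t) * norm (ee (of_int n * \<zeta>)))"
      by simp
    also have "\<dots> \<le> exp (pi * (\<bar>\<theta>\<bar> + 1)\<^sup>2 / t) * (D \<bar>\<theta>\<bar> * exp (- 1 * \<bar>of_int n\<bar>))"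
      by (intro mult_left_mono bound_e) auto
    finally show ?thesis by (simp only: mult.assoc)
  qed
  have sm: "(\<lambda>b::int. K * exp (- 1 * \<bar>of_int b\<bar>) :: real) summable_on UNIV" for K
    by (intro summable_on_cmult_right summable_on_exp_neg_abs_int) simp
  have sm_f: "(\<lambda>b. norm (f b \<theta>)) summable_on UNIV" for \<theta>
    by (rule summable_on_comparison_test [OF sm]) (rule bound_f [OF order_refl], simp)
  have sm_\<rho>: "(\<lambda>b. norm (\<rho> b \<theta>)) summable_on UNIV" for \<theta>
    by (rule summable_on_comparison_test [OF sm]) (rule bound_\<rho>, simp)
  have sm_\<rho>1: "(\<lambda>n. \<rho> n \<theta>) summable_on UNIV" for \<theta>
    by (rule abs_summable_summable [OF sm_\<rho>])
  define L where "L = (\<lambda>\<theta>. \<Sum>\<^sub>\<infinity>b. f b \<theta>)"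
  define R where "R = (\<lambda>\<theta>. 1 / (1 - ee \<zeta>) + (\<Sum>\<^sub>\<infinity>n. \<rho> n \<theta>))"
  \<comment> \<open>Differentiation in \<theta> brings down 2 pi i (\<zeta> + b), which cancels the
    pole. With the constant i / (2 pi) in front, what remains is -\<phi>, the summand of a theta
    series.\<close>
  have dL: "(L has_derivative (\<lambda>h. \<Sum>\<^sub>\<infinity>b. h *\<^sub>R - \<phi> b \<theta>)) (at \<theta>)" for \<theta>
    unfolding L_def
  proof (rule has_derivative_infsum [where S = "ball \<theta> 1" and B = "\<lambda>b. C (\<bar>\<theta>\<bar> + 1) * exp (- 1 * \<bar>of_int b\<bar>)"])
    show "(f b has_derivative (\<lambda>h. h *\<^sub>R - \<phi> b x)) (at x)" for b x
    proof -
      define c where "c = \<zeta> + of_int b"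
      define A where "A = - (of_real (pi * t) * c\<^sup>2)"
      have c: "c \<noteq> 0" using nz by (simp add: c_def)
      have "((\<lambda>z. exp (A + 2 * of_real pi * \<i> * z * c)) has_field_derivative
          2 * of_real pi * \<i> * c * exp (A + 2 * of_real pi * \<i> * of_real x * c)) (at (of_real x))"
        by (auto intro!: derivative_eq_intros)
      from has_vector_derivative_mult_right [OF has_vector_derivative_real_field [OF this], of "\<i> / (2 * of_real pi) / c"]
      have "((\<lambda>\<theta>. \<i> / (2 * of_real pi) / c * exp (A + 2 * of_real pi * \<i> * of_real \<theta> * c)) has_vector_derivative
          - exp (A + 2 * of_real pi * \<i> * of_real x * c)) (at x)"
        using c by simp
      then show ?thesis
        unfolding f_def \<phi>_def has_vector_derivative_def [symmetric] by (simp add: A_def c_def)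
    qed
    show "norm (h *\<^sub>R - \<phi> b x) \<le> C (\<bar>\<theta>\<bar> + 1) * exp (- 1 * \<bar>of_int b\<bar>) * norm h" if "x \<in> ball \<theta> 1" for b x h
    proof -
      have "\<bar>x\<bar> \<le> \<bar>\<theta>\<bar> + 1" using that by (simp add: dist_real_def)
      from mult_left_mono [OF bound_\<phi> [OF this, of b], of "norm h"] show ?thesis by (simp add: mult_ac)
    qed
  qed (use sm sm_f in auto)
  have dR: "((\<lambda>\<theta>. \<Sum>\<^sub>\<infinity>n. \<rho> n \<theta>) has_derivative (\<lambda>h. \<Sum>\<^sub>\<infinity>n. h *\<^sub>R \<rho>' n \<theta>)) (at \<theta>)" for \<theta>
  proof (rule has_derivative_infsum [where S = "ball \<theta> 1" and B = "\<lambda>b. D (\<bar>\<theta>\<bar> + 1) / sqrt t * exp (- 1 * \<bar>of_int b\<bar>)"])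
    show "(\<rho> n has_derivative (\<lambda>h. h *\<^sub>R \<rho>' n x)) (at x)" for n x
    proof -
      have "((\<lambda>\<theta>. Efun ((of_int n - \<theta>) / sqrt t) - sgn (of_int n + 1 / 2)) has_real_derivative
          2 * exp (- pi * ((of_int n - x) / sqrt t)\<^sup>2) * (- 1 / sqrt t)) (at x)"
        using DERIV_diff [OF DERIV_chain2 [OF Efun_has_derivative
              DERIV_cdivide [OF DERIV_diff [OF DERIV_const DERIV_ident]]] DERIV_const] by simp
      moreover have "- pi * ((of_int n - x) / sqrt t)\<^sup>2 = - pi * (of_int n - x)\<^sup>2 / t"
        using t by (simp add: power_divide)
      ultimately have "((\<lambda>\<theta>. Efun ((of_int n - \<theta>) / sqrt t) - sgn (of_int n + 1 / 2)) has_real_derivative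
          2 * exp (- pi * (of_int n - x)\<^sup>2 / t) * (- 1 / sqrt t)) (at x)"
        by (simp only:)
      from has_vector_derivative_mult_right [OF has_vector_derivative_mult_left [OF has_vector_derivative_of_real [OF this]], of "1 / 2" "ee (of_int n * \<zeta>)"]
      show ?thesis
        unfolding has_vector_derivative_def [symmetric] \<rho>_def \<rho>'_def by simp
    qed
    show "norm (h *\<^sub>R \<rho>' b x) \<le> D (\<bar>\<theta>\<bar> + 1) / sqrt t * exp (- 1 * \<bar>of_int b\<bar>) * norm h" if "x \<in> ball \<theta> 1" for b x h
    proof -
      have "\<bar>x\<bar> \<le> \<bar>\<theta>\<bar> + 1" using that by (simp add: dist_real_def)
      from mult_left_mono [OF bound_\<rho>' [OF this, of b], of "norm h"] show ?thesis by (simp add: mult_ac)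
    qed
    show "(\<lambda>b::int. D (\<bar>\<theta>\<bar> + 1) / sqrt t * exp (- 1 * \<bar>of_int b\<bar>)) summable_on UNIV"
      by (rule sm)
  qed (use sm_\<rho> in auto)
  have "(\<Sum>\<^sub>\<infinity>b. h *\<^sub>R - \<phi> b \<theta>) = (\<Sum>\<^sub>\<infinity>n. h *\<^sub>R \<rho>' n \<theta>)" for h \<theta>
    using theta_inversion_real [OF t, of \<zeta> \<theta>]
    unfolding infsum_scaleR_right \<rho>'_def \<phi>_def infsum_uminus infsum_cmult_right' by simp
  then have "((\<lambda>\<theta>. L \<theta> - R \<theta>) has_derivative (\<lambda>h. 0)) (at \<theta>)" for \<theta>
    unfolding R_def
    using has_derivative_diff [OF dL [of \<theta>] has_derivative_add [OF has_derivative_const dR [of \<theta>]]] by simp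
  then obtain c where c: "\<And>\<theta>. L \<theta> - R \<theta> = c"
    using has_derivative_zero_constant [of UNIV "\<lambda>\<theta>. L \<theta> - R \<theta>"] by auto
  have "f b (\<theta> + 1) = ee \<zeta> * f b \<theta>" for b \<theta>
  proof -
    have "\<phi> b (\<theta> + 1) = \<phi> b \<theta> * ee (\<zeta> + of_int b)"
      unfolding \<phi>_def ee_def mult_exp_exp by (rule arg_cong [where f = exp]) (simp add: algebra_simps)
    then show ?thesis by (simp add: f_def ee_add)
  qed
  then have Lsh: "L (\<theta> + 1) = ee \<zeta> * L \<theta>" for \<theta>
    unfolding L_def infsum_cmult_right' [symmetric] by simp
  have ee1: "ee \<zeta> \<noteq> 1" using \<zeta> by (simp add: ee_eq_1_iff)
  have Rsh: "R (\<theta> + 1) = ee \<zeta> * R \<theta>" for \<theta>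
  proof -
    have "(\<Sum>\<^sub>\<infinity>n. \<rho> n (\<theta> + 1)) = (\<Sum>\<^sub>\<infinity>n. \<rho> (n + 1) (\<theta> + 1))"
      by (rule infsum_reindex_bij_witness [of _ "\<lambda>b. b + 1" "\<lambda>b. b - 1"]) auto
    \<comment> \<open>The shift replaces sgn(n + 1/2) by sgn(n + 3/2), which differs only at n = -1.
      That term contributes -1, and it is absorbed by 1 / (1 - ee \<zeta>) - 1 = ee \<zeta> / (1 -
      ee \<zeta>).\<close>
    also have "\<dots> = (\<Sum>\<^sub>\<infinity>n. ee \<zeta> * \<rho> n \<theta> + (if n = - 1 then - 1 else 0))"
    proof (rule infsum_cong)
      fix n :: int
      have arg: "(of_int (n + 1) - (\<theta> + 1)) / sqrt t = (of_int n - \<theta>) / sqrt t" by simp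
      have e: "ee (of_int (n + 1) * \<zeta>) = ee \<zeta> * ee (of_int n * \<zeta>)"
        unfolding ee_add [symmetric] by (rule arg_cong [where f = ee]) (simp add: algebra_simps)
      show "\<rho> (n + 1) (\<theta> + 1) = ee \<zeta> * \<rho> n \<theta> + (if n = - 1 then - 1 else 0)"
      proof (cases "n = - 1")
        case True
        have "ee \<zeta> * ee (- \<zeta>) = 1" by (simp flip: ee_add)
        then show ?thesis unfolding \<rho>_def arg e using True by (simp add: sgn_if field_simps)
      next
        case False
        then have "real_of_int n \<ge> 0 \<or> real_of_int n \<le> - 2" by linarith
        then have "sgn (real_of_int (n + 1) + 1 / 2) = sgn (real_of_int n + 1 / 2)"
          by (auto simp: sgn_if)
        then show ?thesis unfolding \<rho>_def arg e using False by (simp add: mult_ac)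
      qed
    qed
    also have "\<dots> = ee \<zeta> * (\<Sum>\<^sub>\<infinity>n. \<rho> n \<theta>) + (\<Sum>\<^sub>\<infinity>n::int. (if n = - 1 then - 1 else 0))"
      unfolding infsum_cmult_right' [symmetric]
      by (rule infsum_add [OF summable_on_cmult_right [OF sm_\<rho>1]])
         (auto intro!: finite_nonzero_values_imp_summable_on)
    also have "(\<Sum>\<^sub>\<infinity>n::int. (if n = - 1 then - 1 else 0)) = (- 1 :: complex)"
      by (rule infsumI, rule has_sum_finite_neutralI [of "{- 1}"]) auto
    finally have "(\<Sum>\<^sub>\<infinity>n. \<rho> n (\<theta> + 1)) = ee \<zeta> * (\<Sum>\<^sub>\<infinity>n. \<rho> n \<theta>) + - 1" .
    moreover have "1 / (1 - ee \<zeta>) + - 1 = ee \<zeta> * (1 / (1 - ee \<zeta>))" using ee1 by (simp add: field_simps)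
    ultimately show ?thesis unfolding R_def distrib_left by (metis add.assoc add.commute)
  qed
  have "c = ee \<zeta> * c" using c [of 1] c [of 0] Lsh [of 0] Rsh [of 0] by (simp flip: right_diff_distrib)
  then have "c = 0" using ee1 by simp
  then have "L \<theta> = R \<theta>" using c [of \<theta>] by simp
  then show ?thesis
    unfolding L_def R_def f_def \<rho>_def \<phi>_def infsum_cmult_right' .
qed

section \<open>The completed function as a lattice sum\<close>

text \<open>\<open>A\<close> and \<open>B\<close> are real coordinates of the lattice translate, and
  \<open>c\<close> will be l/M. The exponent vanishes together with \<zeta> = z1 + A \<tau> + B, so
  the pole there has coefficient ee(c A z2); its real part contains -(pi c / Im \<tau>) |\<zeta>|^2,
  which gives decay in both coordinates at once.\<close>

definition lat_term :: "real \<Rightarrow> complex \<Rightarrow> complex \<Rightarrow> complex \<Rightarrow> real \<Rightarrow> real \<Rightarrow> complex" where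
  "lat_term c \<tau> z1 z2 A B =
     ee (of_real (c * A) * z2) *
     exp (- (of_real (pi * c / Im \<tau>) * (z1 + of_real A * \<tau> + of_real B) *
        (cnj (z1 + of_real A * \<tau> + of_real B) + 2 * \<i> * of_real (Im z2)))) /
     (z1 + of_real A * \<tau> + of_real B)"

text \<open>\<open>j\<close> and \<open>\<epsilon>\<close> translate the lattice, whereas
  \<open>k\<close> only twists by a character. The factor i / (2 pi) is the residue of 1 / (1 - ee
  \<zeta>) at an integer. This shape is stable under elliptic shifts and under both modular
  generators.\<close>

definition lat_sum :: "nat \<Rightarrow> nat \<Rightarrow> real \<Rightarrow> real \<Rightarrow> real \<Rightarrow> complex \<Rightarrow> complex \<Rightarrow> complex \<Rightarrow> complex" where
  "lat_sum l M j k \<epsilon> \<tau> z1 z2 = \<i> / (2 * of_real pi) *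
     (\<Sum>\<^sub>\<infinity>(a::int, b::int).
        ee (of_real (- (real l / real M) * (k + real M * of_int a) * (\<epsilon> + of_int b))) *
        lat_term (real l / real M) \<tau> z1 z2 (j + real M * of_int a) (\<epsilon> + of_int b))"

section \<open>Lower bounds on lattice points and absolute convergence\<close>

lemma lattice_norm_lower_bound:
  assumes "Im \<tau> > 0"
  obtains \<kappa> where "\<kappa> > 0" "\<And>A B :: real. \<kappa> * (\<bar>A\<bar> + \<bar>B\<bar>) \<le> norm (of_real A * \<tau> + of_real B)"
proof -
  define K where "K = 1 / Im \<tau> + 1 + norm \<tau> / Im \<tau>"
  have K: "K > 0" using assms by (simp add: K_def add_pos_nonneg)
  have "\<bar>A\<bar> + \<bar>B\<bar> \<le> K * norm (of_real A * \<tau> + of_real B)" for A B :: real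
  proof -
    define N where "N = norm (of_real A * \<tau> + of_real B)"
    have "\<bar>Im (of_real A * \<tau> + of_real B)\<bar> \<le> N" unfolding N_def by (rule abs_Im_le_cmod)
    then have "\<bar>A\<bar> * Im \<tau> \<le> N" using assms by (simp add: abs_mult)
    then have A: "\<bar>A\<bar> \<le> N / Im \<tau>" using assms by (simp add: field_simps)
    have "\<bar>B\<bar> = norm ((of_real A * \<tau> + of_real B) - of_real A * \<tau>)" by simp
    also have "\<dots> \<le> N + norm (of_real A * \<tau>)" unfolding N_def by (rule norm_triangle_ineq4)
    also have "\<dots> = N + \<bar>A\<bar> * norm \<tau>" by (simp add: norm_mult)
    also have "\<dots> \<le> N + N / Im \<tau> * norm \<tau>" using A by (intro add_left_mono mult_right_mono) auto
    finally have "\<bar>A\<bar> + \<bar>B\<bar> \<le> N / Im \<tau> + (N + N / Im \<tau> * norm \<tau>)" using A by linarith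
    also have "\<dots> = K * N" by (simp add: K_def algebra_simps)
    finally show ?thesis by (simp add: N_def)
  qed
  then have "1 / K * (\<bar>A\<bar> + \<bar>B\<bar>) \<le> norm (of_real A * \<tau> + of_real B)" for A B :: real
    using K by (simp add: field_simps)
  with K that [of "1 / K"] show ?thesis by simp
qed

text \<open>By linear growth of the norm on the lattice only finitely many translates can come
  within distance 1 of the origin, and the minimum over these is positive.\<close>

lemma lattice_avoid_bounded_below:
  assumes "Im \<tau> > 0" and nz: "\<And>a b :: int. z + of_int a * \<tau> + of_int b \<noteq> 0"
  obtains d where "d > 0" "\<And>a b :: int. d \<le> norm (z + of_int a * \<tau> + of_int b)"
proof -
  obtain \<kappa> where \<kappa>: "\<kappa> > 0" "\<And>A B :: real. \<kappa> * (\<bar>A\<bar> + \<bar>B\<bar>) \<le> norm (of_real A * \<tau> + of_real B)"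
    using lattice_norm_lower_bound [OF assms(1)] by blast
  define N where "N = (1 + norm z) / \<kappa>"
  define F where "F = {- \<lceil>N\<rceil>..\<lceil>N\<rceil>} \<times> {- \<lceil>N\<rceil>..\<lceil>N\<rceil>}"
  define d where "d = Min (insert 1 ((\<lambda>(a, b). norm (z + of_int a * \<tau> + of_int b)) ` F))"
  have fin: "finite (insert 1 ((\<lambda>(a, b). norm (z + of_int a * \<tau> + of_int b)) ` F))"
    by (simp add: F_def)
  have "d > 0" unfolding d_def using nz by (subst Min_gr_iff [OF fin]) auto
  moreover have "d \<le> norm (z + of_int a * \<tau> + of_int b)" for a b :: int
  proof (cases "(a, b) \<in> F")
    case True
    then show ?thesis unfolding d_def by (intro Min_le [OF fin]) force
  next
    case False
    have "norm (z + of_int a * \<tau> + of_int b) \<ge> 1"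
    proof (rule ccontr)
      assume "\<not> ?thesis"
      moreover have "norm (of_int a * \<tau> + of_int b) \<le> norm (z + of_int a * \<tau> + of_int b) + norm z"
        using norm_triangle_ineq4 [of "z + of_int a * \<tau> + of_int b" z] by simp
      ultimately have "\<kappa> * (\<bar>of_int a\<bar> + \<bar>of_int b\<bar>) \<le> 1 + norm z"
        using \<kappa>(2) [of "of_int a" "of_int b"] by simp
      then have "\<bar>real_of_int a\<bar> + \<bar>real_of_int b\<bar> \<le> N" using \<kappa>(1) by (simp add: N_def field_simps)
      then have "\<bar>a\<bar> \<le> \<lceil>N\<rceil>" "\<bar>b\<bar> \<le> \<lceil>N\<rceil>" by linarith+
      then show False using False by (auto simp: F_def)
    qed
    moreover have "d \<le> 1" unfolding d_def by (intro Min_le [OF fin]) simp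
    ultimately show ?thesis by linarith
  qed
  ultimately show ?thesis using that by blast
qed

text \<open>The weight 1 + |A| + |\<zeta>| anticipates the factors that differentiation in z1 and z2
  brings down, and the constants are uniform on a ball for the same purpose. As Im \<zeta> = Im z1 +
  A Im \<tau>, |A| is at most linear in r = |\<zeta>|, so the estimate reduces to a Gaussian in r
  against linear exponents.\<close>

lemma lat_term_bound:
  assumes c: "c > 0" and y: "Im \<tau> > 0" and \<delta>: "\<delta> > 0" and R: "R \<ge> 0"
  obtains C \<kappa> where "\<kappa> > 0" "C \<ge> 0"
    "\<And>z1 z2 A B. norm z1 \<le> R \<Longrightarrow> norm z2 \<le> R \<Longrightarrow> \<delta> \<le> norm (z1 + of_real A * \<tau> + of_real B) \<Longrightarrow>
       (1 + \<bar>A\<bar> + norm (z1 + of_real A * \<tau> + of_real B)) * norm (lat_term c \<tau> z1 z2 A B) \<le>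
       C * exp (- \<kappa> * (\<bar>A\<bar> + \<bar>B\<bar>))"
proof -
  define y where "y = Im \<tau>"
  obtain \<kappa> where \<kappa>: "\<kappa> > 0" "\<And>A B :: real. \<kappa> * (\<bar>A\<bar> + \<bar>B\<bar>) \<le> norm (of_real A * \<tau> + of_real B)"
    using lattice_norm_lower_bound [OF y] by blast
  \<comment> \<open>\<open>K\<close> gathers the coefficients of r in the exponent: one from Im z2,
    one from |A| \<le> (r + R) / y, and 1 from the weight. \<open>K'\<close> is the constant which
    that bound on |A| leaves behind.\<close>
  define K where "K = 2 * pi * c / y * R + (2 * pi * c * R + 1) / y + 1"
  define K' where "K' = (2 * pi * c * R + 1) * R / y"
  define C where "C = exp (K' + (K + 1)\<^sup>2 / (4 * (pi * c / y)) + R) / \<delta>"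
  have y0: "y > 0" using y by (simp add: y_def)
  show ?thesis
  proof (rule that [of \<kappa> C])
    show "\<kappa> > 0" "C \<ge> 0" using \<kappa> \<delta> by (auto simp: C_def)
    fix z1 z2 :: complex and A B :: real
    assume z: "norm z1 \<le> R" "norm z2 \<le> R" and d: "\<delta> \<le> norm (z1 + of_real A * \<tau> + of_real B)"
    define \<zeta> where "\<zeta> = z1 + of_real A * \<tau> + of_real B"
    define r where "r = norm \<zeta>"
    have r: "r \<ge> \<delta>" "r > 0" using d \<delta> unfolding r_def \<zeta>_def by linarith+
    have Im1: "\<bar>Im z1\<bar> \<le> R" "\<bar>Im z2\<bar> \<le> R"
      using abs_Im_le_cmod [of z1] abs_Im_le_cmod [of z2] z by linarith+
    have Im\<zeta>: "\<bar>Im \<zeta>\<bar> \<le> r" unfolding r_def by (rule abs_Im_le_cmod)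
    have "Im \<zeta> = Im z1 + A * y" by (simp add: \<zeta>_def y_def)
    then have "\<bar>A * y\<bar> \<le> r + R" using Im\<zeta> Im1 by linarith
    then have A: "\<bar>A\<bar> \<le> (r + R) / y" using y0 by (simp add: abs_mult field_simps)
    have "norm (lat_term c \<tau> z1 z2 A B) =
        exp (- 2 * pi * (c * A * Im z2)) * exp (- (pi * c / y * (r\<^sup>2 - 2 * Im \<zeta> * Im z2))) / r"
    proof -
      have "Re (of_real (pi * c / y) * \<zeta> * (cnj \<zeta> + 2 * \<i> * of_real (Im z2))) =
          pi * c / y * Re (\<zeta> * (cnj \<zeta> + 2 * \<i> * of_real (Im z2)))"
      proof -
        have "Re (of_real k * w) = k * Re w" for k w by simp
        then show ?thesis unfolding mult.assoc [of "of_real (pi * c / y)"] .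
      qed
      also have "Re (\<zeta> * (cnj \<zeta> + 2 * \<i> * of_real (Im z2))) = r\<^sup>2 - 2 * Im \<zeta> * Im z2"
        unfolding r_def cmod_power2 by (simp add: algebra_simps power2_eq_square)
      finally show ?thesis
        unfolding lat_term_def y_def [symmetric] \<zeta>_def [symmetric] norm_divide norm_mult norm_ee norm_exp_eq_Re
        by (simp add: r_def)
    qed
    also have "\<dots> \<le> exp (2 * pi * c * R * \<bar>A\<bar>) * exp (- (pi * c / y) * r\<^sup>2 + 2 * pi * c / y * R * r) / \<delta>"
    proof (intro frac_le mult_mono)
      have "- (A * Im z2) \<le> \<bar>A\<bar> * R"
        using mult_left_mono [OF Im1(2) abs_ge_zero, of A] abs_ge_minus_self [of "A * Im z2"]
        unfolding abs_mult by linarith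
      then have "2 * pi * c * - (A * Im z2) \<le> 2 * pi * c * (\<bar>A\<bar> * R)"
        by (rule mult_left_mono) (use c in simp)
      then show "exp (- 2 * pi * (c * A * Im z2)) \<le> exp (2 * pi * c * R * \<bar>A\<bar>)"
        by (simp add: mult_ac)
      have "Im \<zeta> * Im z2 \<le> r * R"
      proof -
        have "Im \<zeta> * Im z2 \<le> \<bar>Im \<zeta>\<bar> * \<bar>Im z2\<bar>" by (metis abs_ge_self abs_mult)
        also have "\<dots> \<le> r * R" using Im\<zeta> Im1(2) r by (intro mult_mono) auto
        finally show ?thesis .
      qed
      then have "pi * c / y * (2 * (Im \<zeta> * Im z2)) \<le> pi * c / y * (2 * (r * R))"
        using c y0 by (intro mult_left_mono) auto
      then have "- (pi * c / y * (r\<^sup>2 - 2 * Im \<zeta> * Im z2)) \<le> - (pi * c / y) * r\<^sup>2 + 2 * pi * c / y * R * r"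
        unfolding right_diff_distrib by (simp add: mult_ac)
      then show "exp (- (pi * c / y * (r\<^sup>2 - 2 * Im \<zeta> * Im z2))) \<le> exp (- (pi * c / y) * r\<^sup>2 + 2 * pi * c / y * R * r)"
        by (simp only: exp_le_cancel_iff)
    qed (use r \<delta> in auto)
    finally have 1: "norm (lat_term c \<tau> z1 z2 A B) \<le>
       exp (2 * pi * c * R * \<bar>A\<bar>) * exp (- (pi * c / y) * r\<^sup>2 + 2 * pi * c / y * R * r) / \<delta>" .
    have "1 + \<bar>A\<bar> + r \<le> exp (\<bar>A\<bar> + r)" using exp_ge_add_one_self [of "\<bar>A\<bar> + r"] by linarith
    with 1 have "(1 + \<bar>A\<bar> + r) * norm (lat_term c \<tau> z1 z2 A B) \<le>
       exp (\<bar>A\<bar> + r) * (exp (2 * pi * c * R * \<bar>A\<bar>) * exp (- (pi * c / y) * r\<^sup>2 + 2 * pi * c / y * R * r) / \<delta>)"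
      by (intro mult_mono) auto
    also have "\<dots> = exp ((2 * pi * c * R + 1) * \<bar>A\<bar> + r + (- (pi * c / y) * r\<^sup>2 + 2 * pi * c / y * R * r)) / \<delta>"
      by (simp add: algebra_simps flip: exp_add)
    also have "\<dots> \<le> exp (K' + ((K + 1)\<^sup>2 / (4 * (pi * c / y)) + R - \<kappa> * (\<bar>A\<bar> + \<bar>B\<bar>))) / \<delta>"
    proof -
      have "(2 * pi * c * R + 1) * \<bar>A\<bar> \<le> (2 * pi * c * R + 1) * ((r + R) / y)"
        by (rule mult_left_mono [OF A]) (use c R in simp)
      also have "\<dots> = (2 * pi * c * R + 1) / y * r + K'" by (simp add: K'_def algebra_simps add_divide_distrib)
      finally have "(2 * pi * c * R + 1) * \<bar>A\<bar> + r + (- (pi * c / y) * r\<^sup>2 + 2 * pi * c / y * R * r) \<le>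
         K' + (- (pi * c / y) * r\<^sup>2 + K * r)"
        unfolding K_def distrib_right by simp
      also have "\<dots> \<le> K' + ((K + 1)\<^sup>2 / (4 * (pi * c / y)) - r)"
        by (intro add_left_mono quadratic_le_linear) (use c y0 in simp)
      finally have "(2 * pi * c * R + 1) * \<bar>A\<bar> + r + (- (pi * c / y) * r\<^sup>2 + 2 * pi * c / y * R * r) \<le>
         K' + ((K + 1)\<^sup>2 / (4 * (pi * c / y)) - r)" .
      moreover have "r \<ge> \<kappa> * (\<bar>A\<bar> + \<bar>B\<bar>) - R"
      proof -
        have "norm (of_real A * \<tau> + of_real B) \<le> r + norm z1"
          unfolding r_def using norm_triangle_ineq4 [of \<zeta> z1] by (simp add: \<zeta>_def)
        then show ?thesis using \<kappa>(2) [of A B] z by linarith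
      qed
      ultimately have "(2 * pi * c * R + 1) * \<bar>A\<bar> + r + (- (pi * c / y) * r\<^sup>2 + 2 * pi * c / y * R * r) \<le>
         K' + ((K + 1)\<^sup>2 / (4 * (pi * c / y)) + R - \<kappa> * (\<bar>A\<bar> + \<bar>B\<bar>))" by linarith
      then show ?thesis using \<delta> by (intro divide_right_mono) auto
    qed
    also have "\<dots> = C * exp (- \<kappa> * (\<bar>A\<bar> + \<bar>B\<bar>))"
      unfolding C_def by (simp add: algebra_simps flip: exp_add)
    finally show "(1 + \<bar>A\<bar> + norm (z1 + of_real A * \<tau> + of_real B)) * norm (lat_term c \<tau> z1 z2 A B) \<le>
       C * exp (- \<kappa> * (\<bar>A\<bar> + \<bar>B\<bar>))" by (simp add: r_def \<zeta>_def)
  qed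
qed

lemma exp_neg_lattice_index_le:
  fixes j \<epsilon> \<kappa> :: real
  assumes "\<kappa> > 0" "M > 0"
  shows "exp (- \<kappa> * (\<bar>j + real M * of_int a\<bar> + \<bar>\<epsilon> + of_int b\<bar>)) \<le>
     exp (\<kappa> * (\<bar>j\<bar> + \<bar>\<epsilon>\<bar>)) * exp (- \<kappa> * (\<bar>of_int a\<bar> + \<bar>of_int b\<bar>))"
proof -
  have "\<bar>real_of_int a\<bar> \<le> \<bar>real M * of_int a\<bar>"
    using assms(2) mult_right_mono [of 1 "real M" "\<bar>real_of_int a\<bar>"] by (simp add: abs_mult)
  then have "\<bar>of_int a\<bar> + \<bar>of_int b\<bar> \<le> (\<bar>j\<bar> + \<bar>\<epsilon>\<bar>) + (\<bar>j + real M * of_int a\<bar> + \<bar>\<epsilon> + of_int b\<bar>)"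
    by linarith
  from mult_left_mono [OF this, of \<kappa>] assms(1) show ?thesis
    unfolding mult_exp_exp by (simp add: algebra_simps)
qed

lemma norm_ee_of_real [simp]: "norm (ee (of_real x)) = 1"
  by (simp add: norm_ee)

lemma summable_lat_sum:
  assumes c: "c > 0" and y: "Im \<tau> > 0" and M: "M > 0" and \<delta>: "\<delta> > 0"
    and away: "\<And>a b :: int. \<delta> \<le> norm (z1 + of_real (j + real M * of_int a) * \<tau> + of_real (\<epsilon> + of_int b))"
    and u: "\<And>p. norm (u p) = 1"
  shows "(\<lambda>(a::int, b::int). norm (u (a, b) * lat_term c \<tau> z1 z2 (j + real M * of_int a) (\<epsilon> + of_int b))) summable_on UNIV"
proof -
  define R where "R = max (norm z1) (norm z2)"
  obtain C \<kappa> where \<kappa>: "\<kappa> > 0" "C \<ge> 0" and b: "\<And>z1 z2 A B. norm z1 \<le> R \<Longrightarrow> norm z2 \<le> R \<Longrightarrow>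
       \<delta> \<le> norm (z1 + of_real A * \<tau> + of_real B) \<Longrightarrow>
       (1 + \<bar>A\<bar> + norm (z1 + of_real A * \<tau> + of_real B)) * norm (lat_term c \<tau> z1 z2 A B) \<le>
       C * exp (- \<kappa> * (\<bar>A\<bar> + \<bar>B\<bar>))"
  proof -
    have "R \<ge> 0" by (simp add: R_def max.coboundedI1)
    then show thesis by (rule lat_term_bound [OF c y \<delta>]) (erule (1) that, blast)
  qed
  have s: "(\<lambda>p. (C * exp (\<kappa> * (\<bar>j\<bar> + \<bar>\<epsilon>\<bar>))) * (case p of (a::int, b::int) \<Rightarrow>
       exp (- \<kappa> * (\<bar>of_int a\<bar> + \<bar>of_int b\<bar>)))) summable_on UNIV"
    by (intro summable_on_cmult_right summable_on_exp_neg_abs_int2 \<kappa>)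
  show ?thesis
  proof (rule summable_on_comparison_test [OF s])
    fix p :: "int \<times> int"
    obtain a b where p: "p = (a, b)" by fastforce
    let ?A = "j + real M * of_int a" and ?B = "\<epsilon> + of_int b"
    have "norm (lat_term c \<tau> z1 z2 ?A ?B) \<le>
       (1 + \<bar>?A\<bar> + norm (z1 + of_real ?A * \<tau> + of_real ?B)) * norm (lat_term c \<tau> z1 z2 ?A ?B)"
      using mult_right_mono [of 1 "1 + \<bar>?A\<bar> + norm (z1 + of_real ?A * \<tau> + of_real ?B)"] by simp
    also have "\<dots> \<le> C * exp (- \<kappa> * (\<bar>?A\<bar> + \<bar>?B\<bar>))"
      by (rule b) (use away in \<open>auto simp: R_def\<close>)
    also have "\<dots> \<le> C * (exp (\<kappa> * (\<bar>j\<bar> + \<bar>\<epsilon>\<bar>)) * exp (- \<kappa> * (\<bar>of_int a\<bar> + \<bar>of_int b\<bar>)))"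
      by (intro mult_left_mono exp_neg_lattice_index_le \<kappa> M)
    finally show "(case p of (a, b) \<Rightarrow> norm (u (a, b) * lat_term c \<tau> z1 z2 (j + real M * of_int a) (\<epsilon> + of_int b)))
        \<le> (C * exp (\<kappa> * (\<bar>j\<bar> + \<bar>\<epsilon>\<bar>))) * (case p of (a::int, b::int) \<Rightarrow> exp (- \<kappa> * (\<bar>of_int a\<bar> + \<bar>of_int b\<bar>)))"
      unfolding p prod.case norm_mult u by (simp add: mult.assoc)
  qed auto
qed

section \<open>Theta functions of level l and the completed Appell sum\<close>

lemma Theta_eq_infsum:
  "Theta j l \<tau> w = (\<Sum>\<^sub>\<infinity>a::int. ee (of_nat l * (of_int j / (2 * of_nat l) + of_int a)\<^sup>2 * \<tau>) *
     ee (of_nat l * (of_int j / (2 * of_nat l) + of_int a) * w))"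
proof -
  have "int_shift (of_int j / (2 * of_nat l)) = range (\<lambda>a::int. of_int j / (2 * of_nat l) + of_int a)"
    by (auto simp: int_shift_def)
  then show ?thesis
    unfolding Theta_def by (simp only:) (subst infsum_reindex, auto simp: inj_on_def o_def)
qed

lemma Theta_uminus_left: "Theta (- j) l \<tau> w = Theta j l \<tau> (- w)"
  unfolding Theta_eq_infsum
proof (rule infsum_reindex_bij_witness [of _ uminus uminus])
  fix a :: int
  have "of_int (- j) / (2 * of_nat l) + of_int (- a) = (- (of_int j / (2 * of_nat l) + of_int a) :: complex)"
    by simp
  then show "ee (of_nat l * (of_int j / (2 * of_nat l) + of_int (- a))\<^sup>2 * \<tau>) *
      ee (of_nat l * (of_int j / (2 * of_nat l) + of_int (- a)) * (- w)) =
    ee (of_nat l * (of_int (- j) / (2 * of_nat l) + of_int a)\<^sup>2 * \<tau>) *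
      ee (of_nat l * (of_int (- j) / (2 * of_nat l) + of_int a) * w)"
    by (simp add: power2_eq_square algebra_simps)
qed auto

lemma Theta_add_period:
  assumes "l > 0"
  shows "Theta (j + 2 * int l * k) l \<tau> w = Theta j l \<tau> w"
proof -
  have eq: "of_int (j + 2 * int l * k) / (2 * of_nat l) + of_int a =
     (of_int j / (2 * of_nat l) + of_int (a + k) :: complex)" for a
    using assms by (simp add: field_simps)
  show ?thesis
    unfolding Theta_eq_infsum eq
    by (rule infsum_reindex_bij_witness [of _ "\<lambda>a. a - k" "\<lambda>a. a + k"]) auto
qed

text \<open>For row a, \<open>gaussian_partial_fractions\<close> is used with t = l / Im \<tau>. It
  returns the a-th summand of \<open>Phi1\<close> and a series over n. The latter is summed over a
  first, which gives a theta function of index n, and then over n by residue classes modulo 2 l,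
  which gives \<open>Rfun\<close>.\<close>

lemma Phi1_completed:
  assumes l: "l > 0" and y: "Im \<tau> > 0" and nz: "\<And>a b :: int. z1 + of_int a * \<tau> + of_int b \<noteq> 0"
  shows "Phi1 l \<tau> z1 z2 - 1 / 2 * (\<Sum>j = 0..2 * int l - 1.
      Rfun j l \<tau> ((z1 - z2) / 2) * Theta j l \<tau> (z1 + z2)) = lat_sum l 1 0 0 0 \<tau> z1 z2"
proof -
  define y where "y = Im \<tau>"
  define t where "t = real l / y"
  define v w where "v = (z1 - z2) / 2" and "w = z1 + z2"
  define \<theta> where "\<theta> = t * (Im z1 - Im z2)"
  define \<zeta> where "\<zeta> = (\<lambda>a::int. z1 + of_int a * \<tau>)"
  define T where "T = (\<lambda>a::int. ee (of_nat l * of_int a * w) * ee (of_int a ^ 2 * of_nat l * \<tau>))"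
  define e where "e = (\<lambda>n::int. Efun ((of_int n - \<theta>) / sqrt t) - sgn (of_int n + 1 / 2))"
  have y0: "y > 0" using y by (simp add: y_def)
  have t0: "t > 0" using y0 l by (simp add: t_def)
  obtain d where d: "d > 0" "\<And>a b :: int. d \<le> norm (z1 + of_int a * \<tau> + of_int b)"
    using lattice_avoid_bounded_below [OF y nz] by blast
  have \<zeta>_nint: "\<zeta> a \<notin> \<int>" for a
  proof
    assume "\<zeta> a \<in> \<int>"
    then obtain b where "\<zeta> a = of_int b" by (auto elim: Ints_cases)
    then show False using nz [of a "- b"] by (simp add: \<zeta>_def)
  qed
  define g where "g = (\<lambda>(a::int) (b::int). exp (- (of_real (pi * t) * (\<zeta> a + of_int b)\<^sup>2) +
            2 * of_real pi * \<i> * of_real \<theta> * (\<zeta> a + of_int b)) / (\<zeta> a + of_int b))"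
  have summand: "ee (of_real (- (real l / real 1) * (0 + real 1 * of_int a) * (0 + of_int b))) *
        lat_term (real l / real 1) \<tau> z1 z2 (0 + real 1 * of_int a) (0 + of_int b) = T a * g a b" for a b
  proof -
    define \<xi> where "\<xi> = z1 + of_int a * \<tau> + of_int b"
    have "of_real (- (real l / real 1) * (0 + real 1 * of_int a) * (0 + of_int b)) = (of_int (- (int l * a * b)) :: complex)"
      by simp
    then have 1: "ee (of_real (- (real l / real 1) * (0 + real 1 * of_int a) * (0 + of_int b))) = 1"
      by (simp only: ee_of_int)
    \<comment> \<open>Trading the conjugate for \<xi> makes the exponent a quadratic polynomial in
      \<xi>. The part a Im \<tau> of the linear term contributes ee(l a \<xi>), in which b drops out
      by integrality, and this joins ee(l a z2) to form \<open>T a\<close>.\<close>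
    have cn: "cnj \<xi> + 2 * \<i> * of_real (Im z2) = \<xi> - 2 * \<i> * of_real (Im z1 - Im z2 + of_int a * y)"
      by (simp add: \<xi>_def complex_eq_iff y_def)
    have "ee (of_nat l * of_int a * z2) * exp (- (of_real (pi * t) * \<xi> * (cnj \<xi> + 2 * \<i> * of_real (Im z2)))) =
       T a * exp (- (of_real (pi * t) * \<xi>\<^sup>2) + 2 * of_real pi * \<i> * of_real \<theta> * \<xi>)"
    proof -
      have ty: "of_real t * of_real y = (of_nat l :: complex)"
        using y0 unfolding of_real_mult [symmetric] by (simp add: t_def)
      have "- (of_real (pi * t) * \<xi> * (cnj \<xi> + 2 * \<i> * of_real (Im z2))) =
         - (of_real (pi * t) * \<xi>\<^sup>2) + 2 * of_real pi * \<i> * of_real \<theta> * \<xi> + 2 * of_real pi * \<i> * ((of_real t * of_real y) * of_int a * \<xi>)"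
        unfolding cn by (simp add: \<theta>_def algebra_simps power2_eq_square)
      then have "ee (of_nat l * of_int a * z2) * exp (- (of_real (pi * t) * \<xi> * (cnj \<xi> + 2 * \<i> * of_real (Im z2)))) =
        T a * ee (of_int (int l * a * b)) * exp (- (of_real (pi * t) * \<xi>\<^sup>2) + 2 * of_real pi * \<i> * of_real \<theta> * \<xi>)"
        unfolding ty T_def ee_def mult_exp_exp
        by (intro arg_cong [where f = exp]) (simp add: w_def \<xi>_def algebra_simps power2_eq_square)
      then show ?thesis by (simp only: ee_of_int mult_1_right)
    qed
    then show ?thesis
      unfolding 1 lat_term_def g_def \<zeta>_def y_def [symmetric]
      by (simp add: t_def \<xi>_def)
  qed
  have sm_lat: "(\<lambda>(a, b). norm (T a * g a b)) summable_on UNIV"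
  proof -
    define U where "U = (\<lambda>(a::int, b::int). ee (of_real (- (real l / real 1) * (0 + real 1 * of_int a) * (0 + of_int b))))"
    have U: "norm (U p) = 1" for p by (simp only: U_def case_prod_unfold norm_ee_of_real)
    have "(\<lambda>(a, b). norm (U (a, b) * lat_term (real l / real 1) \<tau> z1 z2 (0 + real 1 * of_int a) (0 + of_int b))) summable_on UNIV"
      by (rule summable_lat_sum [OF _ y _ d(1) _ U]) (use l d in auto)
    then show ?thesis unfolding U_def prod.case summand .
  qed
  define G where "G = (\<lambda>(a::int) (n::int). T a * (1 / 2 * (of_real (e n) * ee (of_int n * \<zeta> a))))"
  have sm_G: "(\<lambda>(a, n). norm (G a n)) summable_on UNIV"
  proof -
    define K1 K2 K3 where "K1 = 2 * pi * y * \<theta> / real l - 2 * pi * Im z1" and "K2 = - 2 * pi * real l * Im w"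
      and "K3 = - pi * y * \<theta>\<^sup>2 / real l"
    define K where "K = \<bar>K1\<bar> + \<bar>K2\<bar>"
    define c where "c = pi * y / real l"
    have c0: "c > 0" using y0 l by (simp add: c_def)
    define E0 where "E0 = exp (pi * (\<bar>\<theta>\<bar> + 1)\<^sup>2 / t)"
    define C where "C = E0 * exp (K3 + 2 * ((K + 1)\<^sup>2 / (4 * c)))"
    have s: "(\<lambda>p. C * (case p of (a::int, n::int) \<Rightarrow>
       exp (- (1 / 2) * (\<bar>of_int a\<bar> + \<bar>of_int n\<bar>)))) summable_on UNIV"
      by (intro summable_on_cmult_right summable_on_exp_neg_abs_int2) simp
    show ?thesis
    proof (rule summable_on_comparison_test [OF s])
      fix p :: "int \<times> int"
      obtain a n where p: "p = (a, n)" by fastforce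
      define a' n' where "a' = real_of_int a" and "n' = real_of_int n"
      \<comment> \<open>\<open>ee (of_int n * \<zeta> a)\<close> alone may grow. Together with
        \<open>T a\<close> and the Gaussian in n the quadratic part of the exponent is -(pi y / l)
        (2 l^2 a^2 + 2 l a n + n^2) = -c (X^2 + Y^2), which is definite.\<close>
      define X Y where "X = n' + real l * a'" and "Y = real l * a'"
      have l1: "real l \<ge> 1" using l by simp
      have aY: "\<bar>a'\<bar> \<le> \<bar>Y\<bar>" using mult_right_mono [OF l1, of "\<bar>a'\<bar>"] by (simp add: Y_def abs_mult)
      have nX: "\<bar>n'\<bar> \<le> \<bar>X\<bar> + \<bar>Y\<bar>" by (simp add: X_def Y_def)
      have "norm (G a n) = norm (T a) * (1 / 2 * (\<bar>e n\<bar> * norm (ee (of_int n * \<zeta> a))))"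
        unfolding G_def norm_mult norm_of_real by simp
      also have "\<dots> \<le> norm (T a) * (1 / 2 * (2 * E0 * exp (- pi * (n' - \<theta>)\<^sup>2 / t) * norm (ee (of_int n * \<zeta> a))))"
        unfolding e_def E0_def n'_def
        by (intro mult_left_mono mult_right_mono Efun_minus_sgn_int_bound t0) auto
      also have "\<dots> = E0 * exp (- c * X\<^sup>2 + - c * Y\<^sup>2 + K1 * n' + K2 * a' + K3)"
      proof -
        have T: "norm (T a) = exp (- 2 * pi * (real l * a' * Im w + a'\<^sup>2 * real l * y))"
        proof -
          have "T a = ee (of_real (real l * a') * w + of_real (a'\<^sup>2 * real l) * \<tau>)"
            unfolding T_def ee_add [symmetric] by (rule arg_cong [where f = ee]) (simp add: a'_def)
          then show ?thesis by (simp add: norm_ee y_def)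
        qed
        have N: "norm (ee (of_int n * \<zeta> a)) = exp (- 2 * pi * (n' * (Im z1 + a' * y)))"
          by (simp add: norm_ee \<zeta>_def n'_def a'_def y_def)
        have "- 2 * pi * (real l * a' * Im w + a'\<^sup>2 * real l * y) + (- pi * (n' - \<theta>)\<^sup>2 / t + - 2 * pi * (n' * (Im z1 + a' * y))) =
           - c * X\<^sup>2 + - c * Y\<^sup>2 + K1 * n' + K2 * a' + K3"
          unfolding c_def X_def Y_def K1_def K2_def K3_def t_def using y0 l
          by (simp add: field_simps power2_eq_square)
        then show ?thesis unfolding T N by (simp add: flip: exp_add)
      qed
      also have "\<dots> \<le> E0 * exp (K3 + 2 * ((K + 1)\<^sup>2 / (4 * c)) + - (1 / 2) * (\<bar>a'\<bar> + \<bar>n'\<bar>))"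
      proof -
        have "K1 * n' \<le> \<bar>K1\<bar> * (\<bar>X\<bar> + \<bar>Y\<bar>)"
          using mult_left_mono [OF nX, of "\<bar>K1\<bar>"] abs_ge_self [of "K1 * n'"] unfolding abs_mult by linarith
        moreover have "K2 * a' \<le> \<bar>K2\<bar> * (\<bar>X\<bar> + \<bar>Y\<bar>)"
          using mult_left_mono [of "\<bar>a'\<bar>" "\<bar>X\<bar> + \<bar>Y\<bar>" "\<bar>K2\<bar>"] aY abs_ge_self [of "K2 * a'"] unfolding abs_mult by linarith
        ultimately have "- c * X\<^sup>2 + - c * Y\<^sup>2 + K1 * n' + K2 * a' + K3 \<le>
            (- c * \<bar>X\<bar>\<^sup>2 + K * \<bar>X\<bar>) + (- c * \<bar>Y\<bar>\<^sup>2 + K * \<bar>Y\<bar>) + K3"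
          by (simp add: K_def algebra_simps)
        also have "\<dots> \<le> ((K + 1)\<^sup>2 / (4 * c) - \<bar>X\<bar>) + ((K + 1)\<^sup>2 / (4 * c) - \<bar>Y\<bar>) + K3"
          by (intro add_right_mono add_mono quadratic_le_linear c0)
        also have "\<dots> \<le> K3 + 2 * ((K + 1)\<^sup>2 / (4 * c)) + - (1 / 2) * (\<bar>a'\<bar> + \<bar>n'\<bar>)"
        proof -
          from add_mono [OF aY nX] show ?thesis by (simp add: algebra_simps)
        qed
        finally show ?thesis by (simp add: E0_def)
      qed
      also have "\<dots> = C * exp (- (1 / 2) * (\<bar>a'\<bar> + \<bar>n'\<bar>))"
        by (simp only: C_def mult.assoc mult_exp_exp)
      finally show "(case p of (a, n) \<Rightarrow> norm (G a n)) \<le> C * (case p of (a::int, n::int) \<Rightarrow>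
       exp (- (1 / 2) * (\<bar>of_int a\<bar> + \<bar>of_int n\<bar>)))"
        by (simp add: p a'_def n'_def)
    qed auto
  qed
  have sm2: "(\<lambda>(a, b). f a b) summable_on UNIV \<times> UNIV" if "(\<lambda>(a, b). norm (f a b)) summable_on UNIV"
    for f :: "int \<Rightarrow> int \<Rightarrow> complex"
    using abs_summable_summable [of "\<lambda>(a, b). f a b" "UNIV \<times> UNIV"] that by (simp add: case_prod_unfold)
  have inner: "\<i> / (2 * of_real pi) * (\<Sum>\<^sub>\<infinity>b. T a * g a b) = T a / (1 - ee (\<zeta> a)) + (\<Sum>\<^sub>\<infinity>n. G a n)" for a
  proof -
    have "\<i> / (2 * of_real pi) * (\<Sum>\<^sub>\<infinity>b. T a * g a b) = T a * (\<i> / (2 * of_real pi) * (\<Sum>\<^sub>\<infinity>b. g a b))"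
      unfolding infsum_cmult_right' by simp
    also have "\<dots> = T a * (1 / (1 - ee (\<zeta> a)) + 1 / 2 * (\<Sum>\<^sub>\<infinity>n. of_real (e n) * ee (of_int n * \<zeta> a)))"
      using gaussian_partial_fractions [OF t0 \<zeta>_nint [of a], where \<theta> = \<theta>] unfolding g_def e_def by simp
    also have "\<dots> = T a / (1 - ee (\<zeta> a)) + (\<Sum>\<^sub>\<infinity>n. G a n)"
      unfolding G_def infsum_cmult_right' by (simp add: distrib_left)
    finally show ?thesis .
  qed
  have s1: "(\<lambda>a. \<Sum>\<^sub>\<infinity>b. T a * g a b) summable_on UNIV"
    using summable_on_Sigma_banach [OF sm2 [OF sm_lat]] by simp
  have s2: "(\<lambda>a. \<Sum>\<^sub>\<infinity>n. G a n) summable_on UNIV"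
    using summable_on_Sigma_banach [OF sm2 [OF sm_G]] by simp
  \<comment> \<open>The series of \<open>Phi1\<close> is summable as a difference of two summable
    ones, so its denominators need no estimate of their own.\<close>
  have s3: "(\<lambda>a. T a / (1 - ee (\<zeta> a))) summable_on UNIV"
  proof -
    have "(\<lambda>a. \<i> / (2 * of_real pi) * (\<Sum>\<^sub>\<infinity>b. T a * g a b) + - (\<Sum>\<^sub>\<infinity>n. G a n)) summable_on UNIV"
      by (intro summable_on_add summable_on_cmult_right s1) (simp add: summable_on_uminus s2)
    then show ?thesis unfolding inner by simp
  qed
  have "lat_sum l 1 0 0 0 \<tau> z1 z2 = \<i> / (2 * of_real pi) * (\<Sum>\<^sub>\<infinity>(a, b). T a * g a b)"
    unfolding lat_sum_def summand ..
  also have "(\<Sum>\<^sub>\<infinity>(a, b). T a * g a b) = (\<Sum>\<^sub>\<infinity>a. \<Sum>\<^sub>\<infinity>b. T a * g a b)"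
    using infsum_Sigma'_banach [OF sm2 [OF sm_lat]] by simp
  also have "\<i> / (2 * of_real pi) * \<dots> = (\<Sum>\<^sub>\<infinity>a. \<i> / (2 * of_real pi) * (\<Sum>\<^sub>\<infinity>b. T a * g a b))"
    by (rule infsum_cmult_right' [symmetric])
  also have "\<dots> = (\<Sum>\<^sub>\<infinity>a. T a / (1 - ee (\<zeta> a)) + (\<Sum>\<^sub>\<infinity>n. G a n))"
    by (simp only: inner)
  also have "\<dots> = (\<Sum>\<^sub>\<infinity>a. T a / (1 - ee (\<zeta> a))) + (\<Sum>\<^sub>\<infinity>a. \<Sum>\<^sub>\<infinity>n. G a n)"
    by (rule infsum_add [OF s3 s2])
  also have "(\<Sum>\<^sub>\<infinity>a. T a / (1 - ee (\<zeta> a))) = Phi1 l \<tau> z1 z2"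
    unfolding Phi1_def T_def \<zeta>_def w_def ee_add ..
  also have "(\<Sum>\<^sub>\<infinity>a. \<Sum>\<^sub>\<infinity>n. G a n) = (\<Sum>\<^sub>\<infinity>n. \<Sum>\<^sub>\<infinity>a. G a n)"
    by (rule infsum_swap_banach [OF sm2 [OF sm_G]])
  also have "\<dots> = (\<Sum>j = 0..2 * int l - 1. - (1 / 2) * (Rfun j l \<tau> v * Theta j l \<tau> w))"
  proof -
    define H where "H = (\<lambda>n. \<Sum>\<^sub>\<infinity>a. G a n)"
    define A where "A = (\<lambda>j. {r :: int. [r = j] (mod (2 * int l))})"
    have H: "H n = 1 / 2 * of_real (e n) * ee (of_int n * v - of_int n ^ 2 / (4 * of_nat l) * \<tau>) * Theta n l \<tau> w" for n
    proof -
      have "G a n = (1 / 2 * of_real (e n) * ee (of_int n * v - of_int n ^ 2 / (4 * of_nat l) * \<tau>)) *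
        (ee (of_nat l * (of_int n / (2 * of_nat l) + of_int a)\<^sup>2 * \<tau>) *
          ee (of_nat l * (of_int n / (2 * of_nat l) + of_int a) * w))" for a
      proof -
        \<comment> \<open>With z1 = v + w/2 this is the completed square l a^2 + n a = l (a + n / (2
          l))^2 - n^2 / (4 l), from which \<open>Theta n l\<close> emerges.\<close>
        have "T a * ee (of_int n * \<zeta> a) = ee (of_int n * v - of_int n ^ 2 / (4 * of_nat l) * \<tau>) *
          (ee (of_nat l * (of_int n / (2 * of_nat l) + of_int a)\<^sup>2 * \<tau>) *
          ee (of_nat l * (of_int n / (2 * of_nat l) + of_int a) * w))"
          unfolding T_def ee_add [symmetric]
          by (rule arg_cong [where f = ee])
             (use l in \<open>simp add: \<zeta>_def v_def w_def field_simps power2_eq_square\<close>)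
        then show ?thesis by (simp add: G_def mult_ac)
      qed
      then show ?thesis unfolding H_def Theta_eq_infsum infsum_cmult_right' [symmetric] by (simp only:)
    qed
    have sm_H: "H summable_on B" for B
    proof -
      have "(\<lambda>(n, a). G a n) summable_on UNIV \<times> UNIV"
        using sm2 [OF sm_G] summable_on_swap [of "\<lambda>(a, n). G a n" UNIV UNIV] by (simp add: case_prod_unfold)
      then have "H summable_on UNIV"
        using summable_on_Sigma_banach [of "\<lambda>n a. G a n" UNIV "\<lambda>_. UNIV"] by (simp add: H_def)
      then show ?thesis by (rule summable_on_subset_banach) simp
    qed
    have UN: "(\<Union>j\<in>{0..2 * int l - 1}. A j) = UNIV"
    proof -
      have "r \<in> A (r mod (2 * int l))" "r mod (2 * int l) \<in> {0..2 * int l - 1}" for r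
        using l by (auto simp: A_def cong_def)
      then show ?thesis by blast
    qed
    have disj: "A i \<inter> A j = {}" if "i \<in> {0..2 * int l - 1}" "j \<in> {0..2 * int l - 1}" "i \<noteq> j" for i j
      using that by (auto simp: A_def cong_def)
    have "(\<Sum>\<^sub>\<infinity>n. H n) = (\<Sum>j = 0..2 * int l - 1. infsum H (A j))"
      unfolding UN [symmetric] by (rule sum_infsum [symmetric]) (use sm_H disj in auto)
    also have "\<dots> = (\<Sum>j = 0..2 * int l - 1. - (1 / 2) * (Rfun j l \<tau> v * Theta j l \<tau> w))"
    proof (rule sum.cong [OF refl])
      fix j assume j: "j \<in> {0..2 * int l - 1}"
      have "infsum H (A j) = (\<Sum>\<^sub>\<infinity>r\<in>A j.
        (of_real (sgn (of_int r - 1 / 2 - of_int j + 2 * of_nat l)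
                 - Efun ((of_int r - 2 * of_nat l * (Im v / Im \<tau>)) * sqrt (Im \<tau> / of_nat l))) *
        exp (- (of_real pi * \<i> * of_int r ^ 2 / (2 * of_nat l)) * \<tau>
             + 2 * of_real pi * \<i> * of_int r * v)) * (- (1 / 2) * Theta j l \<tau> w))"
      proof (rule infsum_cong)
        fix r assume "r \<in> A j"
        then obtain k' where "j = r + 2 * int l * k'"
          unfolding A_def by (auto simp: cong_iff_lin)
        then obtain k where k: "r = j + 2 * int l * k"
          using that [of "- k'"] by simp
        have Th: "Theta r l \<tau> w = Theta j l \<tau> w" unfolding k by (rule Theta_add_period [OF l])
        \<comment> \<open>For r congruent to j with 0 \<le> j < 2 l both signs are positive exactly
          when r \<ge> j. The two borderline values of the left argument are 2 l - 1/2 at r = j and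
          -1/2 at r = j - 2 l.\<close>
        have sg: "sgn (of_int r - 1 / 2 - of_int j + 2 * of_nat l) = sgn (real_of_int r + 1 / 2)"
        proof (cases "k \<ge> 0")
          case True
          then have "r \<ge> 0" "r - j \<ge> 0" using j k by auto
          then have "real_of_int r \<ge> 0" "real_of_int r - of_int j \<ge> 0" by linarith+
          then show ?thesis using l by (simp add: sgn_if)
        next
          case False
          then have "2 * int l * k \<le> 2 * int l * (- 1)" using l by (intro mult_left_mono) auto
          moreover have "j \<le> 2 * int l - 1" using j by simp
          ultimately have "r < 0" "r - j \<le> - 2 * int l" using k by linarith+
          then have "real_of_int r \<le> - 1" "real_of_int r - of_int j \<le> - 2 * of_nat l" by linarith+
          then show ?thesis by (simp add: sgn_if)
        qed
        have arg: "(of_int r - 2 * of_nat l * (Im v / Im \<tau>)) * sqrt (Im \<tau> / of_nat l) = (of_int r - \<theta>) / sqrt t"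
        proof -
          have "sqrt (Im \<tau> / of_nat l) = 1 / sqrt t"
            using y0 l by (simp add: t_def y_def real_sqrt_divide)
          moreover have "2 * of_nat l * (Im v / Im \<tau>) = \<theta>"
            using y0 by (simp add: \<theta>_def t_def y_def v_def field_simps)
          ultimately show ?thesis by simp
        qed
        have ex: "exp (- (of_real pi * \<i> * of_int r ^ 2 / (2 * of_nat l)) * \<tau> + 2 * of_real pi * \<i> * of_int r * v) =
            ee (of_int r * v - of_int r ^ 2 / (4 * of_nat l) * \<tau>)"
          unfolding ee_def by (rule arg_cong [where f = exp]) (simp add: algebra_simps)
        show "H r = (of_real (sgn (of_int r - 1 / 2 - of_int j + 2 * of_nat l)
                 - Efun ((of_int r - 2 * of_nat l * (Im v / Im \<tau>)) * sqrt (Im \<tau> / of_nat l))) *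
        exp (- (of_real pi * \<i> * of_int r ^ 2 / (2 * of_nat l)) * \<tau>
             + 2 * of_real pi * \<i> * of_int r * v)) * (- (1 / 2) * Theta j l \<tau> w)"
          unfolding H Th sg arg ex e_def by (simp add: algebra_simps)
      qed
      also have "\<dots> = - (1 / 2) * (Rfun j l \<tau> v * Theta j l \<tau> w)"
        unfolding infsum_cmult_left' Rfun_def A_def by simp
      finally show "infsum H (A j) = - (1 / 2) * (Rfun j l \<tau> v * Theta j l \<tau> w)" .
    qed
    finally show ?thesis by (simp add: H_def)
  qed
  also have "Phi1 l \<tau> z1 z2 + \<dots> = Phi1 l \<tau> z1 z2 - 1 / 2 * (\<Sum>j = 0..2 * int l - 1. Rfun j l \<tau> v * Theta j l \<tau> w)"
    unfolding sum_distrib_left [symmetric] by simp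
  finally show ?thesis unfolding v_def w_def by simp
qed

text \<open>The substitution (z1, z2) -> (-z2, -z1) fixes z1 - z2 and reverses z1 + z2, and
  reversing the argument turns \<open>Theta j\<close> into \<open>Theta (- j)\<close>. Hence the
  theta difference in \<open>Phi_tilde\<close> completes both Appell sums in the same way.\<close>

lemma Phi_tilde_eq_lat_sum:
  assumes l: "l > 0" and y: "Im \<tau> > 0"
    and nz1: "\<And>a b :: int. z1 + of_int a * \<tau> + of_int b \<noteq> 0"
    and nz2: "\<And>a b :: int. z2 + of_int a * \<tau> + of_int b \<noteq> 0"
  shows "Phi_tilde l \<tau> z1 z2 = lat_sum l 1 0 0 0 \<tau> z1 z2 - lat_sum l 1 0 0 0 \<tau> (- z2) (- z1)"
proof -
  have nz2': "- z2 + of_int a * \<tau> + of_int b \<noteq> 0" for a b :: int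
    using nz2 [of "- a" "- b"] by (simp add: algebra_simps eq_neg_iff_add_eq_0)
  have "(- z2 - - z1) / 2 = (z1 - z2) / 2" "- z2 + - z1 = - (z1 + z2)" by simp_all
  with Phi1_completed [OF l y nz2', of "- z1"]
  have 2: "Phi1 l \<tau> (- z2) (- z1) - 1 / 2 * (\<Sum>j = 0..2 * int l - 1.
      Rfun j l \<tau> ((z1 - z2) / 2) * Theta (- j) l \<tau> (z1 + z2)) = lat_sum l 1 0 0 0 \<tau> (- z2) (- z1)"
    by (simp only: Theta_uminus_left)
  show ?thesis
    unfolding Phi_tilde_def Phi_def right_diff_distrib sum_subtractf
      Phi1_completed [OF l y nz1, of z2, symmetric] 2 [symmetric] by simp
qed

section \<open>Modular transformations of the lattice sum\<close>

text \<open>The translations that occur later have half-integral coordinates. After doubling, the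
  claim is that 2 z keeps a distance from the lattice, which is what regularity says.\<close>

lemma regular_point_bounded_below:
  assumes y: "Im \<tau> > 0" and reg: "regular_point \<tau> z"
  obtains d where "d > 0"
    "\<And>A B :: real. 2 * A \<in> \<int> \<Longrightarrow> 2 * B \<in> \<int> \<Longrightarrow> d \<le> norm (z + of_real A * \<tau> + of_real B)"
proof -
  have "2 * z + of_int a * \<tau> + of_int b \<noteq> 0" for a b :: int
  proof
    assume "2 * z + of_int a * \<tau> + of_int b = 0"
    then have "2 * z = of_int (- b) + of_int (- a) * \<tau>" by (simp add: algebra_simps eq_neg_iff_add_eq_0)
    then show False using reg unfolding regular_point_def by blast
  qed
  from lattice_avoid_bounded_below [OF y this]
  obtain d where d: "d > 0" "\<And>a b :: int. d \<le> norm (2 * z + of_int a * \<tau> + of_int b)" by blast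
  have "d / 2 \<le> norm (z + of_real A * \<tau> + of_real B)" if AB: "2 * A \<in> \<int>" "2 * B \<in> \<int>" for A B :: real
  proof -
    obtain a b where ab: "2 * A = of_int a" "2 * B = of_int b" using AB by (auto elim!: Ints_cases)
    have "2 * z + of_int a * \<tau> + of_int b = 2 * z + of_real (2 * A) * \<tau> + of_real (2 * B)"
      unfolding ab by simp
    also have "\<dots> = 2 * (z + of_real A * \<tau> + of_real B)" by (simp add: algebra_simps)
    finally have "2 * z + of_int a * \<tau> + of_int b = 2 * (z + of_real A * \<tau> + of_real B)" .
    with d(2) [of a b] have "d \<le> norm (2 * (z + of_real A * \<tau> + of_real B))" by (simp only:)
    then show ?thesis unfolding norm_mult by simp
  qed
  with d(1) that [of "d / 2"] show ?thesis by simp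
qed

lemma regular_point_nonzero:
  assumes "regular_point \<tau> z" "2 * A \<in> \<int>" "2 * B \<in> \<int>"
  shows "z + of_real A * \<tau> + of_real B \<noteq> 0"
proof
  assume *: "z + of_real A * \<tau> + of_real B = 0"
  obtain a b where ab: "2 * A = of_int a" "2 * B = of_int b" using assms by (auto elim!: Ints_cases)
  have "2 * z = 2 * (z + of_real A * \<tau> + of_real B) - of_real (2 * B) - of_real (2 * A) * \<tau>"
    by (simp add: algebra_simps)
  also have "\<dots> = of_int (- b) + of_int (- a) * \<tau>" unfolding * ab by simp
  finally show False using assms(1) unfolding regular_point_def by blast
qed

lemma regular_point_uminus: "regular_point \<tau> z \<Longrightarrow> regular_point \<tau> (- z)"
  unfolding regular_point_def
proof (intro allI notI)
  fix a b :: int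
  assume *: "\<forall>a b :: int. 2 * z \<noteq> of_int a + of_int b * \<tau>" and "2 * - z = of_int a + of_int b * \<tau>"
  moreover have "2 * z = - (2 * - z)" by simp
  ultimately have "2 * z = - (of_int a + of_int b * \<tau>)" by (simp only:)
  then have "2 * z = of_int (- a) + of_int (- b) * \<tau>" by simp
  with * show False by blast
qed

lemma regular_point_S:
  assumes "\<tau> \<noteq> 0" "regular_point \<tau> z" shows "regular_point (- 1 / \<tau>) (z / \<tau>)"
  unfolding regular_point_def
proof (intro allI notI)
  fix a b :: int
  assume "2 * (z / \<tau>) = of_int a + of_int b * (- 1 / \<tau>)"
  then have "2 * z = of_int (- b) + of_int a * \<tau>" using assms(1) by (simp add: field_simps)
  with assms(2) show False unfolding regular_point_def by blast
qed

lemma regular_point_T: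
  assumes "regular_point \<tau> z" shows "regular_point (\<tau> + 1) z"
  unfolding regular_point_def
proof (intro allI notI)
  fix a b :: int
  assume "2 * z = of_int a + of_int b * (\<tau> + 1)"
  then have "2 * z = of_int (a + b) + of_int b * \<tau>" by (simp add: algebra_simps)
  with assms show False unfolding regular_point_def by blast
qed

lemma Im_minus_inverse: "Im (- 1 / \<tau>) = Im \<tau> / (norm \<tau>)\<^sup>2"
  by (simp add: cmod_power2 Im_divide)

text \<open>The pole variable becomes (z1 + B \<tau> - A) / \<tau>, so S acts on coordinates by (A,
  B) -> (B, -A). The |\<tau>|^2 from Im (-1/\<tau>) cancels against the conjugates except next to
  z2, where cnj \<tau> = \<tau> - 2 i Im \<tau> leaves ee(c \<zeta> z2 / \<tau>). Combined with ee(c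
  A z2 / \<tau>) this is the index factor times the new phase ee(c B z2).\<close>

lemma lat_term_S:
  assumes y: "Im \<tau> > 0"
  shows "lat_term c (- 1 / \<tau>) (z1 / \<tau>) (z2 / \<tau>) A B =
    \<tau> * ee (of_real c * z1 * z2 / \<tau>) * lat_term c \<tau> z1 z2 B (- A)"
proof -
  define \<zeta> where "\<zeta> = z1 + of_real B * \<tau> + of_real (- A)"
  have \<tau>: "\<tau> \<noteq> 0" "cnj \<tau> \<noteq> 0" using y by auto
  have \<zeta>': "z1 / \<tau> + of_real A * (- 1 / \<tau>) + of_real B = \<zeta> / \<tau>"
    using \<tau> by (simp add: \<zeta>_def field_simps)
  define Y where "Y = (of_real (Im \<tau>) :: complex)"
  have Y: "Y \<noteq> 0" using y by (simp add: Y_def)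
  have Imz: "2 * \<i> * of_real (Im w) = w - cnj w" for w by (simp add: complex_eq_iff)
  have 2: "cnj \<tau> = \<tau> - 2 * \<i> * Y" by (simp add: Y_def complex_eq_iff)
  have "of_real (pi * c / Im (- 1 / \<tau>)) * (\<zeta> / \<tau>) * (cnj (\<zeta> / \<tau>) + 2 * \<i> * of_real (Im (z2 / \<tau>))) =
     (of_real (pi * c) * (\<tau> * cnj \<tau>) / Y) * (\<zeta> / \<tau>) * (cnj \<zeta> / cnj \<tau> + (z2 / \<tau> - cnj z2 / cnj \<tau>))"
  proof -
    have k: "of_real (pi * c / (Im \<tau> / (norm \<tau>)\<^sup>2)) = of_real (pi * c) * (\<tau> * cnj \<tau>) / Y"
      by (simp add: Y_def flip: complex_norm_square)
    show ?thesis unfolding Im_minus_inverse Imz k by simp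
  qed
  also have "\<dots> = of_real (pi * c) / Y * \<zeta> * (cnj \<zeta> + z2 * (cnj \<tau> / \<tau>) - cnj z2)"
  proof -
    have "K * (\<tau> * t) / Y * (\<zeta> / \<tau>) * (u / t + (z2 / \<tau> - w / t)) = K / Y * \<zeta> * (u + z2 * (t / \<tau>) - w)"
      if "t \<noteq> 0" for K t u w
      using that \<tau>(1) Y by (simp add: field_simps)
    from this [OF \<tau>(2)] show ?thesis .
  qed
  also have "\<dots> = of_real (pi * c) / Y * \<zeta> * (cnj \<zeta> + (z2 - cnj z2)) - 2 * of_real pi * \<i> * (of_real c * \<zeta> * z2 / \<tau>)"
    unfolding 2 using \<tau>(1) Y by (simp add: field_simps)
  finally have ex: "of_real (pi * c / Im (- 1 / \<tau>)) * (\<zeta> / \<tau>) * (cnj (\<zeta> / \<tau>) + 2 * \<i> * of_real (Im (z2 / \<tau>))) =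
     of_real (pi * c / Im \<tau>) * \<zeta> * (cnj \<zeta> + 2 * \<i> * of_real (Im z2)) - 2 * of_real pi * \<i> * (of_real c * \<zeta> * z2 / \<tau>)"
    unfolding Imz by (simp add: Y_def)
  have "ee (of_real (c * A) * (z2 / \<tau>)) *
     exp (- (of_real (pi * c / Im \<tau>) * \<zeta> * (cnj \<zeta> + 2 * \<i> * of_real (Im z2)) - 2 * of_real pi * \<i> * (of_real c * \<zeta> * z2 / \<tau>))) =
    ee (of_real c * z1 * z2 / \<tau>) * (ee (of_real (c * B) * z2) *
     exp (- (of_real (pi * c / Im \<tau>) * \<zeta> * (cnj \<zeta> + 2 * \<i> * of_real (Im z2)))))"
  proof -
    have "of_real (c * A) * (z2 / \<tau>) + of_real c * \<zeta> * z2 / \<tau> = of_real c * z1 * z2 / \<tau> + of_real (c * B) * z2"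
      using \<tau>(1) by (simp add: \<zeta>_def field_simps)
    then have "2 * of_real pi * \<i> * (of_real (c * A) * (z2 / \<tau>)) + 2 * of_real pi * \<i> * (of_real c * \<zeta> * z2 / \<tau>) =
      2 * of_real pi * \<i> * (of_real c * z1 * z2 / \<tau>) + 2 * of_real pi * \<i> * (of_real (c * B) * z2)"
      by (simp only: distrib_left [symmetric])
    then show ?thesis
      unfolding ee_def mult_exp_exp by (intro arg_cong [where f = exp]) (simp add: algebra_simps)
  qed
  then show ?thesis
    unfolding lat_term_def \<zeta>' ex \<zeta>_def [symmetric] by simp
qed

lemma lat_term_T: "lat_term c (\<tau> + 1) z1 z2 A B = lat_term c \<tau> z1 z2 A (A + B)"
  by (simp add: lat_term_def algebra_simps)

lemma Ints_imp_ee_mult_nat: "x \<in> \<int> \<Longrightarrow> ee (of_nat l * of_int n * of_real x) = 1"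
proof -
  assume "x \<in> \<int>"
  then obtain i where "x = of_int i" by (auto elim: Ints_cases)
  then have "of_nat l * of_int n * of_real x = (of_int (int l * n * i) :: complex)" by simp
  then show ?thesis by (simp only: ee_of_int)
qed

text \<open>Translating z2 by k \<tau> raises Im z2 by k Im \<tau> and changes the exponent by a
  multiple of \<zeta>. The prefactor of \<open>Psi_tilde\<close> compensates this and the remaining
  shifts up to the phase ee(l a * 2 \<epsilon>), which is 1 because 2 \<epsilon> is an
  integer.\<close>

lemma lat_sum_rescale:
  assumes M: "M > 0" and y: "Im \<tau> > 0" and \<epsilon>: "2 * \<epsilon> \<in> \<int>"
  shows "ee (of_real (real l / real M * j * k) * \<tau>) * ee (of_real (real l / real M) * (of_real k * z1 + of_real j * z2)) *
      lat_sum l 1 0 0 0 (of_nat M * \<tau>) (z1 + of_real j * \<tau> + of_real \<epsilon>) (z2 + of_real k * \<tau> + of_real \<epsilon>) =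
    lat_sum l M j k \<epsilon> \<tau> z1 z2"
proof -
  define Z1 Z2 where "Z1 = z1 + of_real j * \<tau> + of_real \<epsilon>" and "Z2 = z2 + of_real k * \<tau> + of_real \<epsilon>"
  define P where "P = ee (of_real (real l / real M * j * k) * \<tau>) * ee (of_real (real l / real M) * (of_real k * z1 + of_real j * z2))"
  define c where "c = real l / real M"
  have "P * (ee (of_real (- (real l / real 1) * (0 + real 1 * of_int a) * (0 + of_int b))) *
        lat_term (real l / real 1) (of_nat M * \<tau>) Z1 Z2 (0 + real 1 * of_int a) (0 + of_int b)) =
      ee (of_real (- c * (k + real M * of_int a) * (\<epsilon> + of_int b))) *
        lat_term c \<tau> z1 z2 (j + real M * of_int a) (\<epsilon> + of_int b)" for a b :: int
  proof -
    define \<zeta> where "\<zeta> = z1 + of_real (j + real M * of_int a) * \<tau> + of_real (\<epsilon> + of_int b)"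
    define W where "W = of_real (pi * c / Im \<tau>) * \<zeta> * (cnj \<zeta> + 2 * \<i> * of_real (Im z2))"
    have \<zeta>': "Z1 + of_real (0 + real 1 * of_int a) * (of_nat M * \<tau>) + of_real (0 + of_int b) = \<zeta>"
      by (simp add: Z1_def \<zeta>_def algebra_simps)
    have cy: "of_real (pi * (real l / real 1) / Im (of_nat M * \<tau>)) = (of_real (pi * c / Im \<tau>) :: complex)"
      by (simp add: c_def)
    have W': "of_real (pi * c / Im \<tau>) * \<zeta> * (cnj \<zeta> + 2 * \<i> * of_real (Im Z2)) =
        W + 2 * of_real pi * \<i> * (of_real (c * k) * \<zeta>)"
    proof -
      have "Im Z2 = Im z2 + k * Im \<tau>" by (simp add: Z2_def)
      then show ?thesis using y unfolding W_def by (simp add: field_simps)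
    qed
    have cM: "of_real c * of_nat M = (of_nat l :: complex)"
      using M by (simp add: c_def)
    have arg: "of_real (c * j * k) * \<tau> + of_real c * (of_real k * z1 + of_real j * z2) +
        of_real (- (real l / real 1) * (0 + real 1 * of_int a) * (0 + of_int b)) +
        of_real (real l / real 1 * (0 + real 1 * of_int a)) * Z2 - of_real (c * k) * \<zeta> =
      of_real (- c * (k + real M * of_int a) * (\<epsilon> + of_int b)) + of_real (c * (j + real M * of_int a)) * z2
        + of_nat l * of_int a * of_real (2 * \<epsilon>)"
      unfolding \<zeta>_def Z2_def by (simp add: algebra_simps flip: cM)
    have "P * (ee (of_real (- (real l / real 1) * (0 + real 1 * of_int a) * (0 + of_int b))) *
       (ee (of_real (real l / real 1 * (0 + real 1 * of_int a)) * Z2) * exp (- (W + 2 * of_real pi * \<i> * (of_real (c * k) * \<zeta>))) / \<zeta>)) =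
      ee (of_real (c * j * k) * \<tau> + of_real c * (of_real k * z1 + of_real j * z2) +
        of_real (- (real l / real 1) * (0 + real 1 * of_int a) * (0 + of_int b)) +
        of_real (real l / real 1 * (0 + real 1 * of_int a)) * Z2 - of_real (c * k) * \<zeta>) * exp (- W) / \<zeta>"
      unfolding P_def c_def [symmetric] ee_add ee_diff
      by (simp add: ee_def exp_add exp_minus exp_diff field_simps)
    also have "\<dots> = ee (of_real (- c * (k + real M * of_int a) * (\<epsilon> + of_int b))) *
        (ee (of_real (c * (j + real M * of_int a)) * z2) * exp (- W) / \<zeta>)"
      unfolding arg ee_add Ints_imp_ee_mult_nat [OF \<epsilon>] by simp
    finally show ?thesis
      unfolding lat_term_def \<zeta>' cy W' \<zeta>_def [symmetric] W_def [symmetric] .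
  qed
  then have "P * (\<Sum>\<^sub>\<infinity>(a::int, b::int). ee (of_real (- (real l / real 1) * (0 + real 1 * of_int a) * (0 + of_int b))) *
        lat_term (real l / real 1) (of_nat M * \<tau>) Z1 Z2 (0 + real 1 * of_int a) (0 + of_int b)) =
      (\<Sum>\<^sub>\<infinity>(a::int, b::int). ee (of_real (- c * (k + real M * of_int a) * (\<epsilon> + of_int b))) *
        lat_term c \<tau> z1 z2 (j + real M * of_int a) (\<epsilon> + of_int b))"
    unfolding infsum_cmult_right' [symmetric] by (simp only: case_prod_unfold)
  then have "P * lat_sum l 1 0 0 0 (of_nat M * \<tau>) Z1 Z2 = lat_sum l M j k \<epsilon> \<tau> z1 z2"
    unfolding lat_sum_def c_def by (simp only: mult.left_commute [of P])
  then show ?thesis unfolding P_def Z1_def Z2_def .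
qed

text \<open>The prefactor of \<open>Psi_tilde\<close> is invariant under (j, k, z1, z2) -> (-k, -j,
  -z2, -z1). So the second lattice sum of \<open>Phi_tilde\<close> rescales like the first, with
  -\<epsilon> for \<epsilon>.\<close>

lemma Psi_tilde_eq_lat_sum:
  assumes M: "M > 0" and m: "m < 0" and y: "Im \<tau> > 0"
    and \<epsilon>: "2 * \<epsilon> \<in> \<int>" and j: "2 * j \<in> \<int>" and k: "2 * k \<in> \<int>"
    and reg: "regular_point \<tau> z1" "regular_point \<tau> z2"
  shows "Psi_tilde M m \<epsilon> j k \<tau> z1 z2 = lat_sum (nat (- m)) M j k \<epsilon> \<tau> z1 z2 -
    lat_sum (nat (- m)) M (- k) (- j) (- \<epsilon>) \<tau> (- z2) (- z1)"
proof -
  define l where "l = nat (- m)"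
  have l: "l > 0" "of_int m = (- of_nat l :: complex)" using m by (auto simp: l_def)
  have nz: "w + of_real i * \<tau> + of_real \<epsilon> + of_int a * (of_nat M * \<tau>) + of_int b \<noteq> 0"
    if "regular_point \<tau> w" "2 * i \<in> \<int>" for w i and a b :: int
  proof -
    have "2 * (i + real M * of_int a) \<in> \<int>" "2 * (\<epsilon> + of_int b) \<in> \<int>"
      using that \<epsilon> by (auto simp: distrib_left)
    from regular_point_nonzero [OF that(1) this] show ?thesis by (simp add: algebra_simps)
  qed
  have y': "Im (of_nat M * \<tau>) > 0" using y M by simp
  have a: "ee (- (of_int m / of_nat M) * of_real j * of_real k * \<tau>) = ee (of_real (real l / real M * j * k) * \<tau>)"
    "ee (- (of_int m / of_nat M) * (of_real k * z1 + of_real j * z2)) = ee (of_real (real l / real M) * (of_real k * z1 + of_real j * z2))"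
    by (simp_all add: l)
  have \<epsilon>': "2 * - \<epsilon> \<in> \<int>" using \<epsilon> by simp
  have 2: "ee (of_real (real l / real M * j * k) * \<tau>) * ee (of_real (real l / real M) * (of_real k * z1 + of_real j * z2)) *
     lat_sum l 1 0 0 0 (of_nat M * \<tau>) (- (z2 + of_real k * \<tau> + of_real \<epsilon>)) (- (z1 + of_real j * \<tau> + of_real \<epsilon>)) =
     lat_sum l M (- k) (- j) (- \<epsilon>) \<tau> (- z2) (- z1)"
    using lat_sum_rescale [OF M y \<epsilon>', of l "- k" "- j" "- z2" "- z1"]
    by (simp add: algebra_simps)
  show ?thesis
    unfolding Psi_tilde_def a l_def [symmetric]
      Phi_tilde_eq_lat_sum [OF l(1) y' nz [OF reg(1) j] nz [OF reg(2) k]] right_diff_distrib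
      2 lat_sum_rescale [OF M y \<epsilon>] ..
qed

text \<open>T acts on coordinates by (A, B) -> (A, A + B), which is undone by the relabelling b -> b
  + M a + n. The characters then differ by ee(c j k) and by the phase l a (j + k + M a), an integer
  because j + k is one.\<close>

lemma lat_sum_T:
  assumes "M > 0" and jk: "j + k \<in> \<int>" and n: "j + \<epsilon> = \<epsilon>'' + of_int n"
  shows "lat_sum l M j k \<epsilon> (\<tau> + 1) z1 z2 = ee (of_real (real l / real M * j * k)) * lat_sum l M j k \<epsilon>'' \<tau> z1 z2"
proof -
  define c where "c = real l / real M"
  have "(\<Sum>\<^sub>\<infinity>(a::int, b::int). ee (of_real (- c * (k + real M * of_int a) * (\<epsilon> + of_int b))) *
        lat_term c (\<tau> + 1) z1 z2 (j + real M * of_int a) (\<epsilon> + of_int b)) =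
     (\<Sum>\<^sub>\<infinity>(a::int, b::int). ee (of_real (c * j * k)) * (ee (of_real (- c * (k + real M * of_int a) * (\<epsilon>'' + of_int b))) *
        lat_term c \<tau> z1 z2 (j + real M * of_int a) (\<epsilon>'' + of_int b)))"
  proof (rule infsum_reindex_bij_witness [of _ "\<lambda>(a, b). (a, b - int M * a - n)" "\<lambda>(a, b). (a, b + int M * a + n)"], goal_cases)
    case (5 p)
    obtain a b where p: "p = (a, b)" by fastforce
    have B: "j + real M * of_int a + (\<epsilon> + of_int b) = \<epsilon>'' + of_int (b + int M * a + n)"
      using n by simp
    have cM: "c * real M = real l" using assms(1) by (simp add: c_def)
    have "c * j * k + - c * (k + real M * of_int a) * (\<epsilon>'' + of_int (b + int M * a + n)) =
      - c * (k + real M * of_int a) * (\<epsilon> + of_int b) - (c * real M) * of_int a * (j + k + real M * of_int a)"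
      unfolding B [symmetric] by (simp add: algebra_simps)
    also have "\<dots> = - c * (k + real M * of_int a) * (\<epsilon> + of_int b) + real l * of_int (- a) * (j + k + real M * of_int a)"
      unfolding cM by simp
    finally have e: "c * j * k + - c * (k + real M * of_int a) * (\<epsilon>'' + of_int (b + int M * a + n)) =
      - c * (k + real M * of_int a) * (\<epsilon> + of_int b) + real l * of_int (- a) * (j + k + real M * of_int a)" .
    have "ee (of_real (c * j * k)) * ee (of_real (- c * (k + real M * of_int a) * (\<epsilon>'' + of_int (b + int M * a + n)))) =
      ee (of_real (- c * (k + real M * of_int a) * (\<epsilon> + of_int b)) + of_nat l * of_int (- a) * of_real (j + k + real M * of_int a))"
      unfolding ee_add [symmetric] of_real_add [symmetric] e
      by (simp only: of_real_add of_real_mult of_real_of_nat_eq of_real_of_int_eq of_real_minus)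
    also have "\<dots> = ee (of_real (- c * (k + real M * of_int a) * (\<epsilon> + of_int b)))"
      unfolding ee_add by (subst Ints_imp_ee_mult_nat) (use jk in auto)
    finally show ?case
      unfolding p prod.case lat_term_T B mult.assoc [symmetric] by simp
  qed auto
  then have "(\<Sum>\<^sub>\<infinity>(a::int, b::int). ee (of_real (- c * (k + real M * of_int a) * (\<epsilon> + of_int b))) *
        lat_term c (\<tau> + 1) z1 z2 (j + real M * of_int a) (\<epsilon> + of_int b)) = ee (of_real (c * j * k)) *
     (\<Sum>\<^sub>\<infinity>(a::int, b::int). ee (of_real (- c * (k + real M * of_int a) * (\<epsilon>'' + of_int b)) ) *
        lat_term c \<tau> z1 z2 (j + real M * of_int a) (\<epsilon>'' + of_int b))"
    unfolding infsum_cmult_right' [symmetric] by (simp only: case_prod_unfold)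
  then show ?thesis unfolding lat_sum_def c_def by (simp only: mult.left_commute)
qed

text \<open>The shift of j is undone by a -> a + n, which affects only the character. Together with
  the opposite phase in \<open>lat_sum_shift_right\<close> this describes the dependence on j and k
  modulo M, and it is what makes a sum over coset representatives independent of their
  choice.\<close>

lemma lat_sum_shift_left:
  assumes "M > 0"
  shows "lat_sum l M (j + real M * of_int n) k \<epsilon> \<tau> z1 z2 = ee (of_real (real l * of_int n * \<epsilon>)) * lat_sum l M j k \<epsilon> \<tau> z1 z2"
proof -
  define c where "c = real l / real M"
  have "(\<Sum>\<^sub>\<infinity>(a::int, b::int). ee (of_real (- c * (k + real M * of_int a) * (\<epsilon> + of_int b))) *
        lat_term c \<tau> z1 z2 (j + real M * of_int n + real M * of_int a) (\<epsilon> + of_int b)) =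
     (\<Sum>\<^sub>\<infinity>(a::int, b::int). ee (of_real (real l * of_int n * \<epsilon>)) * (ee (of_real (- c * (k + real M * of_int a) * (\<epsilon> + of_int b))) *
        lat_term c \<tau> z1 z2 (j + real M * of_int a) (\<epsilon> + of_int b)))"
  proof (rule infsum_reindex_bij_witness [of _ "\<lambda>(a, b). (a - n, b)" "\<lambda>(a, b). (a + n, b)"], goal_cases)
    case (5 p)
    obtain a b where p: "p = (a, b)" by fastforce
    have cM: "c * real M = real l" using assms by (simp add: c_def)
    have "real l * of_int n * \<epsilon> + - c * (k + real M * of_int (a + n)) * (\<epsilon> + of_int b) =
      - c * (k + real M * of_int a) * (\<epsilon> + of_int b) + real l * of_int n * \<epsilon> - (c * real M) * of_int n * (\<epsilon> + of_int b)"
      by (simp add: algebra_simps)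
    also have "\<dots> = - c * (k + real M * of_int a) * (\<epsilon> + of_int b) + of_int (- (int l * n * b))"
      unfolding cM by (simp add: algebra_simps)
    finally have "ee (of_real (real l * of_int n * \<epsilon>)) * ee (of_real (- c * (k + real M * of_int (a + n)) * (\<epsilon> + of_int b))) =
       ee (of_real (- c * (k + real M * of_int a) * (\<epsilon> + of_int b)))"
      unfolding ee_add [symmetric] of_real_add [symmetric] by (simp only: of_real_add of_real_of_int_eq ee_add ee_of_int mult_1_right)
    then show ?case
      unfolding p prod.case mult.assoc [symmetric] by (simp add: algebra_simps)
  qed auto
  then have "(\<Sum>\<^sub>\<infinity>(a::int, b::int). ee (of_real (- c * (k + real M * of_int a) * (\<epsilon> + of_int b))) *
        lat_term c \<tau> z1 z2 (j + real M * of_int n + real M * of_int a) (\<epsilon> + of_int b)) = ee (of_real (real l * of_int n * \<epsilon>)) *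
     (\<Sum>\<^sub>\<infinity>(a::int, b::int). ee (of_real (- c * (k + real M * of_int a) * (\<epsilon> + of_int b))) *
        lat_term c \<tau> z1 z2 (j + real M * of_int a) (\<epsilon> + of_int b))"
    unfolding infsum_cmult_right' [symmetric] by (simp only: case_prod_unfold)
  then show ?thesis unfolding lat_sum_def c_def by (simp only: mult.left_commute)
qed

lemma lat_sum_shift_right:
  assumes "M > 0"
  shows "lat_sum l M j (k + real M * of_int n) \<epsilon> \<tau> z1 z2 = ee (of_real (- real l * of_int n * \<epsilon>)) * lat_sum l M j k \<epsilon> \<tau> z1 z2"
proof -
  define c where "c = real l / real M"
  have cM: "c * real M = real l" using assms by (simp add: c_def)
  have "ee (of_real (- c * (k + real M * of_int n + real M * of_int a) * (\<epsilon> + of_int b))) =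
      ee (of_real (- real l * of_int n * \<epsilon>)) * ee (of_real (- c * (k + real M * of_int a) * (\<epsilon> + of_int b)))" for a b :: int
  proof -
    have "- c * (k + real M * of_int n + real M * of_int a) * (\<epsilon> + of_int b) =
      - c * (k + real M * of_int a) * (\<epsilon> + of_int b) - (c * real M) * of_int n * (\<epsilon> + of_int b)"
      by (simp add: algebra_simps)
    also have "\<dots> = - real l * of_int n * \<epsilon> + - c * (k + real M * of_int a) * (\<epsilon> + of_int b) + of_int (- (int l * n * b))"
      unfolding cM by (simp add: algebra_simps)
    finally show ?thesis by (simp only: of_real_add of_real_of_int_eq ee_add ee_of_int mult_1_right)
  qed
  then have "(\<Sum>\<^sub>\<infinity>(a::int, b::int). ee (of_real (- c * (k + real M * of_int n + real M * of_int a) * (\<epsilon> + of_int b))) *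
        lat_term c \<tau> z1 z2 (j + real M * of_int a) (\<epsilon> + of_int b)) = ee (of_real (- real l * of_int n * \<epsilon>)) *
     (\<Sum>\<^sub>\<infinity>(a::int, b::int). ee (of_real (- c * (k + real M * of_int a) * (\<epsilon> + of_int b))) *
        lat_term c \<tau> z1 z2 (j + real M * of_int a) (\<epsilon> + of_int b))"
    unfolding infsum_cmult_right' [symmetric] by (simp only: case_prod_unfold mult.assoc)
  then show ?thesis unfolding lat_sum_def c_def by (simp only: mult.left_commute)
qed

section \<open>Finite sums over (Z/M)^2 and the behaviour under S\<close>

text \<open>Each element of S has exactly one partner in S', differing from it by multiples of M,
  and h does not see the difference. An arbitrary system of representatives may thus be replaced by
  the box.\<close>

lemma sum_coset_representatives_cong:
  fixes h :: "real \<times> real \<Rightarrow> 'a::comm_monoid_add"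
  assumes M: "M > 0" and S: "coset_representatives M \<epsilon> S" and S': "coset_representatives M \<epsilon> S'"
    and per: "\<And>a b m n. a \<in> int_shift \<epsilon> \<Longrightarrow> b \<in> int_shift \<epsilon> \<Longrightarrow> h (a + real M * of_int m, b + real M * of_int n) = h (a, b)"
  shows "sum h S = sum h S'"
proof -
  define R where "R = (\<lambda>p q :: real \<times> real. (fst p - fst q) / of_nat M \<in> \<int> \<and> (snd p - snd q) / of_nat M \<in> \<int>)"
  have R_sym: "R q p" if "R p q" for p q
    using that Ints_minus [of "(fst p - fst q) / of_nat M"] Ints_minus [of "(snd p - snd q) / of_nat M"]
    by (simp add: R_def minus_divide_left)
  have sub: "p \<in> int_shift \<epsilon> \<times> int_shift \<epsilon>" if "p \<in> S \<or> p \<in> S'" for p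
    using that S S' by (auto simp: coset_representatives_def)
  have ex: "\<exists>!q. q \<in> T \<and> R p q" if "p \<in> int_shift \<epsilon> \<times> int_shift \<epsilon>" "coset_representatives M \<epsilon> T" for p T
    using that unfolding coset_representatives_def R_def by (cases p) auto
  define f where "f = (\<lambda>T p. THE q. q \<in> T \<and> R p q)"
  have f: "f T p \<in> T \<and> R p (f T p)" if "p \<in> int_shift \<epsilon> \<times> int_shift \<epsilon>" "coset_representatives M \<epsilon> T" for p T
    unfolding f_def by (rule theI' [OF ex [OF that]])
  have f_eq: "f T p = q" if "p \<in> int_shift \<epsilon> \<times> int_shift \<epsilon>" "coset_representatives M \<epsilon> T" "q \<in> T" "R p q" for p q T
    unfolding f_def by (rule the1_equality [OF ex [OF that(1,2)]]) (use that in auto)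
  have h_eq: "h p = h q" if "R p q" "q \<in> int_shift \<epsilon> \<times> int_shift \<epsilon>" for p q
  proof -
    from that(1) have "(fst p - fst q) / real M \<in> \<int>" "(snd p - snd q) / real M \<in> \<int>"
      by (auto simp: R_def)
    then obtain m n where "(fst p - fst q) / real M = of_int m" "(snd p - snd q) / real M = of_int n"
      by (metis Ints_cases)
    then have "fst p = fst q + real M * of_int m" "snd p = snd q + real M * of_int n"
      using M by (auto simp: field_simps)
    then have "p = (fst q + real M * of_int m, snd q + real M * of_int n)" by (simp add: prod_eq_iff)
    then show ?thesis using per [of "fst q" "snd q" m n] that(2) by auto
  qed
  show ?thesis
  proof (rule sum.reindex_bij_witness [of _ "f S" "f S'"])
    show "f S (f S' p) = p" if "p \<in> S" for p
      using f [OF sub S', of p] that by (intro f_eq [OF sub S]) (auto intro: R_sym)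
    show "f S' (f S p) = p" if "p \<in> S'" for p
      using f [OF sub S, of p] that by (intro f_eq [OF sub S']) (auto intro: R_sym)
    show "f S' p \<in> S'" if "p \<in> S" for p using f [OF sub S', of p] that by simp
    show "f S p \<in> S" if "p \<in> S'" for p using f [OF sub S, of p] that by simp
    show "h (f S' p) = h p" if "p \<in> S" for p
      using f [OF sub S', of p] that by (intro h_eq) (auto intro: R_sym sub)
  qed
qed

lemma infsum_finite_sum:
  fixes f :: "'i \<Rightarrow> 'a \<Rightarrow> 'b::{comm_monoid_add, t2_space, topological_comm_monoid_add}"
  assumes "finite I" "\<And>i. i \<in> I \<Longrightarrow> f i summable_on A"
  shows "(\<Sum>\<^sub>\<infinity>x\<in>A. \<Sum>i\<in>I. f i x) = (\<Sum>i\<in>I. infsum (f i) A)"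
proof -
  have "((\<lambda>x. \<Sum>i\<in>I. f i x) has_sum (\<Sum>i\<in>I. infsum (f i) A)) A"
    using assms
  proof (induction I rule: finite_induct)
    case (insert i I)
    then have "((\<lambda>x. f i x + (\<Sum>i\<in>I. f i x)) has_sum (infsum (f i) A + (\<Sum>i\<in>I. infsum (f i) A))) A"
      by (intro has_sum_add has_sum_infsum) auto
    then show ?case using insert.hyps by simp
  qed simp
  then show ?thesis by (rule infsumI)
qed

text \<open>Read from left to right, M sums over sublattices of index M fuse into one sum over the
  whole lattice.\<close>

lemma infsum_residue_split:
  fixes Q :: "int \<times> int \<Rightarrow> complex"
  assumes M: "M > 0" and sm: "Q summable_on UNIV"
  shows "(\<Sum>x<M. \<Sum>\<^sub>\<infinity>(s, b). Q (int x + int M * s, b)) = infsum Q UNIV"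
proof -
  define A where "A = (\<lambda>x. {p :: int \<times> int. fst p mod int M = int x})"
  have A: "A x = range (\<lambda>(s, b). (int x + int M * s, b))" if "x < M" for x
  proof -
    have "p \<in> range (\<lambda>(s, b). (int x + int M * s, b))" if "fst p mod int M = int x" for p :: "int \<times> int"
    proof (rule image_eqI [where x = "(fst p div int M, snd p)"])
      show "p = (\<lambda>(s, b). (int x + int M * s, b)) (fst p div int M, snd p)"
        using that mult_div_mod_eq [of "int M" "fst p"] by (simp add: prod_eq_iff)
    qed simp
    then show ?thesis using that by (auto simp: A_def)
  qed
  have "infsum Q (A x) = (\<Sum>\<^sub>\<infinity>(s, b). Q (int x + int M * s, b))" if "x < M" for x
  proof -
    have "inj (\<lambda>(s, b). (int x + int M * s, b :: int))" using M by (auto simp: inj_on_def)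
    then show ?thesis unfolding A [OF that] by (simp add: infsum_reindex o_def case_prod_unfold)
  qed
  then have "(\<Sum>x<M. \<Sum>\<^sub>\<infinity>(s, b). Q (int x + int M * s, b)) = (\<Sum>x<M. infsum Q (A x))" by simp
  also have "\<dots> = infsum Q (\<Union>x<M. A x)"
    by (rule sum_infsum) (use summable_on_subset_banach [OF sm] in \<open>auto simp: A_def\<close>)
  also have "(\<Union>x<M. A x) = UNIV"
  proof -
    have "p \<in> (\<Union>x<M. A x)" for p
      using M by (intro UN_I [of "nat (fst p mod int M)"]) (auto simp: A_def nat_less_iff)
    then show ?thesis by blast
  qed
  finally show ?thesis .
qed

text \<open>Orthogonality of characters, with the offset \<epsilon> taken out of the geometric sum.
  Coprimality of l and M ensures that the ratio w is a nontrivial root of unity whenever M does not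
  divide N.\<close>

lemma sum_ee_roots_of_unity:
  assumes M: "M > 0" and co: "coprime l M"
  shows "(\<Sum>y<M. ee (of_real (- (real l / real M) * (\<epsilon> + real y) * of_int N))) =
    (if int M dvd N then of_nat M * ee (of_real (- (real l / real M) * \<epsilon> * of_int N)) else 0)"
proof -
  define w where "w = ee (of_real (- (real l / real M) * of_int N))"
  define K where "K = ee (of_real (- (real l / real M) * \<epsilon> * of_int N))"
  have summand: "ee (of_real (- (real l / real M) * (\<epsilon> + real y) * of_int N)) = K * w ^ y" for y
    unfolding w_def K_def ee_power ee_add [symmetric]
    by (rule arg_cong [where f = ee]) (simp add: algebra_simps add_divide_distrib)
  have wM: "w ^ M = 1"
  proof -
    have "of_nat M * of_real (- (real l / real M) * of_int N) = (of_int (- (int l * N)) :: complex)"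
      using M by simp
    then show ?thesis unfolding w_def ee_power by (simp only: ee_of_int)
  qed
  show ?thesis
  proof (cases "int M dvd N")
    case True
    then obtain i where "N = int M * i" by blast
    then have "of_real (- (real l / real M) * of_int N) = (of_int (- (int l * i)) :: complex)"
      using M by simp
    then have "w = 1" unfolding w_def by (simp only: ee_of_int)
    then show ?thesis using True unfolding summand by (simp add: K_def mult.commute)
  next
    case False
    have "w \<noteq> 1"
    proof
      assume "w = 1"
      then have "(of_real (- (real l / real M) * of_int N) :: complex) \<in> \<int>"
        unfolding w_def ee_eq_1_iff .
      then obtain i where "of_real (- (real l / real M) * of_int N) = (of_int i :: complex)"
        by (rule Ints_cases)
      then have "- (real l / real M) * of_int N = of_int i"
        by (metis of_real_eq_iff of_real_of_int_eq)
      then have "real_of_int (int l * N) = real_of_int (int M * - i)" using M by (simp add: field_simps)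
      then have "int l * N = int M * - i" by (simp only: of_int_eq_iff)
      then have "int M dvd int l * N" by simp
      moreover have "coprime (int M) (int l)" using co by (simp add: coprime_commute)
      ultimately show False using False by (simp add: coprime_dvd_mult_right_iff)
    qed
    then have "(\<Sum>y<M. w ^ y) = 0" using wM by (simp add: sum_gp_strict)
    then show ?thesis using False unfolding summand by (simp flip: sum_distrib_left)
  qed
qed

text \<open>The right side is simplified until it becomes the left. The representative of a and the
  row index M s add up to a free integer, so the sum over a unfolds the rows to all of \<epsilon> +
  Z. The sum over b is a character sum which retains one residue class of columns modulo M and
  contributes a factor M, offset by 1/M. The surviving lattice has its coarse direction along the
  columns, just as the lattice on the left has after inversion.\<close>

lemma lat_sum_S:
  assumes l: "l > 0" and M: "M > 0" and co: "coprime l M" and y: "Im \<tau> > 0"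
    and \<epsilon>: "2 * \<epsilon> \<in> \<int>" and \<epsilon>': "2 * \<epsilon>' \<in> \<int>" and j: "j - \<epsilon>' \<in> \<int>" and k: "k - \<epsilon>' \<in> \<int>"
    and reg: "regular_point \<tau> z1" and S: "coset_representatives M \<epsilon> S"
  shows "lat_sum l M j k \<epsilon> (- 1 / \<tau>) (z1 / \<tau>) (z2 / \<tau>) =
    \<tau> / of_nat M * ee (of_real (real l / real M) * z1 * z2 / \<tau>) *
    (\<Sum>(a, b)\<in>S. ee (of_real (- (real l / real M) * (a * k + b * j))) * lat_sum l M a b \<epsilon>' \<tau> z1 z2)"
proof -
  define c where "c = real l / real M"
  have cM: "c * real M = real l" using M by (simp add: c_def)
  have c0: "c > 0" using l M by (simp add: c_def)
  have int_eq: "x + \<epsilon>' \<in> \<int>" if "x - \<epsilon>' \<in> \<int>" for x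
    using Ints_add [OF that \<epsilon>'] by (simp add: algebra_simps)
  obtain d where d: "d > 0"
    "\<And>A B :: real. 2 * A \<in> \<int> \<Longrightarrow> 2 * B \<in> \<int> \<Longrightarrow> d \<le> norm (z1 + of_real A * \<tau> + of_real B)"
    using regular_point_bounded_below [OF y reg] by blast
  define L where "L = (\<lambda>n b :: int. lat_term c \<tau> z1 z2 (\<epsilon> + of_int n) (\<epsilon>' + of_int b))"
  define h where "h = (\<lambda>(a, b). ee (of_real (- c * (a * k + b * j))) * lat_sum l M a b \<epsilon>' \<tau> z1 z2)"
  define box where "box = (\<lambda>(a, b). (\<epsilon> + real a, \<epsilon> + real b)) ` ({..<M} \<times> {..<M})"
  \<comment> \<open>The summand after unfolding: \<epsilon> + \<open>fst p\<close> is the free row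
    coordinate, \<open>snd p\<close> the column, and the representative y is left only in a
    character of J + \<open>snd p\<close>.\<close>
  define Q where "Q = (\<lambda>(y::nat) (p::int \<times> int). ee (of_real (- c * (\<epsilon> + real y) * (j + \<epsilon>' + of_int (snd p)))) *
      (ee (of_real (- c * (\<epsilon> + of_int (fst p)) * k)) * L (fst p) (snd p)))"
  obtain J where J: "j + \<epsilon>' = of_int J" using int_eq [OF j] by (auto elim: Ints_cases)
  have sm: "(\<lambda>p. u p * L (fst p) (snd p)) summable_on UNIV" if u: "\<And>p. norm (u p) = 1" for u
  proof -
    have "(\<lambda>(a::int, b::int). norm (u (a, b) * lat_term c \<tau> z1 z2 (\<epsilon> + real 1 * of_int a) (\<epsilon>' + of_int b))) summable_on UNIV"
    proof (rule summable_lat_sum [OF c0 y _ d(1) _ u])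
      show "d \<le> norm (z1 + of_real (\<epsilon> + real 1 * of_int a) * \<tau> + of_real (\<epsilon>' + of_int b))" for a b :: int
        by (rule d(2)) (use \<epsilon> \<epsilon>' in \<open>auto simp: distrib_left\<close>)
    qed simp
    then have "(\<lambda>p. norm (u p * L (fst p) (snd p))) summable_on UNIV"
      by (simp add: L_def case_prod_unfold)
    then show ?thesis by (rule abs_summable_summable)
  qed
  have sm_Q: "Q y summable_on UNIV" for y
    unfolding Q_def mult.assoc [symmetric] by (rule sm) (simp only: norm_mult norm_ee_of_real mult_1_left)
  have "sum h S = sum h box"
  proof (rule sum_coset_representatives_cong [OF M S])
    show "coset_representatives M \<epsilon> box" unfolding box_def by (rule coset_representatives_box [OF M])
    fix a b :: real and m n :: int
    have "ee (of_real (- c * ((a + real M * of_int m) * k + (b + real M * of_int n) * j))) *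
        lat_sum l M (a + real M * of_int m) (b + real M * of_int n) \<epsilon>' \<tau> z1 z2 =
        ee (of_real (- c * (a * k + b * j)) + of_nat l * of_int (- m) * of_real (k - \<epsilon>') + of_nat l * of_int (- n) * of_real (j + \<epsilon>')) *
        lat_sum l M a b \<epsilon>' \<tau> z1 z2"
    proof -
      have "- c * ((a + real M * of_int m) * k + (b + real M * of_int n) * j) + (- real l * of_int n * \<epsilon>' + real l * of_int m * \<epsilon>') =
         - c * (a * k + b * j) + real l * of_int (- m) * (k - \<epsilon>') + real l * of_int (- n) * (j + \<epsilon>')"
        unfolding cM [symmetric] by (simp add: algebra_simps)
      then have "ee (of_real (- c * ((a + real M * of_int m) * k + (b + real M * of_int n) * j))) *
         (ee (of_real (- real l * of_int n * \<epsilon>')) * ee (of_real (real l * of_int m * \<epsilon>'))) =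
         ee (of_real (- c * (a * k + b * j)) + of_nat l * of_int (- m) * of_real (k - \<epsilon>') + of_nat l * of_int (- n) * of_real (j + \<epsilon>'))"
        unfolding ee_add [symmetric] of_real_add [symmetric] by (simp only: of_real_add of_real_mult of_real_of_nat_eq of_real_of_int_eq)
      then show ?thesis
        unfolding lat_sum_shift_left [OF M] lat_sum_shift_right [OF M] by (simp only: mult.assoc [symmetric])
    qed
    also have "\<dots> = ee (of_real (- c * (a * k + b * j))) * lat_sum l M a b \<epsilon>' \<tau> z1 z2"
      unfolding ee_add Ints_imp_ee_mult_nat [OF k] Ints_imp_ee_mult_nat [OF int_eq [OF j]] by simp
    finally show "h (a + real M * of_int m, b + real M * of_int n) = h (a, b)" by (simp add: h_def)
  qed
  also have "sum h box = (\<Sum>x<M. \<Sum>y<M. h (\<epsilon> + real x, \<epsilon> + real y))"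
  proof -
    have "inj_on (\<lambda>(a, b). (\<epsilon> + real a, \<epsilon> + real b)) ({..<M} \<times> {..<M})" by (auto simp: inj_on_def)
    then show ?thesis unfolding box_def by (simp add: sum.reindex o_def case_prod_unfold sum.cartesian_product)
  qed
  also have "\<dots> = (\<Sum>y<M. \<Sum>x<M. h (\<epsilon> + real x, \<epsilon> + real y))" by (rule sum.swap)
  also have "\<dots> = (\<Sum>y<M. \<i> / (2 * of_real pi) * (\<Sum>x<M. \<Sum>\<^sub>\<infinity>(s, b). Q y (int x + int M * s, b)))"
    unfolding sum_distrib_left
  proof (intro sum.cong refl)
    fix x y
    have "ee (of_real (- c * ((\<epsilon> + real x) * k + (\<epsilon> + real y) * j))) *
        (ee (of_real (- (real l / real M) * (\<epsilon> + real y + real M * of_int s) * (\<epsilon>' + of_int b))) *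
        lat_term (real l / real M) \<tau> z1 z2 (\<epsilon> + real x + real M * of_int s) (\<epsilon>' + of_int b)) =
        Q y (int x + int M * s, b)" for s b
    proof -
      have "- c * ((\<epsilon> + real x) * k + (\<epsilon> + real y) * j) + - c * (\<epsilon> + real y + real M * of_int s) * (\<epsilon>' + of_int b) =
        (- c * (\<epsilon> + real y) * (j + \<epsilon>' + of_int b) + - c * (\<epsilon> + of_int (int x + int M * s)) * k) + (c * real M) * of_int s * (k - \<epsilon>' - of_int b)"
        by (simp add: algebra_simps)
      then have "ee (of_real (- c * ((\<epsilon> + real x) * k + (\<epsilon> + real y) * j))) * ee (of_real (- c * (\<epsilon> + real y + real M * of_int s) * (\<epsilon>' + of_int b))) =
        ee (of_real (- c * (\<epsilon> + real y) * (j + \<epsilon>' + of_int b))) * ee (of_real (- c * (\<epsilon> + of_int (int x + int M * s)) * k)) *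
        ee (of_nat l * of_int s * of_real (k - \<epsilon>' - of_int b))"
        unfolding cM ee_add [symmetric] of_real_add [symmetric] by (simp only: of_real_add of_real_mult of_real_of_nat_eq of_real_of_int_eq)
      also have "ee (of_nat l * of_int s * of_real (k - \<epsilon>' - of_int b)) = 1"
        by (rule Ints_imp_ee_mult_nat) (use k in auto)
      finally show ?thesis
        unfolding Q_def L_def c_def [symmetric] mult.assoc [symmetric] fst_conv snd_conv by (simp add: add.assoc)
    qed
    then have "ee (of_real (- c * ((\<epsilon> + real x) * k + (\<epsilon> + real y) * j))) *
        (\<Sum>\<^sub>\<infinity>(s, b). ee (of_real (- (real l / real M) * (\<epsilon> + real y + real M * of_int s) * (\<epsilon>' + of_int b))) *
        lat_term (real l / real M) \<tau> z1 z2 (\<epsilon> + real x + real M * of_int s) (\<epsilon>' + of_int b)) =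
        (\<Sum>\<^sub>\<infinity>(s, b). Q y (int x + int M * s, b))"
      unfolding infsum_cmult_right' [symmetric] by (simp only: case_prod_unfold)
    then show "h (\<epsilon> + real x, \<epsilon> + real y) = \<i> / (2 * of_real pi) * (\<Sum>\<^sub>\<infinity>(s, b). Q y (int x + int M * s, b))"
      unfolding h_def lat_sum_def prod.case by (simp only: mult.left_commute)
  qed
  also have "\<dots> = \<i> / (2 * of_real pi) * (\<Sum>y<M. infsum (Q y) UNIV)"
    unfolding infsum_residue_split [OF M sm_Q] sum_distrib_left ..
  also have "(\<Sum>y<M. infsum (Q y) UNIV) = (\<Sum>\<^sub>\<infinity>p. \<Sum>y<M. Q y p)"
    by (rule infsum_finite_sum [symmetric]) (use sm_Q in auto)
  also have "\<dots> = (\<Sum>\<^sub>\<infinity>p. (if int M dvd J + snd p then of_nat M * ee (of_real (- c * \<epsilon> * of_int (J + snd p))) else 0) *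
      (ee (of_real (- c * (\<epsilon> + of_int (fst p)) * k)) * L (fst p) (snd p)))"
    unfolding Q_def sum_distrib_right [symmetric] J of_int_add [symmetric] c_def
    by (subst sum_ee_roots_of_unity [OF M co]) (rule refl)
  also have "\<dots> = (\<Sum>\<^sub>\<infinity>(a, b). of_nat M * (ee (of_real (- c * (k + real M * of_int a) * (\<epsilon> + of_int b))) *
        lat_term c \<tau> z1 z2 (\<epsilon> + of_int b) (- (j + real M * of_int a))))" (is "infsum ?G UNIV = infsum ?H UNIV")
  proof -
    \<comment> \<open>The points that survive the character sum, labelled as on the left side: S
      sends (j + M a, \<epsilon> + b) to (\<epsilon> + b, -(j + M a)), and the second entry is
      \<epsilon>' + (- J - M a).\<close>
    define f where "f = (\<lambda>(a, b). (b :: int, - J - int M * a))"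
    have f: "inj f" using M by (auto simp: f_def inj_on_def)
    have "infsum ?G UNIV = infsum ?G (range f)"
    proof (rule infsum_cong_neutral)
      fix p :: "int \<times> int" assume p: "p \<in> UNIV - range f"
      have "\<not> int M dvd J + snd p"
      proof
        assume "int M dvd J + snd p"
        then obtain i where "J + snd p = int M * i" by blast
        then have "p = f (- i, fst p)" by (simp add: f_def prod_eq_iff)
        then show False using p by blast
      qed
      then show "?G p = 0" by simp
    qed auto
    also have "\<dots> = infsum (?G \<circ> f) UNIV" by (rule infsum_reindex [OF f])
    also have "\<dots> = infsum ?H UNIV"
    proof (rule infsum_cong)
      fix p :: "int \<times> int"
      obtain a b where p: "p = (a, b)" by fastforce
      have dv: "int M dvd J + (- J - int M * a)" by simp
      have B: "\<epsilon>' + of_int (- J - int M * a) = - (j + real M * of_int a)" using J by simp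
      have "- c * \<epsilon> * of_int (J + (- J - int M * a)) + - c * (\<epsilon> + of_int b) * k =
         - c * (k + real M * of_int a) * (\<epsilon> + of_int b) + (c * real M) * of_int a * (2 * \<epsilon> + of_int b)"
        by (simp add: algebra_simps)
      then have "ee (of_real (- c * \<epsilon> * of_int (J + (- J - int M * a)))) * ee (of_real (- c * (\<epsilon> + of_int b) * k)) =
         ee (of_real (- c * (k + real M * of_int a) * (\<epsilon> + of_int b))) * ee (of_nat l * of_int a * of_real (2 * \<epsilon> + of_int b))"
        unfolding cM ee_add [symmetric] of_real_add [symmetric] by (simp only: of_real_add of_real_mult of_real_of_nat_eq of_real_of_int_eq)
      also have "ee (of_nat l * of_int a * of_real (2 * \<epsilon> + of_int b)) = 1"
        by (rule Ints_imp_ee_mult_nat) (use \<epsilon> in auto)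
      finally show "(?G \<circ> f) p = ?H p"
        unfolding p o_def f_def prod.case fst_conv snd_conv if_P [OF dv] L_def B by (simp add: mult.assoc [symmetric])
    qed
    finally show ?thesis .
  qed
  finally have hS: "sum h S = \<i> / (2 * of_real pi) * (\<Sum>\<^sub>\<infinity>(a, b). of_nat M * (ee (of_real (- c * (k + real M * of_int a) * (\<epsilon> + of_int b))) *
        lat_term c \<tau> z1 z2 (\<epsilon> + of_int b) (- (j + real M * of_int a))))" .
  define X where "X = (\<Sum>\<^sub>\<infinity>(a, b). ee (of_real (- c * (k + real M * of_int a) * (\<epsilon> + of_int b))) *
        lat_term c \<tau> z1 z2 (\<epsilon> + of_int b) (- (j + real M * of_int a)))"
  define K where "K = \<tau> * ee (of_real c * z1 * z2 / \<tau>)"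
  have hS': "sum h S = \<i> / (2 * of_real pi) * (of_nat M * X)"
    unfolding hS X_def infsum_cmult_right' [symmetric] by (simp only: case_prod_unfold)
  have "lat_sum l M j k \<epsilon> (- 1 / \<tau>) (z1 / \<tau>) (z2 / \<tau>) = \<i> / (2 * of_real pi) * (K * X)"
  proof -
    have "(\<Sum>\<^sub>\<infinity>(a, b). ee (of_real (- c * (k + real M * of_int a) * (\<epsilon> + of_int b))) *
        (K * lat_term c \<tau> z1 z2 (\<epsilon> + of_int b) (- (j + real M * of_int a)))) = K * X"
      unfolding X_def infsum_cmult_right' [symmetric]
      by (rule infsum_cong) (auto simp: mult.left_commute)
    then show ?thesis unfolding lat_sum_def lat_term_S [OF y] c_def [symmetric] K_def [symmetric] by simp
  qed
  moreover have "(\<Sum>(a, b)\<in>S. ee (of_real (- (real l / real M) * (a * k + b * j))) * lat_sum l M a b \<epsilon>' \<tau> z1 z2) = sum h S"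
    unfolding h_def c_def ..
  ultimately show ?thesis
    unfolding hS' c_def [symmetric] using M by (simp add: K_def)
qed

section \<open>Wirtinger derivatives of the lattice sum\<close>

lemma open_regular_points:
  assumes "Im \<tau> > 0"
  shows "open {z. regular_point \<tau> z}"
  unfolding open_contains_ball
proof (intro ballI)
  fix z assume "z \<in> {z. regular_point \<tau> z}"
  then obtain d where d: "d > 0" "\<And>A B :: real. 2 * A \<in> \<int> \<Longrightarrow> 2 * B \<in> \<int> \<Longrightarrow> d \<le> norm (z + of_real A * \<tau> + of_real B)"
    using regular_point_bounded_below [OF assms] by blast
  have "regular_point \<tau> u" if "u \<in> ball z d" for u
    unfolding regular_point_def
  proof (intro allI notI)
    fix a b :: int
    assume *: "2 * u = of_int a + of_int b * \<tau>"
    have "d \<le> norm (z + of_real (- of_int b / 2) * \<tau> + of_real (- of_int a / 2))"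
      by (rule d(2)) auto
    also have "z + of_real (- of_int b / 2) * \<tau> + of_real (- of_int a / 2) = z - (2 * u) / 2"
      unfolding * by (simp add: field_simps)
    finally show False using that by (simp add: dist_norm)
  qed
  with d(1) show "\<exists>e>0. ball z e \<subseteq> {z. regular_point \<tau> z}" by auto
qed

text \<open>Termwise differentiation on a ball of radius d/2, where all poles stay at distance at
  least d/2. Differentiability is real and joint in the pair because the variable is later inserted
  as (w, z2), (z1, w), (-z2, -w) or (-w, -z1).\<close>

lemma lat_sum_differentiable:
  assumes l: "l > 0" and M: "M > 0" and y: "Im \<tau> > 0" and j: "2 * j \<in> \<int>" and \<epsilon>: "2 * \<epsilon> \<in> \<int>"
    and reg: "regular_point \<tau> z1"
  shows "(\<lambda>p. lat_sum l M j k \<epsilon> \<tau> (fst p) (snd p)) differentiable at (z1, z2)"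
proof -
  define c where "c = real l / real M"
  define q where "q = pi * c / Im \<tau>"
  have c0: "c > 0" using l M by (simp add: c_def)
  have q0: "q > 0" using c0 y by (simp add: q_def)
  obtain d where d: "d > 0" "\<And>A B :: real. 2 * A \<in> \<int> \<Longrightarrow> 2 * B \<in> \<int> \<Longrightarrow> d \<le> norm (z1 + of_real A * \<tau> + of_real B)"
    using regular_point_bounded_below [OF y reg] by blast
  define R where "R = norm z1 + norm z2 + d"
  obtain C \<kappa> where \<kappa>: "\<kappa> > 0" "C \<ge> 0" and bd: "\<And>z1 z2 A B. norm z1 \<le> R \<Longrightarrow> norm z2 \<le> R \<Longrightarrow>
       d / 2 \<le> norm (z1 + of_real A * \<tau> + of_real B) \<Longrightarrow>
       (1 + \<bar>A\<bar> + norm (z1 + of_real A * \<tau> + of_real B)) * norm (lat_term c \<tau> z1 z2 A B) \<le>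
       C * exp (- \<kappa> * (\<bar>A\<bar> + \<bar>B\<bar>))"
  proof -
    have R0: "R \<ge> 0" and d0: "d / 2 > 0" using d(1) by (simp_all add: R_def)
    show thesis by (rule lat_term_bound [OF c0 y d0 R0]) (erule (1) that, blast)
  qed
  define A B where "A = (\<lambda>i :: int \<times> int. j + real M * of_int (fst i))" and "B = (\<lambda>i :: int \<times> int. \<epsilon> + of_int (snd i))"
  define \<zeta> where "\<zeta> = (\<lambda>i (p :: complex \<times> complex). fst p + of_real (A i) * \<tau> + of_real (B i) :: complex)"
  define u where "u = (\<lambda>i :: int \<times> int. ee (of_real (- c * (k + real M * of_int (fst i)) * (\<epsilon> + of_int (snd i)))))"
  define f where "f = (\<lambda>i p. u i * lat_term c \<tau> (fst p) (snd p) (A i) (B i))"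
  \<comment> \<open>Written as the term times its logarithmic derivative. The latter is linear in
    |A| and |\<zeta>| apart from the part with 1/\<zeta>, which is at most 2/d; this explains the
    weight in \<open>lat_term_bound\<close>, and \<open>K\<close> collects the constants.\<close>
  define f' where "f' = (\<lambda>i p h. f i p * (2 * of_real pi * \<i> * of_real (c * A i) * snd h -
      of_real q * (fst h * (cnj (\<zeta> i p) + 2 * \<i> * of_real (Im (snd p))) + \<zeta> i p * (cnj (fst h) + 2 * \<i> * of_real (Im (snd h)))) -
      fst h / \<zeta> i p))"
  define K where "K = 2 * pi * c + q * (4 + 2 * R) + 2 / d"
  define S where "S = ball (z1, z2) (d / 2)"
  have u1: "norm (u i) = 1" for i by (simp only: u_def norm_ee_of_real)
  have S1: "norm (fst p) \<le> R" "norm (snd p) \<le> R" "d / 2 \<le> norm (\<zeta> i p)" if "p \<in> S" for p i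
  proof -
    have 1: "norm (fst p - z1) < d / 2" "norm (snd p - z2) < d / 2"
    proof -
      have "(z1, z2) - p = - (fst p - z1, snd p - z2)" by (simp add: prod_eq_iff)
      then have "norm (fst p - z1, snd p - z2) < d / 2"
        using that unfolding S_def mem_ball dist_norm by (simp only: norm_minus_cancel)
      then show "norm (fst p - z1) < d / 2" "norm (snd p - z2) < d / 2"
        using norm_fst_le [of "fst p - z1" "snd p - z2"] norm_snd_le [of "snd p - z2" "fst p - z1"] by linarith+
    qed
    show "norm (fst p) \<le> R" using 1(1) norm_triangle_sub [of "fst p" z1] norm_ge_zero [of z2] d(1) unfolding R_def by linarith
    show "norm (snd p) \<le> R" using 1(2) norm_triangle_sub [of "snd p" z2] norm_ge_zero [of z1] d(1) unfolding R_def by linarith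
    have "d \<le> norm (z1 + of_real (A i) * \<tau> + of_real (B i))"
      by (rule d(2)) (use j \<epsilon> in \<open>auto simp: A_def B_def distrib_left\<close>)
    also have "z1 + of_real (A i) * \<tau> + of_real (B i) = \<zeta> i p - (fst p - z1)" by (simp add: \<zeta>_def)
    also have "norm \<dots> \<le> norm (\<zeta> i p) + norm (fst p - z1)" by (rule norm_triangle_ineq4)
    finally show "d / 2 \<le> norm (\<zeta> i p)" using 1(1) by linarith
  qed
  have nz: "\<zeta> i p \<noteq> 0" if "p \<in> S" for i p using S1(3) [OF that, of i] d(1) by auto
  have bd': "(1 + \<bar>A i\<bar> + norm (\<zeta> i p)) * norm (f i p) \<le>
      (C * exp (\<kappa> * (\<bar>j\<bar> + \<bar>\<epsilon>\<bar>))) * (case i of (a, b) \<Rightarrow> exp (- \<kappa> * (\<bar>of_int a\<bar> + \<bar>of_int b\<bar>)))" if "p \<in> S" for i p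
  proof -
    have "(1 + \<bar>A i\<bar> + norm (\<zeta> i p)) * norm (f i p) \<le> C * exp (- \<kappa> * (\<bar>A i\<bar> + \<bar>B i\<bar>))"
      using bd [OF S1(1,2) [OF that] S1(3) [OF that, of i, unfolded \<zeta>_def]] by (simp add: f_def norm_mult u1 \<zeta>_def)
    also have "\<dots> \<le> C * (exp (\<kappa> * (\<bar>j\<bar> + \<bar>\<epsilon>\<bar>)) * exp (- \<kappa> * (\<bar>of_int (fst i)\<bar> + \<bar>of_int (snd i)\<bar>)))"
      unfolding A_def B_def by (intro mult_left_mono exp_neg_lattice_index_le \<kappa> M)
    finally show ?thesis by (simp add: case_prod_unfold mult.assoc)
  qed
  have sm: "(\<lambda>i. D * (case i of (a::int, b::int) \<Rightarrow> exp (- \<kappa> * (\<bar>of_int a\<bar> + \<bar>of_int b\<bar>)))) summable_on UNIV" for D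
    by (intro summable_on_cmult_right summable_on_exp_neg_abs_int2 \<kappa>)
  have "((\<lambda>p. \<Sum>\<^sub>\<infinity>i. f i p) has_derivative (\<lambda>h. \<Sum>\<^sub>\<infinity>i. f' i (z1, z2) h)) (at (z1, z2))"
  proof (rule has_derivative_infsum [where S = S and
        B = "\<lambda>i. (K * (C * exp (\<kappa> * (\<bar>j\<bar> + \<bar>\<epsilon>\<bar>)))) * (case i of (a, b) \<Rightarrow> exp (- \<kappa> * (\<bar>of_int a\<bar> + \<bar>of_int b\<bar>)))"])
    show "infinite (UNIV :: (int \<times> int) set)" by (simp add: finite_prod infinite_UNIV_int)
    show "convex S" "open S" "(z1, z2) \<in> S" using d(1) by (auto simp: S_def)
    show "(f i has_derivative f' i p) (at p)" if p: "p \<in> S" for i p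
    proof -
      define W L where "W = (\<lambda>p. 2 * of_real pi * \<i> * of_real (c * A i) * snd p -
          of_real q * (\<zeta> i p * (cnj (\<zeta> i p) + 2 * \<i> * of_real (Im (snd p)))))"
        and "L = (\<lambda>h. 2 * of_real pi * \<i> * of_real (c * A i) * snd h -
          of_real q * (fst h * (cnj (\<zeta> i p) + 2 * \<i> * of_real (Im (snd p))) + \<zeta> i p * (cnj (fst h) + 2 * \<i> * of_real (Im (snd h)))))"
      have d\<zeta>: "(\<zeta> i has_derivative fst) (at p)"
        unfolding \<zeta>_def by (auto intro!: derivative_eq_intros)
      note dcnj = bounded_linear.has_derivative [OF bounded_linear_cnj d\<zeta>]
      have dsnd: "((\<lambda>p :: complex \<times> complex. snd p) has_derivative snd) (at p)"
        by (auto intro!: derivative_eq_intros)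
      note dIm = bounded_linear.has_derivative [OF bounded_linear_of_real
          bounded_linear.has_derivative [OF bounded_linear_Im dsnd]]
      have "(W has_derivative L) (at p)"
        unfolding W_def L_def
        using has_derivative_diff [OF has_derivative_mult_right [OF dsnd, of "2 * of_real pi * \<i> * of_real (c * A i)"]
            has_derivative_mult_right [OF has_derivative_mult [OF d\<zeta>
            has_derivative_add [OF dcnj has_derivative_mult_right [OF dIm, of "2 * \<i>"]]], of "of_real q"]]
        by (simp add: add.commute)
      from has_derivative_compose [OF this DERIV_exp [unfolded has_field_derivative_def]]
      have "((\<lambda>p. exp (W p)) has_derivative (\<lambda>h. exp (W p) * L h)) (at p)" .
      from has_derivative_mult_right [OF has_derivative_divide [OF this d\<zeta> nz [OF p]], of "u i"]
      have "((\<lambda>p. u i * (exp (W p) / \<zeta> i p)) has_derivative (\<lambda>h. u i * (- exp (W p) * (inverse (\<zeta> i p) * fst h * inverse (\<zeta> i p)) +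
          exp (W p) * L h / \<zeta> i p))) (at p)" .
      moreover have fW: "f i = (\<lambda>p. u i * (exp (W p) / \<zeta> i p))"
        unfolding f_def lat_term_def ee_def W_def \<zeta>_def q_def mult_exp_exp
        by (intro ext arg_cong [where f = "(*) (u i)"] arg_cong2 [where f = "(/)"] arg_cong [where f = exp] refl) simp
      moreover have "u i * (- exp (W p) * (inverse (\<zeta> i p) * fst h * inverse (\<zeta> i p)) + exp (W p) * L h / \<zeta> i p) = f' i p h" for h
      proof -
        have "f' i p h = u i * (exp (W p) / \<zeta> i p) * (L h - fst h / \<zeta> i p)"
          unfolding f'_def L_def fW ..
        then show ?thesis using nz [OF p, of i] by (simp add: field_simps)
      qed
      ultimately show ?thesis by simp
    qed
    show "norm (f' i p h) \<le> K * (C * exp (\<kappa> * (\<bar>j\<bar> + \<bar>\<epsilon>\<bar>))) * (case i of (a, b) \<Rightarrow> exp (- \<kappa> * (\<bar>of_int a\<bar> + \<bar>of_int b\<bar>))) * norm h"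
      if p: "p \<in> S" for i p h
    proof -
      define H r where "H = norm h" and "r = norm (\<zeta> i p)"
      have h: "norm (fst h) \<le> H" "norm (snd h) \<le> H" unfolding H_def
        using norm_fst_le [of "fst h" "snd h"] norm_snd_le [of "snd h" "fst h"] by simp_all
      have H0: "H \<ge> 0" by (simp add: H_def)
      have r: "d / 2 \<le> r" "r > 0" using S1(3) [OF p, of i] d(1) by (auto simp: r_def)
      have t1: "norm (2 * of_real pi * \<i> * of_real (c * A i) * snd h) \<le> 2 * pi * c * \<bar>A i\<bar> * H"
        using h(2) c0 by (simp add: norm_mult abs_mult mult_left_mono)
      have im: "norm (2 * \<i> * of_real (Im w)) \<le> 2 * norm w" for w :: complex
        using abs_Im_le_cmod [of w] by (simp add: norm_mult)
      have "norm (fst h * (cnj (\<zeta> i p) + 2 * \<i> * of_real (Im (snd p)))) \<le> H * (r + 2 * R)"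
        unfolding norm_mult using h(1) H0 r(2)
          norm_triangle_ineq [of "cnj (\<zeta> i p)" "2 * \<i> * of_real (Im (snd p))"] im [of "snd p"] S1(2) [OF p]
        by (intro mult_mono) (auto simp: r_def)
      moreover have "norm (\<zeta> i p * (cnj (fst h) + 2 * \<i> * of_real (Im (snd h)))) \<le> r * (3 * H)"
        unfolding norm_mult using h r(2) H0
          norm_triangle_ineq [of "cnj (fst h)" "2 * \<i> * of_real (Im (snd h))"] im [of "snd h"]
        by (intro mult_mono) (auto simp: r_def)
      ultimately have "norm (fst h * (cnj (\<zeta> i p) + 2 * \<i> * of_real (Im (snd p))) + \<zeta> i p * (cnj (fst h) + 2 * \<i> * of_real (Im (snd h))))
          \<le> H * (r + 2 * R) + r * (3 * H)"
        by (intro norm_triangle_le) linarith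
      then have "q * norm (fst h * (cnj (\<zeta> i p) + 2 * \<i> * of_real (Im (snd p))) + \<zeta> i p * (cnj (fst h) + 2 * \<i> * of_real (Im (snd h))))
          \<le> q * (H * (r + 2 * R) + r * (3 * H))"
        using q0 by (intro mult_left_mono) auto
      then have t2: "norm (of_real q * (fst h * (cnj (\<zeta> i p) + 2 * \<i> * of_real (Im (snd p))) + \<zeta> i p * (cnj (fst h) + 2 * \<i> * of_real (Im (snd h)))))
          \<le> q * (H * (r + 2 * R) + r * (3 * H))"
        unfolding norm_mult [of "of_real q"] using q0 by simp
      have t3: "norm (fst h / \<zeta> i p) \<le> H / (d / 2)"
        unfolding norm_divide r_def [symmetric] using h(1) r d(1) H0 by (intro frac_le) auto
      have "norm (2 * of_real pi * \<i> * of_real (c * A i) * snd h -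
        of_real q * (fst h * (cnj (\<zeta> i p) + 2 * \<i> * of_real (Im (snd p))) + \<zeta> i p * (cnj (fst h) + 2 * \<i> * of_real (Im (snd h)))) -
        fst h / \<zeta> i p) \<le> 2 * pi * c * \<bar>A i\<bar> * H + q * (H * (r + 2 * R) + r * (3 * H)) + H / (d / 2)"
        by (intro order_trans [OF norm_triangle_ineq4] add_mono t1 t2 t3)
      also have "\<dots> \<le> K * (1 + \<bar>A i\<bar> + r) * H"
      proof -
        have R0: "R \<ge> 0" using d(1) by (simp add: R_def)
        have "K * (1 + \<bar>A i\<bar> + r) * H - (2 * pi * c * \<bar>A i\<bar> * H + q * (H * (r + 2 * R) + r * (3 * H)) + H / (d / 2)) =
          (2 * pi * c * (1 + r) + q * (4 + (4 + 2 * R) * \<bar>A i\<bar> + 2 * R * r) + 2 / d * (\<bar>A i\<bar> + r)) * H"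
          by (simp add: K_def algebra_simps)
        also have "\<dots> \<ge> 0"
          using c0 q0 R0 r(2) d(1) H0 by (intro mult_nonneg_nonneg add_nonneg_nonneg) auto
        finally show ?thesis by simp
      qed
      finally have "norm (f' i p h) \<le> norm (f i p) * (K * (1 + \<bar>A i\<bar> + r) * H)"
        unfolding f'_def norm_mult by (rule mult_left_mono) simp
      also have "\<dots> = K * ((1 + \<bar>A i\<bar> + norm (\<zeta> i p)) * norm (f i p)) * H" by (simp add: r_def)
      also have "\<dots> \<le> K * ((C * exp (\<kappa> * (\<bar>j\<bar> + \<bar>\<epsilon>\<bar>))) * (case i of (a, b) \<Rightarrow> exp (- \<kappa> * (\<bar>of_int a\<bar> + \<bar>of_int b\<bar>)))) * H"
      proof (intro mult_right_mono mult_left_mono bd' [OF p] H0)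
        show "K \<ge> 0" using c0 q0 d(1) by (simp add: K_def R_def)
      qed
      finally show ?thesis by (simp add: H_def mult.assoc)
    qed
    show "(\<lambda>i. (K * (C * exp (\<kappa> * (\<bar>j\<bar> + \<bar>\<epsilon>\<bar>)))) * (case i of (a, b) \<Rightarrow> exp (- \<kappa> * (\<bar>of_int a\<bar> + \<bar>of_int b\<bar>)))) summable_on UNIV"
      by (rule sm)
    show "(\<lambda>i. norm (f i p)) summable_on UNIV" if p: "p \<in> S" for p
    proof (rule summable_on_comparison_test [OF sm])
      fix i
      have "norm (f i p) \<le> (1 + \<bar>A i\<bar> + norm (\<zeta> i p)) * norm (f i p)"
        using mult_right_mono [of 1 "1 + \<bar>A i\<bar> + norm (\<zeta> i p)" "norm (f i p)"] by simp
      also note bd' [OF p]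
      finally show "norm (f i p) \<le> (C * exp (\<kappa> * (\<bar>j\<bar> + \<bar>\<epsilon>\<bar>))) * (case i of (a, b) \<Rightarrow> exp (- \<kappa> * (\<bar>of_int a\<bar> + \<bar>of_int b\<bar>)))" .
    qed simp
  qed
  then have "(\<lambda>p. \<i> / (2 * of_real pi) * (\<Sum>\<^sub>\<infinity>i. f i p)) differentiable at (z1, z2)"
    using has_derivative_mult_right differentiable_def by blast
  then show ?thesis
    unfolding lat_sum_def c_def [symmetric] f_def u_def A_def B_def by (simp add: case_prod_unfold)
qed

section \<open>Calculus of Wirtinger derivatives\<close>

text \<open>A real-linear map of the plane is h -> a h + b cnj h, and its Wirtinger part is a.
  Hiding b in the existential leaves the ordinary rules of calculus for a.\<close>

definition has_wirtinger :: "(complex \<Rightarrow> complex) \<Rightarrow> complex \<Rightarrow> complex \<Rightarrow> bool" where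
  "has_wirtinger f a z \<longleftrightarrow> (\<exists>b. (f has_derivative (\<lambda>h. a * h + b * cnj h)) (at z))"

lemma has_wirtinger_imp_eq:
  assumes "has_wirtinger f a z" shows "wirtinger f z = a"
proof -
  obtain b where "(f has_derivative (\<lambda>h. a * h + b * cnj h)) (at z)"
    using assms unfolding has_wirtinger_def by blast
  then have "(\<lambda>h. a * h + b * cnj h) = frechet_derivative f (at z)" by (rule frechet_derivative_at)
  from fun_cong [OF this [symmetric]] have "frechet_derivative f (at z) h = a * h + b * cnj h" for h .
  then show ?thesis by (simp add: wirtinger_def algebra_simps)
qed

lemma differentiable_imp_has_wirtinger:
  assumes "f differentiable at z" shows "has_wirtinger f (wirtinger f z) z"
proof -
  define D where "D = frechet_derivative f (at z)"
  have D: "(f has_derivative D) (at z)" using assms frechet_derivative_works unfolding D_def by blast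
  then interpret D: bounded_linear D by (rule has_derivative_bounded_linear)
  define b where "b = (D 1 + \<i> * D \<i>) / 2"
  have "D h = wirtinger f z * h + b * cnj h" for h
  proof -
    have "D h = D (Re h *\<^sub>R 1 + Im h *\<^sub>R \<i>)" by (rule arg_cong [where f = D]) (simp add: complex_eq_iff)
    also have "\<dots> = of_real (Re h) * D 1 + of_real (Im h) * D \<i>"
      unfolding D.add D.scaleR by (simp only: scaleR_conv_of_real)
    also have "\<dots> = (D 1 - \<i> * D \<i>) / 2 * (of_real (Re h) + \<i> * of_real (Im h)) + b * (of_real (Re h) - \<i> * of_real (Im h))"
      by (simp add: b_def field_simps)
    also have "of_real (Re h) + \<i> * of_real (Im h) = h" by (simp add: complex_eq_iff)
    also have "of_real (Re h) - \<i> * of_real (Im h) = cnj h" by (simp add: complex_eq_iff)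
    finally show ?thesis by (simp add: wirtinger_def D_def)
  qed
  then have "D = (\<lambda>h. wirtinger f z * h + b * cnj h)" by blast
  with D show ?thesis unfolding has_wirtinger_def by blast
qed

lemma has_wirtinger_mult:
  assumes "has_wirtinger f a z" "has_wirtinger g c z"
  shows "has_wirtinger (\<lambda>w. f w * g w) (f z * c + a * g z) z"
proof -
  obtain b d where "(f has_derivative (\<lambda>h. a * h + b * cnj h)) (at z)" "(g has_derivative (\<lambda>h. c * h + d * cnj h)) (at z)"
    using assms unfolding has_wirtinger_def by blast
  from has_derivative_mult [OF this]
  have "((\<lambda>w. f w * g w) has_derivative (\<lambda>h. (f z * c + a * g z) * h + (f z * d + b * g z) * cnj h)) (at z)"
    by (simp add: algebra_simps)
  then show ?thesis unfolding has_wirtinger_def by blast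
qed

lemma has_field_derivative_imp_has_wirtinger:
  assumes "(f has_field_derivative a) (at z)" shows "has_wirtinger f a z"
  unfolding has_wirtinger_def
  by (rule exI [of _ 0]) (use assms in \<open>simp add: has_field_derivative_def\<close>)

lemma has_wirtinger_sum:
  assumes "\<And>i. i \<in> I \<Longrightarrow> has_wirtinger (f i) (a i) z"
  shows "has_wirtinger (\<lambda>w. \<Sum>i\<in>I. f i w) (\<Sum>i\<in>I. a i) z"
  using assms
proof (induction I rule: infinite_finite_induct)
  case (insert i I)
  then obtain b d where "(f i has_derivative (\<lambda>h. a i * h + b * cnj h)) (at z)"
      "((\<lambda>w. \<Sum>i\<in>I. f i w) has_derivative (\<lambda>h. (\<Sum>i\<in>I. a i) * h + d * cnj h)) (at z)"
    unfolding has_wirtinger_def by blast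
  from has_derivative_add [OF this]
  have "((\<lambda>w. f i w + (\<Sum>i\<in>I. f i w)) has_derivative (\<lambda>h. (a i + (\<Sum>i\<in>I. a i)) * h + (b + d) * cnj h)) (at z)"
    by (simp add: algebra_simps)
  then show ?case unfolding has_wirtinger_def using insert.hyps by auto
qed (use has_field_derivative_imp_has_wirtinger [OF DERIV_const] in auto)

lemma has_wirtinger_transform_open:
  assumes "has_wirtinger f a z" "open U" "z \<in> U" "\<And>w. w \<in> U \<Longrightarrow> f w = g w"
  shows "has_wirtinger g a z"
  using assms unfolding has_wirtinger_def by (meson has_derivative_transform_within_open)

lemma has_wirtinger_scale_arg:
  assumes "has_wirtinger (\<lambda>w. f (w / t)) a z" "t \<noteq> 0"
  shows "has_wirtinger f (t * a) (z / t)"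
proof -
  obtain b where b: "((\<lambda>w. f (w / t)) has_derivative (\<lambda>h. a * h + b * cnj h)) (at z)"
    using assms unfolding has_wirtinger_def by blast
  have "((\<lambda>u. t * u) has_derivative (\<lambda>h. t * h)) (at (z / t))"
    by (auto intro!: derivative_eq_intros)
  moreover have "((\<lambda>w. f (w / t)) has_derivative (\<lambda>h. a * h + b * cnj h)) (at (t * (z / t)))"
    using b assms(2) by simp
  ultimately have "((\<lambda>u. f (t * u / t)) has_derivative (\<lambda>h. a * (t * h) + b * cnj (t * h))) (at (z / t))"
    by (rule has_derivative_compose)
  then have "(f has_derivative (\<lambda>h. a * (t * h) + b * (cnj t * cnj h))) (at (z / t))"
    using assms(2) by simp
  then have "(f has_derivative (\<lambda>h. (t * a) * h + (b * cnj t) * cnj h)) (at (z / t))"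
    by (simp add: mult_ac)
  then show ?thesis unfolding has_wirtinger_def by blast
qed

text \<open>On the diagonal the derivative of the factor \<open>ee (K * z1 * z2)\<close> cancels in \<open>D0\<close>.\<close>

lemma D0_diagonal_transform:
  assumes U: "open U" "z \<in> U" and t: "t \<noteq> 0"
    and F: "\<And>z1 z2. z1 \<in> U \<Longrightarrow> z2 \<in> U \<Longrightarrow> F (z1 / t) (z2 / t) = C * ee (K * z1 * z2) * (\<Sum>i\<in>I. w i * g i z1 z2)"
    and g1: "\<And>i. i \<in> I \<Longrightarrow> (\<lambda>x. g i x z) differentiable at z"
    and g2: "\<And>i. i \<in> I \<Longrightarrow> (\<lambda>x. g i z x) differentiable at z"
  shows "D0 F (z / t) (z / t) = t * C * ee (K * z * z) * (\<Sum>i\<in>I. w i * D0 (g i) z z)"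
proof -
  have ee1: "has_wirtinger (\<lambda>x. C * ee (K * x * z)) (C * (2 * of_real pi * \<i> * K * z * ee (K * z * z))) z"
    by (rule has_field_derivative_imp_has_wirtinger) (auto simp: ee_def intro!: derivative_eq_intros)
  have ee2: "has_wirtinger (\<lambda>x. C * ee (K * z * x)) (C * (2 * of_real pi * \<i> * K * z * ee (K * z * z))) z"
    by (rule has_field_derivative_imp_has_wirtinger) (auto simp: ee_def intro!: derivative_eq_intros)
  have const: "has_wirtinger (\<lambda>x. c) 0 z" for c
    by (rule has_field_derivative_imp_has_wirtinger) (rule DERIV_const)
  have s1: "has_wirtinger (\<lambda>x. \<Sum>i\<in>I. w i * g i x z) (\<Sum>i\<in>I. w i * wirtinger (\<lambda>x. g i x z) z) z"
    by (rule has_wirtinger_sum) (use has_wirtinger_mult [OF const differentiable_imp_has_wirtinger [OF g1]] in simp)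
  have s2: "has_wirtinger (\<lambda>x. \<Sum>i\<in>I. w i * g i z x) (\<Sum>i\<in>I. w i * wirtinger (\<lambda>x. g i z x) z) z"
    by (rule has_wirtinger_sum) (use has_wirtinger_mult [OF const differentiable_imp_has_wirtinger [OF g2]] in simp)
  define G where "G = (\<Sum>i\<in>I. w i * g i z z)"
  define G1 G2 where "G1 = (\<Sum>i\<in>I. w i * wirtinger (\<lambda>x. g i x z) z)" and "G2 = (\<Sum>i\<in>I. w i * wirtinger (\<lambda>x. g i z x) z)"
  \<comment> \<open>The derivative of C ee(K z1 z2) has this value in either variable, because it is
    taken at z1 = z2 = z.\<close>
  define E1 where "E1 = C * (2 * of_real pi * \<i> * K * z * ee (K * z * z))"
  have "has_wirtinger (\<lambda>x. F (x / t) (z / t)) (C * ee (K * z * z) * G1 + E1 * G) z"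
    by (rule has_wirtinger_transform_open [OF has_wirtinger_mult [OF ee1 s1, folded G_def G1_def E1_def] U])
       (use F U(2) in simp)
  from has_wirtinger_imp_eq [OF has_wirtinger_scale_arg [OF this t]]
  have 1: "wirtinger (\<lambda>x. F x (z / t)) (z / t) = t * (C * ee (K * z * z) * G1 + E1 * G)" .
  have "has_wirtinger (\<lambda>x. F (z / t) (x / t)) (C * ee (K * z * z) * G2 + E1 * G) z"
    by (rule has_wirtinger_transform_open [OF has_wirtinger_mult [OF ee2 s2, folded G_def G2_def E1_def] U])
       (use F U(2) in simp)
  from has_wirtinger_imp_eq [OF has_wirtinger_scale_arg [OF this t]]
  have 2: "wirtinger (\<lambda>x. F (z / t) x) (z / t) = t * (C * ee (K * z * z) * G2 + E1 * G)" .
  have sum_D0: "(\<Sum>i\<in>I. w i * D0 (g i) z z) = 1 / (2 * of_real pi * \<i>) * (G1 - G2)"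
    unfolding D0_def G1_def G2_def sum_subtractf [symmetric] sum_distrib_left
    by (rule sum.cong) (simp_all add: algebra_simps)
  show ?thesis unfolding sum_D0 unfolding D0_def 1 2 by (simp add: algebra_simps diff_divide_distrib)
qed

lemma Psi_tilde_differentiable:
  assumes M: "M > 0" and m: "m < 0" and y: "Im \<tau> > 0"
    and \<epsilon>: "2 * \<epsilon> \<in> \<int>" and j: "2 * j \<in> \<int>" and k: "2 * k \<in> \<int>"
    and reg: "regular_point \<tau> z1" "regular_point \<tau> z2"
  shows "(\<lambda>w. Psi_tilde M m \<epsilon> j k \<tau> w z2) differentiable at z1"
    and "(\<lambda>w. Psi_tilde M m \<epsilon> j k \<tau> z1 w) differentiable at z2"
proof -
  define l where "l = nat (- m)"
  have l: "l > 0" using m by (simp add: l_def)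
  have neg: "2 * - \<epsilon> \<in> \<int>" "2 * - k \<in> \<int>" using \<epsilon> k by simp_all
  note d1 = lat_sum_differentiable [OF l M y j \<epsilon> reg(1), of k z2]
  note d2 = lat_sum_differentiable [OF l M y neg(2,1) regular_point_uminus [OF reg(2)], of "- j" "- z1"]
  have "(\<lambda>w. (w, z2)) differentiable at z1" "(\<lambda>w. (- z2, - w)) differentiable at z1"
    "(\<lambda>w. (z1, w)) differentiable at z2" "(\<lambda>w. (- w, - z1)) differentiable at z2"
    by (auto simp: differentiable_def intro!: derivative_eq_intros exI)
  note this = differentiable_chain_at [OF this(1), of "\<lambda>p. lat_sum l M j k \<epsilon> \<tau> (fst p) (snd p)"]
    differentiable_chain_at [OF this(2), of "\<lambda>p. lat_sum l M (- k) (- j) (- \<epsilon>) \<tau> (fst p) (snd p)"]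
    differentiable_chain_at [OF this(3), of "\<lambda>p. lat_sum l M j k \<epsilon> \<tau> (fst p) (snd p)"]
    differentiable_chain_at [OF this(4), of "\<lambda>p. lat_sum l M (- k) (- j) (- \<epsilon>) \<tau> (fst p) (snd p)"]
  then have D: "(\<lambda>w. lat_sum l M j k \<epsilon> \<tau> w z2) differentiable at z1"
    "(\<lambda>w. lat_sum l M (- k) (- j) (- \<epsilon>) \<tau> (- z2) (- w)) differentiable at z1"
    "(\<lambda>w. lat_sum l M j k \<epsilon> \<tau> z1 w) differentiable at z2"
    "(\<lambda>w. lat_sum l M (- k) (- j) (- \<epsilon>) \<tau> (- w) (- z1)) differentiable at z2"
    using d1 d2 by (simp_all add: o_def)
  note op = open_regular_points [OF y]
  \<comment> \<open>The lattice formula for \<open>Psi_tilde\<close> is available at regular points,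
    so differentiability is transported along the open set that they form.\<close>
  have tr: "g differentiable at z" if f: "f differentiable at z" "regular_point \<tau> z" "\<And>w. regular_point \<tau> w \<Longrightarrow> f w = g w"
    for f g :: "complex \<Rightarrow> complex" and z
  proof -
    obtain D where "(f has_derivative D) (at z)" using f(1) unfolding differentiable_def by blast
    then have "(g has_derivative D) (at z)"
      by (rule has_derivative_transform_within_open [OF _ op]) (use f(2,3) in auto)
    then show ?thesis unfolding differentiable_def by blast
  qed
  show "(\<lambda>w. Psi_tilde M m \<epsilon> j k \<tau> w z2) differentiable at z1"
    by (rule tr [OF differentiable_diff [OF D(1,2)] reg(1)])
       (simp add: Psi_tilde_eq_lat_sum [OF M m y \<epsilon> j k _ reg(2)] l_def)
  show "(\<lambda>w. Psi_tilde M m \<epsilon> j k \<tau> z1 w) differentiable at z2"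
    by (rule tr [OF differentiable_diff [OF D(3,4)] reg(2)])
       (simp add: Psi_tilde_eq_lat_sum [OF M m y \<epsilon> j k reg(1)] l_def)
qed

section \<open>Theta functions with characteristics and the triple product\<close>

definition theta_char :: "real \<Rightarrow> real \<Rightarrow> complex \<Rightarrow> complex \<Rightarrow> complex" where
  "theta_char a b \<tau> z = (\<Sum>\<^sub>\<infinity>n::int. ee ((of_real a + of_int n)\<^sup>2 / 2 * \<tau> + (of_real a + of_int n) * (z + of_real b)))"

lemma norm_theta_term_le:
  fixes n :: int
  assumes "d > 0" "d \<le> Im A" "\<bar>Im B\<bar> \<le> K"
  shows "norm (ee (of_int n ^ 2 / 2 * A + of_int n * B)) \<le>
    exp ((2 * pi * K + 1)\<^sup>2 / (4 * (pi * d))) * exp (- 1 * \<bar>of_int n\<bar>)"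
proof -
  define x where "x = \<bar>real_of_int n\<bar>"
  have "Im (of_int n ^ 2 / 2 * A + of_int n * B) = x\<^sup>2 / 2 * Im A + of_int n * Im B"
  proof -
    have eq: "of_int n ^ 2 / 2 * A + of_int n * B = of_real (x\<^sup>2 / 2) * A + of_real (of_int n) * B"
      by (simp add: x_def)
    show ?thesis unfolding eq by simp
  qed
  then have "norm (ee (of_int n ^ 2 / 2 * A + of_int n * B)) = exp (- (pi * Im A * x\<^sup>2) - 2 * pi * (of_int n * Im B))"
    by (simp add: norm_ee algebra_simps)
  also have "\<dots> \<le> exp ((2 * pi * K + 1)\<^sup>2 / (4 * (pi * d)) - x)"
  proof -
    have 1: "pi * d * x\<^sup>2 \<le> pi * Im A * x\<^sup>2" using assms(2) by (intro mult_right_mono mult_left_mono) auto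
    have "- (of_int n * Im B) \<le> x * K"
    proof -
      have "- (of_int n * Im B) \<le> x * \<bar>Im B\<bar>" unfolding x_def by (metis abs_ge_minus_self abs_mult)
      also have "\<dots> \<le> x * K" using assms(3) by (intro mult_left_mono) (auto simp: x_def)
      finally show ?thesis .
    qed
    then have "2 * pi * - (of_int n * Im B) \<le> 2 * pi * (x * K)" by (intro mult_left_mono) auto
    then have 2: "- (2 * pi * (of_int n * Im B)) \<le> 2 * pi * K * x" by (simp add: mult_ac)
    have 3: "- (pi * d * x\<^sup>2) + 2 * pi * K * x \<le> (2 * pi * K + 1)\<^sup>2 / (4 * (pi * d)) - x"
      using quadratic_le_linear [of "pi * d" x "2 * pi * K"] assms(1) by simp
    show ?thesis unfolding exp_le_cancel_iff using 1 2 3 by linarith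
  qed
  also have "\<dots> = exp ((2 * pi * K + 1)\<^sup>2 / (4 * (pi * d))) * exp (- 1 * \<bar>of_int n\<bar>)"
    unfolding mult_exp_exp by (simp add: x_def)
  finally show ?thesis .
qed

lemma summable_exp_neg_abs_int_cmult: "(\<lambda>n::int. C * exp (- 1 * \<bar>of_int n\<bar>) :: real) summable_on UNIV"
  by (intro summable_on_cmult_right summable_on_exp_neg_abs_int) simp

lemma summable_theta_term:
  assumes "Im A > 0"
  shows "(\<lambda>n::int. ee (of_int n ^ 2 / 2 * A + of_int n * B)) summable_on UNIV"
proof -
  have "(\<lambda>n::int. norm (ee (of_int n ^ 2 / 2 * A + of_int n * B))) summable_on UNIV"
    by (rule summable_on_comparison_test [OF summable_exp_neg_abs_int_cmult norm_theta_term_le [OF assms order_refl order_refl]]) simp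
  then show ?thesis by (rule abs_summable_summable)
qed

lemma theta_char_summand:
  "ee ((of_real a + of_int n)\<^sup>2 / 2 * \<tau> + (of_real a + of_int n) * (z + of_real b)) =
   ee (of_real a ^ 2 / 2 * \<tau> + of_real a * (z + of_real b)) *
   ee (of_int n ^ 2 / 2 * \<tau> + of_int n * (z + of_real b + of_real a * \<tau>))"
  unfolding ee_add [symmetric] by (rule arg_cong [where f = ee]) (simp add: field_simps power2_eq_square)

lemma summable_theta_char:
  assumes "Im \<tau> > 0"
  shows "(\<lambda>n::int. ee ((of_real a + of_int n)\<^sup>2 / 2 * \<tau> + (of_real a + of_int n) * (z + of_real b))) summable_on UNIV"
  unfolding theta_char_summand by (intro summable_on_cmult_right summable_theta_term assms)

lemma theta_char_eq:
  "theta_char a b \<tau> z = ee (of_real a ^ 2 / 2 * \<tau> + of_real a * (z + of_real b)) *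
     theta_char 0 0 \<tau> (z + of_real b + of_real a * \<tau>)"
  unfolding theta_char_def theta_char_summand infsum_cmult_right' by simp

text \<open>On a closed disc the minimum of Im A and the maximum of |Im B| yield one majorant for
  all terms, so the convergence is locally uniform and the limit holomorphic.\<close>

lemma holomorphic_theta_series:
  assumes U: "open U" and A: "A holomorphic_on U" and B: "B holomorphic_on U"
    and pos: "\<And>t. t \<in> U \<Longrightarrow> Im (A t) > 0"
  shows "(\<lambda>t. \<Sum>\<^sub>\<infinity>n::int. ee (of_int n ^ 2 / 2 * A t + of_int n * B t)) holomorphic_on U"
proof -
  have "\<exists>r>0. (\<lambda>t. \<Sum>\<^sub>\<infinity>n::int. ee (of_int n ^ 2 / 2 * A t + of_int n * B t)) holomorphic_on ball x r" if x: "x \<in> U" for x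
  proof -
    obtain r where r: "r > 0" "cball x r \<subseteq> U" using U x open_contains_cball by blast
    have cA: "continuous_on (cball x r) (\<lambda>t. Im (A t))" and cB: "continuous_on (cball x r) (\<lambda>t. \<bar>Im (B t)\<bar>)"
      using holomorphic_on_imp_continuous_on [OF A] holomorphic_on_imp_continuous_on [OF B] r(2)
      by (auto intro!: continuous_intros intro: continuous_on_subset)
    have ne: "cball x r \<noteq> {}" using r(1) by auto
    obtain t0 where t0: "t0 \<in> cball x r" "\<And>t. t \<in> cball x r \<Longrightarrow> Im (A t0) \<le> Im (A t)"
      using continuous_attains_inf [OF compact_cball ne cA] by blast
    obtain t1 where t1: "\<And>t. t \<in> cball x r \<Longrightarrow> \<bar>Im (B t)\<bar> \<le> \<bar>Im (B t1)\<bar>"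
      using continuous_attains_sup [OF compact_cball ne cB] by blast
    have d: "Im (A t0) > 0" using pos t0(1) r(2) by blast
    have ul: "uniform_limit (cball x r) (\<lambda>X t. \<Sum>n\<in>X. ee (of_int n ^ 2 / 2 * A t + of_int n * B t))
        (\<lambda>t. \<Sum>\<^sub>\<infinity>n::int. ee (of_int n ^ 2 / 2 * A t + of_int n * B t)) (finite_subsets_at_top UNIV)"
      by (rule Weierstrass_m_test_general [OF _ summable_exp_neg_abs_int_cmult])
         (rule norm_theta_term_le [OF d t0(2) t1])
    have hol: "(\<lambda>t. \<Sum>n\<in>X. ee (of_int n ^ 2 / 2 * A t + of_int n * B t)) holomorphic_on U" for X
      unfolding ee_def by (intro holomorphic_intros A B) auto
    have "(\<lambda>t. \<Sum>\<^sub>\<infinity>n::int. ee (of_int n ^ 2 / 2 * A t + of_int n * B t)) holomorphic_on ball x r"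
    proof (rule holomorphic_uniform_limit [OF _ ul])
      show "\<forall>\<^sub>F X in finite_subsets_at_top UNIV. continuous_on (cball x r) (\<lambda>t. \<Sum>n\<in>X. ee (of_int n ^ 2 / 2 * A t + of_int n * B t)) \<and>
          (\<lambda>t. \<Sum>n\<in>X. ee (of_int n ^ 2 / 2 * A t + of_int n * B t)) holomorphic_on ball x r"
        using r(2) ball_subset_cball [of x r]
        by (intro always_eventually allI conjI holomorphic_on_imp_continuous_on holomorphic_on_subset [OF hol]) auto
    qed auto
    with r(1) show ?thesis by blast
  qed
  note near = this
  show ?thesis
    unfolding holomorphic_on_def
  proof
    fix x assume "x \<in> U"
    then obtain r where "r > 0"
      "(\<lambda>t. \<Sum>\<^sub>\<infinity>n::int. ee (of_int n ^ 2 / 2 * A t + of_int n * B t)) holomorphic_on ball x r"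
      using near by blast
    then have "(\<lambda>t. \<Sum>\<^sub>\<infinity>n::int. ee (of_int n ^ 2 / 2 * A t + of_int n * B t)) field_differentiable at x"
      by (intro holomorphic_on_imp_differentiable_at [OF _ open_ball]) auto
    then show "(\<lambda>t. \<Sum>\<^sub>\<infinity>n::int. ee (of_int n ^ 2 / 2 * A t + of_int n * B t)) field_differentiable at x within U"
      by (rule field_differentiable_at_within)
  qed
qed

lemma csqrt_square: "csqrt w * csqrt w = w"
  by (metis power2_csqrt power2_eq_square)

lemma theta_S_imaginary:
  assumes s: "s > 0"
  shows "theta_char 0 0 (- 1 / (\<i> * of_real s)) (z / (\<i> * of_real s)) =
    of_real (sqrt s) * ee (z\<^sup>2 / (2 * (\<i> * of_real s))) * theta_char 0 0 (\<i> * of_real s) z"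
proof -
  define w where "w = z / (\<i> * of_real s)"
  have zw: "z = \<i> * of_real s * w" using s by (simp add: w_def)
  have "theta_char 0 0 (- 1 / (\<i> * of_real s)) w = (\<Sum>\<^sub>\<infinity>n::int. of_real (exp (- pi * (of_int n - 0)\<^sup>2 / s)) * ee (of_int n * w))"
    unfolding theta_char_def
  proof (rule infsum_cong)
    fix n :: int
    show "ee ((of_real 0 + of_int n)\<^sup>2 / 2 * (- 1 / (\<i> * of_real s)) + (of_real 0 + of_int n) * (w + of_real 0)) =
      of_real (exp (- pi * (of_int n - 0)\<^sup>2 / s)) * ee (of_int n * w)"
      unfolding ee_def exp_of_real [symmetric] mult_exp_exp
      by (rule arg_cong [where f = exp]) (use s in \<open>simp add: field_simps\<close>)
  qed
  also have "\<dots> = of_real (sqrt s) * (\<Sum>\<^sub>\<infinity>b::int. exp (- (of_real (pi * s) * (w + of_int b)\<^sup>2) + 2 * of_real pi * \<i> * of_real 0 * (w + of_int b)))"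
    unfolding theta_inversion_real [OF s] using s by simp
  also have "(\<Sum>\<^sub>\<infinity>b::int. exp (- (of_real (pi * s) * (w + of_int b)\<^sup>2) + 2 * of_real pi * \<i> * of_real 0 * (w + of_int b))) =
      ee (z\<^sup>2 / (2 * (\<i> * of_real s))) * theta_char 0 0 (\<i> * of_real s) z"
    unfolding theta_char_def infsum_cmult_right' [symmetric]
  proof (rule infsum_cong)
    fix n :: int
    show "exp (- (of_real (pi * s) * (w + of_int n)\<^sup>2) + 2 * of_real pi * \<i> * of_real 0 * (w + of_int n)) =
      ee (z\<^sup>2 / (2 * (\<i> * of_real s))) * ee ((of_real 0 + of_int n)\<^sup>2 / 2 * (\<i> * of_real s) + (of_real 0 + of_int n) * (z + of_real 0))"
      unfolding ee_def mult_exp_exp zw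
      by (rule arg_cong [where f = exp]) (use s in \<open>simp add: field_simps power2_eq_square\<close>)
  qed
  finally show ?thesis by (simp add: w_def mult.assoc)
qed

text \<open>Both sides are holomorphic in \<tau> on the upper half-plane and agree on the imaginary
  axis. There -i \<tau> is positive and its root is the positive one, which identifies the branch as
  the principal one.\<close>

lemma theta_S:
  assumes "Im \<tau> > 0"
  shows "theta_char 0 0 (- 1 / \<tau>) (z / \<tau>) = csqrt (- \<i> * \<tau>) * ee (z\<^sup>2 / (2 * \<tau>)) * theta_char 0 0 \<tau> z"
proof -
  define U where "U = {t :: complex. Im t > 0}"
  define f where "f = (\<lambda>t. theta_char 0 0 (- 1 / t) (z / t) - csqrt (- \<i> * t) * ee (z\<^sup>2 / (2 * t)) * theta_char 0 0 t z)"
  have U: "open U" unfolding U_def by (rule open_halfspace_Im_gt)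
  have nz: "t \<noteq> 0" if "t \<in> U" for t using that by (auto simp: U_def)
  have "(\<lambda>t. \<Sum>\<^sub>\<infinity>n::int. ee (of_int n ^ 2 / 2 * (- 1 / t) + of_int n * (z / t))) holomorphic_on U"
    by (rule holomorphic_theta_series [OF U])
       (auto intro!: holomorphic_intros simp: nz Im_minus_inverse U_def simp del: minus_divide_left divide_minus_left)
  then have 1: "(\<lambda>t. theta_char 0 0 (- 1 / t) (z / t)) holomorphic_on U" by (simp add: theta_char_def)
  have "(\<lambda>t. \<Sum>\<^sub>\<infinity>n::int. ee (of_int n ^ 2 / 2 * t + of_int n * z)) holomorphic_on U"
    by (rule holomorphic_theta_series [OF U]) (auto intro!: holomorphic_intros simp: U_def)
  then have 2: "(\<lambda>t. theta_char 0 0 t z) holomorphic_on U" by (simp add: theta_char_def)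
  have 3: "(\<lambda>t. csqrt (- \<i> * t)) holomorphic_on U"
    by (intro holomorphic_intros) (auto simp: U_def complex_nonpos_Reals_iff)
  have 4: "(\<lambda>t. ee (z\<^sup>2 / (2 * t))) holomorphic_on U"
    unfolding ee_def by (intro holomorphic_intros) (auto simp: nz)
  have hol: "f holomorphic_on U"
    unfolding f_def by (intro holomorphic_on_diff holomorphic_on_mult 1 2 3 4)
  have con: "connected U" unfolding U_def by (intro convex_connected convex_halfspace_Im_gt)
  define V where "V = (\<lambda>s. \<i> * of_real s) ` {0<..}"
  have lim: "\<i> islimpt V"
  proof (subst islimpt_approachable, intro allI impI)
    fix e :: real assume "e > 0"
    then show "\<exists>x'\<in>V. x' \<noteq> \<i> \<and> dist x' \<i> < e"
      by (intro bexI [of _ "\<i> * of_real (1 + e / 2)"])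
         (auto simp: V_def dist_norm algebra_simps norm_mult complex_eq_iff)
  qed
  have V0: "f t = 0" if "t \<in> V" for t
  proof -
    from that obtain s where s: "s > 0" "t = \<i> * of_real s" by (auto simp: V_def)
    have "- \<i> * t = of_real s" by (simp add: s)
    then have "csqrt (- \<i> * t) = of_real (sqrt s)" using s by (simp add: csqrt_of_real_nonneg)
    then show ?thesis using theta_S_imaginary [OF s(1), of z] by (simp add: f_def s(2))
  qed
  have "f \<tau> = 0"
    by (rule analytic_continuation [OF hol U con _ _ lim V0]) (use assms in \<open>auto simp: U_def V_def\<close>)
  then show ?thesis by (simp add: f_def)
qed

lemma theta_char_S:
  assumes "Im \<tau> > 0"
  shows "theta_char a b (- 1 / \<tau>) (z / \<tau>) =
    csqrt (- \<i> * \<tau>) * ee (z\<^sup>2 / (2 * \<tau>)) * ee (of_real (a * b)) * theta_char b (- a) \<tau> z"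
proof -
  have \<tau>: "\<tau> \<noteq> 0" using assms by auto
  define Z where "Z = z + of_real b * \<tau> - of_real a"
  have arg: "z / \<tau> + of_real b + of_real a * (- 1 / \<tau>) = Z / \<tau>"
    using \<tau> by (simp add: Z_def field_simps)
  have arg': "z + of_real (- a) + of_real b * \<tau> = Z" by (simp add: Z_def)
  have "ee (of_real a ^ 2 / 2 * (- 1 / \<tau>) + of_real a * (z / \<tau> + of_real b)) * ee (Z\<^sup>2 / (2 * \<tau>)) =
     ee (z\<^sup>2 / (2 * \<tau>)) * ee (of_real (a * b)) * ee (of_real b ^ 2 / 2 * \<tau> + of_real b * (z + of_real (- a)))"
    unfolding ee_add [symmetric]
    by (rule arg_cong [where f = ee]) (use \<tau> in \<open>simp add: Z_def field_simps power2_eq_square\<close>)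
  then show ?thesis
    unfolding theta_char_eq [of a b] theta_char_eq [of b "- a"] arg arg' theta_S [OF assms]
    by (simp add: mult_ac)
qed

lemma theta_char_add_1_right: "theta_char a (b + 1) \<tau> z = ee (of_real a) * theta_char a b \<tau> z"
  unfolding theta_char_def infsum_cmult_right' [symmetric]
proof (rule infsum_cong)
  fix n :: int
  have "(of_real a + of_int n)\<^sup>2 / 2 * \<tau> + (of_real a + of_int n) * (z + of_real (b + 1)) =
    of_real a + ((of_real a + of_int n)\<^sup>2 / 2 * \<tau> + (of_real a + of_int n) * (z + of_real b)) + of_int n"
    by (simp add: algebra_simps)
  then show "ee ((of_real a + of_int n)\<^sup>2 / 2 * \<tau> + (of_real a + of_int n) * (z + of_real (b + 1))) =
    ee (of_real a) * ee ((of_real a + of_int n)\<^sup>2 / 2 * \<tau> + (of_real a + of_int n) * (z + of_real b))"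
    by (simp only: ee_add ee_of_int mult_1_right)
qed

lemma theta_char_T: "theta_char a b (\<tau> + 1) z = ee (of_real (- (a\<^sup>2 + a) / 2)) * theta_char a (b + a + 1 / 2) \<tau> z"
  unfolding theta_char_def infsum_cmult_right' [symmetric]
proof (rule infsum_cong)
  fix n :: int
  \<comment> \<open>This parity turns n^2 / 2 into n / 2 modulo integers, so that adding 1 to \<tau>
    amounts to a shift of b by a + 1/2 and a constant phase.\<close>
  have "even (n\<^sup>2 - n)" by simp
  then obtain i where "n\<^sup>2 - n = 2 * i" by blast
  then have i: "(of_int n)\<^sup>2 - of_int n = (2 * of_int i :: complex)"
    by (metis of_int_diff of_int_mult of_int_numeral of_int_power)
  have "(of_real a + of_int n)\<^sup>2 / 2 * (\<tau> + 1) + (of_real a + of_int n) * (z + of_real b) =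
    of_real (- (a\<^sup>2 + a) / 2) + ((of_real a + of_int n)\<^sup>2 / 2 * \<tau> + (of_real a + of_int n) * (z + of_real (b + a + 1 / 2)))
      + ((of_int n)\<^sup>2 - of_int n) / 2"
    by (simp add: field_simps power2_eq_square)
  also have "((of_int n)\<^sup>2 - of_int n) / 2 = (of_int i :: complex)" unfolding i by simp
  finally show "ee ((of_real a + of_int n)\<^sup>2 / 2 * (\<tau> + 1) + (of_real a + of_int n) * (z + of_real b)) =
    ee (of_real (- (a\<^sup>2 + a) / 2)) * ee ((of_real a + of_int n)\<^sup>2 / 2 * \<tau> + (of_real a + of_int n) * (z + of_real (b + a + 1 / 2)))"
    by (simp only: ee_add ee_of_int mult_1_right)
qed

lemma infsum_int_even_odd:
  fixes f :: "int \<Rightarrow> complex"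
  assumes "f summable_on UNIV"
  shows "infsum f UNIV = (\<Sum>\<^sub>\<infinity>n. f (2 * n)) + (\<Sum>\<^sub>\<infinity>n. f (2 * n + 1))"
proof -
  have s: "f summable_on A" for A using assms by (rule summable_on_subset_banach) simp
  have UN: "UNIV = range (\<lambda>n::int. 2 * n) \<union> range (\<lambda>n. 2 * n + 1)"
  proof -
    have "x \<in> range (\<lambda>n::int. 2 * n) \<union> range (\<lambda>n. 2 * n + 1)" for x
      by (cases "even x") (auto elim!: evenE oddE)
    then show ?thesis by blast
  qed
  have "infsum f UNIV = infsum f (range (\<lambda>n::int. 2 * n)) + infsum f (range (\<lambda>n. 2 * n + 1))"
  proof (subst UN, rule infsum_Un_disjoint [OF s s])
    show "range (\<lambda>n::int. 2 * n) \<inter> range (\<lambda>n. 2 * n + 1) = {}" by auto presburger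
  qed
  also have "infsum f (range (\<lambda>n::int. 2 * n)) = (\<Sum>\<^sub>\<infinity>n. f (2 * n))"
    by (subst infsum_reindex) (auto simp: inj_on_def o_def)
  also have "infsum f (range (\<lambda>n::int. 2 * n + 1)) = (\<Sum>\<^sub>\<infinity>n. f (2 * n + 1))"
    by (subst infsum_reindex) (auto simp: inj_on_def o_def)
  finally show ?thesis .
qed

lemma Theta_2_eq:
  "Theta j 2 \<tau> z = (\<Sum>\<^sub>\<infinity>n::int. ee ((of_int j / 2 + of_int (2 * n))\<^sup>2 / 2 * \<tau> + (of_int j / 2 + of_int (2 * n)) * z))"
  unfolding Theta_eq_infsum ee_add [symmetric]
  by (intro infsum_cong arg_cong [where f = ee]) (simp add: field_simps power2_eq_square)

lemma ee_quarter: "ee (1 / 4) = \<i>"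
proof -
  have "2 * of_real pi * \<i> * (1 / 4) = \<i> * of_real (pi / 2)" by simp
  then show ?thesis unfolding ee_def by (simp only: cis_conv_exp [symmetric] cis_pi_half)
qed

text \<open>Even and odd n give the two theta functions of level 2, since the phase ee((a/2 + n)
  b/2) is constant on each half; its values 1, -1, i, -i are the coefficients in
  \<open>vartheta\<close>. For a = 1 the odd half is reindexed by 1/2 + (2 n + 1) = -1/2 + 2 (n +
  1).\<close>

lemma vartheta_eq_theta_char:
  assumes y: "Im \<tau> > 0" and ab: "a = 0 \<or> a = 1" "b = 0 \<or> b = 1"
  shows "vartheta a b \<tau> z = theta_char (a / 2) (b / 2) \<tau> z"
proof -
  have split: "theta_char (a / 2) (b / 2) \<tau> z =
    (\<Sum>\<^sub>\<infinity>n::int. ee ((of_real (a / 2) + of_int (2 * n))\<^sup>2 / 2 * \<tau> + (of_real (a / 2) + of_int (2 * n)) * (z + of_real (b / 2)))) +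
    (\<Sum>\<^sub>\<infinity>n::int. ee ((of_real (a / 2) + of_int (2 * n + 1))\<^sup>2 / 2 * \<tau> + (of_real (a / 2) + of_int (2 * n + 1)) * (z + of_real (b / 2))))"
    unfolding theta_char_def by (rule infsum_int_even_odd [OF summable_theta_char [OF y]])
  have phase: "ee (x * (z + of_real (b / 2)) + w) = ee (x * of_real (b / 2)) * ee (w + x * z)" for x w
    unfolding ee_add [symmetric] by (rule arg_cong [where f = ee]) (simp add: algebra_simps)
  show ?thesis
  proof (cases "a = 0")
    case True
    have 1: "(\<Sum>\<^sub>\<infinity>n::int. ee ((of_real (a / 2) + of_int (2 * n))\<^sup>2 / 2 * \<tau> + (of_real (a / 2) + of_int (2 * n)) * (z + of_real (b / 2)))) = Theta 0 2 \<tau> z"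
      unfolding Theta_2_eq
    proof (rule infsum_cong)
      fix n :: int
      have "ee ((of_real (a / 2) + of_int (2 * n)) * of_real (b / 2)) = 1"
        by (rule ee_Ints) (use True ab in auto)
      then show "ee ((of_real (a / 2) + of_int (2 * n))\<^sup>2 / 2 * \<tau> + (of_real (a / 2) + of_int (2 * n)) * (z + of_real (b / 2))) =
        ee ((of_int 0 / 2 + of_int (2 * n))\<^sup>2 / 2 * \<tau> + (of_int 0 / 2 + of_int (2 * n)) * z)"
        using phase [of "of_real (a / 2) + of_int (2 * n)" "(of_real (a / 2) + of_int (2 * n))\<^sup>2 / 2 * \<tau>"] True by (simp add: add.commute)
    qed
    have 2: "(\<Sum>\<^sub>\<infinity>n::int. ee ((of_real (a / 2) + of_int (2 * n + 1))\<^sup>2 / 2 * \<tau> + (of_real (a / 2) + of_int (2 * n + 1)) * (z + of_real (b / 2)))) =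
       ee (of_real (b / 2)) * Theta 2 2 \<tau> z"
      unfolding Theta_2_eq infsum_cmult_right' [symmetric]
    proof (rule infsum_cong)
      fix n :: int
      have "(of_real (a / 2) + of_int (2 * n + 1)) * of_real (b / 2) = of_real (b / 2) + (of_int n * of_real b :: complex)"
        using True by (simp add: field_simps)
      then have "ee ((of_real (a / 2) + of_int (2 * n + 1)) * of_real (b / 2)) = ee (of_real (b / 2)) * ee (of_int n * of_real b)"
        by (simp only: ee_add)
      also have "ee (of_int n * of_real b) = 1" by (rule ee_Ints) (use ab in auto)
      finally show "ee ((of_real (a / 2) + of_int (2 * n + 1))\<^sup>2 / 2 * \<tau> + (of_real (a / 2) + of_int (2 * n + 1)) * (z + of_real (b / 2))) =
        ee (of_real (b / 2)) * ee ((of_int 2 / 2 + of_int (2 * n))\<^sup>2 / 2 * \<tau> + (of_int 2 / 2 + of_int (2 * n)) * z)"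
        using phase [of "of_real (a / 2) + of_int (2 * n + 1)" "(of_real (a / 2) + of_int (2 * n + 1))\<^sup>2 / 2 * \<tau>"] True by (simp add: add.commute)
    qed
    show ?thesis
      unfolding split 1 2 using True ab ee_half by (auto simp: vartheta_def)
  next
    case False
    then have a: "a = 1" using ab by simp
    have 1: "(\<Sum>\<^sub>\<infinity>n::int. ee ((of_real (a / 2) + of_int (2 * n))\<^sup>2 / 2 * \<tau> + (of_real (a / 2) + of_int (2 * n)) * (z + of_real (b / 2)))) =
      ee (of_real (b / 4)) * Theta 1 2 \<tau> z"
      unfolding Theta_2_eq infsum_cmult_right' [symmetric]
    proof (rule infsum_cong)
      fix n :: int
      have "(of_real (a / 2) + of_int (2 * n)) * of_real (b / 2) = of_real (b / 4) + (of_int n * of_real b :: complex)"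
        using a by (simp add: field_simps)
      then have "ee ((of_real (a / 2) + of_int (2 * n)) * of_real (b / 2)) = ee (of_real (b / 4)) * ee (of_int n * of_real b)"
        by (simp only: ee_add)
      also have "ee (of_int n * of_real b) = 1" by (rule ee_Ints) (use ab in auto)
      finally show "ee ((of_real (a / 2) + of_int (2 * n))\<^sup>2 / 2 * \<tau> + (of_real (a / 2) + of_int (2 * n)) * (z + of_real (b / 2))) =
        ee (of_real (b / 4)) * ee ((of_int 1 / 2 + of_int (2 * n))\<^sup>2 / 2 * \<tau> + (of_int 1 / 2 + of_int (2 * n)) * z)"
        using phase [of "of_real (a / 2) + of_int (2 * n)" "(of_real (a / 2) + of_int (2 * n))\<^sup>2 / 2 * \<tau>"] a by (simp add: add.commute)
    qed
    have 2: "(\<Sum>\<^sub>\<infinity>n::int. ee ((of_real (a / 2) + of_int (2 * n + 1))\<^sup>2 / 2 * \<tau> + (of_real (a / 2) + of_int (2 * n + 1)) * (z + of_real (b / 2)))) =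
       ee (of_real (- b / 4)) * Theta (- 1) 2 \<tau> z"
      unfolding Theta_2_eq infsum_cmult_right' [symmetric]
    proof (rule infsum_reindex_bij_witness [of _ "\<lambda>n. n - 1" "\<lambda>n. n + 1"])
      fix n :: int
      have x: "of_int (- 1) / 2 + of_int (2 * (n + 1)) = (of_real (a / 2) + of_int (2 * n + 1) :: complex)" using a by simp
      have "(of_real (a / 2) + of_int (2 * n + 1)) * of_real (b / 2) = of_real (- b / 4) + (of_int (n + 1) * of_real b :: complex)"
        using a by (simp add: field_simps)
      then have "ee ((of_real (a / 2) + of_int (2 * n + 1)) * of_real (b / 2)) = ee (of_real (- b / 4)) * ee (of_int (n + 1) * of_real b)"
        by (simp only: ee_add)
      also have "ee (of_int (n + 1) * of_real b) = 1" by (rule ee_Ints) (use ab in auto)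
      finally show "ee (of_real (- b / 4)) * ee ((of_int (- 1) / 2 + of_int (2 * (n + 1)))\<^sup>2 / 2 * \<tau> + (of_int (- 1) / 2 + of_int (2 * (n + 1))) * z) =
        ee ((of_real (a / 2) + of_int (2 * n + 1))\<^sup>2 / 2 * \<tau> + (of_real (a / 2) + of_int (2 * n + 1)) * (z + of_real (b / 2)))"
        unfolding x using phase [of "of_real (a / 2) + of_int (2 * n + 1)" "(of_real (a / 2) + of_int (2 * n + 1))\<^sup>2 / 2 * \<tau>"] by (simp add: add.commute)
    qed auto
    have q: "ee (- (1 / 4)) = - \<i>" by (simp add: ee_minus ee_quarter)
    show ?thesis
      unfolding split 1 2 using a ab ee_quarter q by (auto simp: vartheta_def)
  qed
qed

section \<open>Jacobi's triple product as a limit of finite products\<close>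

text \<open>Tannery's theorem. The majorant makes the partial sums converge uniformly in N, so the
  two limits may be exchanged.\<close>

lemma infsum_dominated_convergence:
  fixes f :: "nat \<Rightarrow> 'i \<Rightarrow> complex"
  assumes lim: "\<And>j. (\<lambda>N. f N j) \<longlonglongrightarrow> g j" and bound: "\<And>N j. norm (f N j) \<le> B j"
    and B: "B summable_on UNIV"
  shows "(\<lambda>N. \<Sum>\<^sub>\<infinity>j. f N j) \<longlonglongrightarrow> (\<Sum>\<^sub>\<infinity>j. g j)"
proof (rule swap_uniform_limit' [where f = "\<lambda>X N. \<Sum>j\<in>X. f N j" and g = "\<lambda>X. \<Sum>j\<in>X. g j"
      and F = "finite_subsets_at_top UNIV" and S = UNIV])
  show "\<forall>\<^sub>F X in finite_subsets_at_top UNIV. (\<lambda>N. \<Sum>j\<in>X. f N j) \<longlonglongrightarrow> (\<Sum>j\<in>X. g j)"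
    by (intro always_eventually allI tendsto_sum lim)
  have "norm (g j) \<le> B j" for j
    by (rule tendsto_upperbound [OF tendsto_norm [OF lim]]) (auto intro: always_eventually bound)
  then have "(\<lambda>j. norm (g j)) summable_on UNIV"
    by (intro summable_on_comparison_test [OF B]) auto
  then have "g summable_on UNIV" by (rule abs_summable_summable)
  then show "((\<lambda>X. \<Sum>j\<in>X. g j) \<longlongrightarrow> (\<Sum>\<^sub>\<infinity>j. g j)) (finite_subsets_at_top UNIV)"
    by (rule infsum_tendsto)
  show "uniform_limit UNIV (\<lambda>X N. \<Sum>j\<in>X. f N j) (\<lambda>N. \<Sum>\<^sub>\<infinity>j. f N j) (finite_subsets_at_top UNIV)"
    by (rule Weierstrass_m_test_general [OF bound B])
qed auto

text \<open>The q-Pochhammer symbol (q; q)_n.\<close>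

definition qfact :: "complex \<Rightarrow> nat \<Rightarrow> complex" where
  "qfact q n = (\<Prod>i<n. 1 - q ^ Suc i)"

text \<open>The convention that \<open>1 / (q; q)\<^sub>m\<close> vanishes for negative \<open>m\<close> makes the recurrence for the
  coefficients of the finite triple product uniform in the index.\<close>

definition inv_qfact :: "complex \<Rightarrow> int \<Rightarrow> complex" where
  "inv_qfact q m = (if m < 0 then 0 else 1 / qfact q (nat m))"

lemma inv_qfact_rec:
  assumes "\<And>n. q ^ Suc n \<noteq> 1"
  shows "inv_qfact q (m - 1) = (1 - q powi m) * inv_qfact q m"
proof (cases "m \<le> 0")
  case True
  \<comment> \<open>At m = 0 the left side is 0 by convention and the right side because 1 - q^0 =
    0, so the recurrence passes over the cut-off.\<close>
  then show ?thesis by (cases "m = 0") (auto simp: inv_qfact_def)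
next
  case False
  define n where "n = nat (m - 1)"
  have m: "m = int (Suc n)" using False by (simp add: n_def)
  have "1 - q ^ Suc n \<noteq> 0" using assms [of n] by simp
  then show ?thesis
    unfolding inv_qfact_def m power_int_of_nat by (simp add: qfact_def nat_add_distrib)
qed

text \<open>The coefficients are Gaussian binomials of 2 N over N + j in q = p^2, which vanish for
  |j| > N. Passing to N + 1 multiplies by (1 + u x)(1 + u / x) = 1 + u^2 + u x + u / x with u = p^(2
  N + 1), so comparing coefficients of x^j gives a recurrence with the three neighbours j - 1, j, j
  + 1.\<close>

lemma finite_triple_product:
  fixes p x :: complex
  assumes p: "p \<noteq> 0" "\<And>n. p ^ (2 * Suc n) \<noteq> 1" and x: "x \<noteq> 0"
  shows "((\<lambda>j. qfact (p\<^sup>2) (2 * N) * (inv_qfact (p\<^sup>2) (int N - j) * inv_qfact (p\<^sup>2) (int N + j)) * (p powi (j * j) * x powi j))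
     has_sum (\<Prod>k<N. (1 + p ^ (2 * k + 1) * x) * (1 + p ^ (2 * k + 1) / x))) UNIV"
proof (induction N)
  case 0
  have "qfact (p\<^sup>2) (2 * 0) * (inv_qfact (p\<^sup>2) (int 0 - j) * inv_qfact (p\<^sup>2) (int 0 + j)) * (p powi (j * j) * x powi j) =
      (if j = 0 then 1 else 0)" for j
    by (auto simp: qfact_def inv_qfact_def)
  moreover have "((\<lambda>j::int. if j = 0 then 1 else 0) has_sum (1 :: complex)) UNIV"
    by (rule has_sum_finite_neutralI [of "{0}"]) auto
  ultimately show ?case by simp
next
  case (Suc N)
  define q where "q = p\<^sup>2"
  have q: "q \<noteq> 0" "\<And>n. q ^ Suc n \<noteq> 1"
    using p unfolding q_def power_mult [symmetric] by auto
  define c where "c = (\<lambda>j. qfact q (2 * N) * (inv_qfact q (int N - j) * inv_qfact q (int N + j)))"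
  define c' where "c' = (\<lambda>j. qfact q (2 * Suc N) * (inv_qfact q (int (Suc N) - j) * inv_qfact q (int (Suc N) + j)))"
  define g where "g = (\<lambda>j. c j * (p powi (j * j) * x powi j))"
  define P where "P = (\<Prod>k<N. (1 + p ^ (2 * k + 1) * x) * (1 + p ^ (2 * k + 1) / x))"
  define u where "u = p ^ (2 * N + 1)"
  have IH: "(g has_sum P) UNIV" using Suc.IH by (simp add: g_def c_def q_def P_def)
  have bij: "bij_betw (\<lambda>j::int. j + i) UNIV UNIV" for i
    by (rule bij_betwI [of _ _ _ "\<lambda>j. j - i"]) auto
  have sh: "((\<lambda>j. g (j + i)) has_sum P) UNIV" for i
    using IH has_sum_reindex_bij_betw [OF bij, of g i] by simp
  have "((\<lambda>j. (1 + u\<^sup>2) * g j + u * x * g (j + - 1) + u / x * g (j + 1)) has_sum ((1 + u\<^sup>2) * P + u * x * P + u / x * P)) UNIV"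
    by (intro has_sum_add has_sum_cmult_right IH sh)
  moreover have "(1 + u\<^sup>2) * P + u * x * P + u / x * P = P * ((1 + u * x) * (1 + u / x))"
    using x by (simp add: field_simps power2_eq_square)
  moreover have "(1 + u\<^sup>2) * g j + u * x * g (j + - 1) + u / x * g (j + 1) = c' j * (p powi (j * j) * x powi j)" for j
  proof -
    \<comment> \<open>Indices at level N + 1. With A = q^a and B = q^b the three old coefficients
      and the new one are multiples of \<open>G\<close>, and the recurrence becomes (1 + A B / q)(1
      - A)(1 - B) + A (1 - B)(1 - B / q) + B (1 - A)(1 - A / q) = (1 - A B / q)(1 - A B).\<close>
    define a b where "a = int (Suc N) - j" and "b = int (Suc N) + j"
    define A B where "A = q powi a" and "B = q powi b"
    define G where "G = qfact q (2 * N) * (inv_qfact q a * inv_qfact q b)"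
    have AB: "A * B = q ^ (2 * N + 2)"
    proof -
      have "A * B = q powi (int (2 * N + 2))"
        unfolding A_def B_def using q(1) by (subst power_int_add [symmetric]) (auto simp: a_def b_def)
      then show ?thesis by (simp only: power_int_of_nat)
    qed
    have A1: "q powi (a - 1) = A / q" "q powi (b - 1) = B / q"
      unfolding A_def B_def using q(1) by (simp_all add: power_int_diff)
    have cj: "c j = G * ((1 - A) * (1 - B))"
    proof -
      have "int N - j = a - 1" "int N + j = b - 1" by (simp_all add: a_def b_def)
      then show ?thesis unfolding c_def G_def A_def B_def by (simp add: inv_qfact_rec [OF q(2)])
    qed
    have cm: "c (j - 1) = G * ((1 - B) * (1 - B / q))"
    proof -
      have "int N - (j - 1) = a" "int N + (j - 1) = b - 1 - 1" by (simp_all add: a_def b_def)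
      then show ?thesis unfolding c_def G_def
        by (simp only: inv_qfact_rec [OF q(2)] A1 B_def [symmetric] mult_ac)
    qed
    have cp: "c (j + 1) = G * ((1 - A) * (1 - A / q))"
    proof -
      have "int N - (j + 1) = a - 1 - 1" "int N + (j + 1) = b" by (simp_all add: a_def b_def)
      then show ?thesis unfolding c_def G_def
        by (simp only: inv_qfact_rec [OF q(2)] A1 A_def [symmetric] mult_ac)
    qed
    have "qfact q (2 * Suc N) = qfact q (2 * N) * ((1 - q ^ (2 * N + 1)) * (1 - q ^ (2 * N + 2)))"
      by (simp add: qfact_def)
    moreover have "q ^ (2 * N + 1) = A * B / q" using q(1) unfolding AB by simp
    ultimately have c'j: "c' j = G * ((1 - A * B / q) * (1 - A * B))"
      unfolding c'_def G_def a_def [symmetric] b_def [symmetric] AB [symmetric] by simp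
    have u2: "u\<^sup>2 = A * B / q"
    proof -
      have "A * B / q = q ^ (2 * N + 1)" using q(1) unfolding AB by simp
      then show ?thesis by (simp only: u_def q_def power_mult [symmetric] mult.commute)
    qed
    have e1: "u * x * (p powi ((j - 1) * (j - 1)) * x powi (j - 1)) = A * (p powi (j * j) * x powi j)"
    proof -
      have "x * x powi (j - 1) = x powi j" using x by (simp add: power_int_diff)
      moreover have "u * p powi ((j - 1) * (j - 1)) = A * p powi (j * j)"
      proof -
        have "A = p powi (2 * a)" unfolding A_def q_def using p(1) by (simp add: power_int_mult)
        moreover have "u = p powi (int (2 * N + 1))" unfolding u_def by (simp only: power_int_of_nat)
        ultimately have "u * p powi ((j - 1) * (j - 1)) = p powi (int (2 * N + 1) + (j - 1) * (j - 1))"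
          "A * p powi (j * j) = p powi (2 * a + j * j)" using p(1) by (simp_all add: power_int_add)
        moreover have "int (2 * N + 1) + (j - 1) * (j - 1) = 2 * a + j * j" by (simp add: a_def algebra_simps)
        ultimately show ?thesis by simp
      qed
      ultimately show ?thesis by (metis (no_types, lifting) mult.assoc mult.left_commute)
    qed
    have e2: "u / x * (p powi ((j + 1) * (j + 1)) * x powi (j + 1)) = B * (p powi (j * j) * x powi j)"
    proof -
      have "x powi (j + 1) / x = x powi j" using x by (simp add: power_int_add)
      moreover have "u * p powi ((j + 1) * (j + 1)) = B * p powi (j * j)"
      proof -
        have "B = p powi (2 * b)" unfolding B_def q_def using p(1) by (simp add: power_int_mult)
        moreover have "u = p powi (int (2 * N + 1))" unfolding u_def by (simp only: power_int_of_nat)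
        ultimately have "u * p powi ((j + 1) * (j + 1)) = p powi (int (2 * N + 1) + (j + 1) * (j + 1))"
          "B * p powi (j * j) = p powi (2 * b + j * j)" using p(1) by (simp_all add: power_int_add)
        moreover have "int (2 * N + 1) + (j + 1) * (j + 1) = 2 * b + j * j" by (simp add: b_def algebra_simps)
        ultimately show ?thesis by simp
      qed
      moreover have "u / x * (p powi ((j + 1) * (j + 1)) * x powi (j + 1)) = (u * p powi ((j + 1) * (j + 1))) * (x powi (j + 1) / x)"
        by simp
      ultimately show ?thesis by (simp only: mult.assoc)
    qed
    have "(1 + u\<^sup>2) * g j + u * x * g (j + - 1) + u / x * g (j + 1) =
       (1 + u\<^sup>2) * c j * (p powi (j * j) * x powi j) + c (j - 1) * (u * x * (p powi ((j - 1) * (j - 1)) * x powi (j - 1))) +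
       c (j + 1) * (u / x * (p powi ((j + 1) * (j + 1)) * x powi (j + 1)))"
      by (simp add: g_def)
    also have "\<dots> = ((1 + u\<^sup>2) * c j + c (j - 1) * A + c (j + 1) * B) * (p powi (j * j) * x powi j)"
      unfolding e1 e2 by (simp add: distrib_right)
    also have "(1 + u\<^sup>2) * c j + c (j - 1) * A + c (j + 1) * B = c' j"
      unfolding cj cm cp c'j u2 using q(1) by (simp add: field_simps)
    finally show ?thesis .
  qed
  ultimately show ?case by (simp add: c'_def q_def P_def u_def)
qed

lemma qfact_limit:
  fixes q :: complex
  assumes "norm q < 1"
  shows "qfact q \<longlonglongrightarrow> (\<Prod>n. 1 - q ^ Suc n)" and "(\<Prod>n. 1 - q ^ Suc n) \<noteq> 0"
    and "q ^ Suc n \<noteq> 1" and "qfact q n \<noteq> 0"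
proof -
  have ne: "q ^ Suc n \<noteq> 1" for n
  proof
    assume "q ^ Suc n = 1"
    then have "norm q ^ Suc n = 1" by (metis norm_one norm_power)
    moreover have "norm q ^ Suc n < 1" using power_strict_mono [of "norm q" 1 "Suc n"] assms by simp
    ultimately show False by simp
  qed
  show "q ^ Suc n \<noteq> 1" by (rule ne)
  show "qfact q n \<noteq> 0" using ne by (simp add: qfact_def prod_zero_iff) 
  have "summable (\<lambda>n. norm q * norm q ^ n)"
    using assms by (intro summable_mult summable_geometric) auto
  then have "summable (\<lambda>n. norm ((1 - q ^ Suc n) - 1))" by (simp add: norm_mult norm_power)
  then have cp: "convergent_prod (\<lambda>n. 1 - q ^ Suc n)"
    by (intro abs_convergent_prod_imp_convergent_prod summable_imp_abs_convergent_prod)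
  then have "(\<lambda>n. 1 - q ^ Suc n) has_prod (\<Prod>n. 1 - q ^ Suc n)" by (rule convergent_prod_has_prod)
  then have "(\<lambda>N. \<Prod>n<N. 1 - q ^ Suc n) \<longlonglongrightarrow> (\<Prod>n. 1 - q ^ Suc n)" by (rule has_prod_imp_tendsto')
  then show "qfact q \<longlonglongrightarrow> (\<Prod>n. 1 - q ^ Suc n)" by (simp add: qfact_def [abs_def])
  show "(\<Prod>n. 1 - q ^ Suc n) \<noteq> 0" by (rule prodinf_nonzero [OF cp]) (use ne in auto)
qed

text \<open>Each coefficient of the finite identity tends to Q * (1/Q) * (1/Q) = 1/Q, and all of
  them are bounded by a common constant, so the limit may be taken inside the sum. The product is
  kept as a limit so that several such products can be multiplied before passing to it.\<close>

lemma jacobi_triple_product_limit: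
  fixes p x :: complex
  assumes p: "p \<noteq> 0" "norm p < 1" and x: "x \<noteq> 0"
    and sm: "(\<lambda>j::int. norm (p powi (j * j) * x powi j)) summable_on UNIV"
  shows "(\<lambda>N. \<Prod>k<N. (1 + p ^ (2 * k + 1) * x) * (1 + p ^ (2 * k + 1) / x)) \<longlonglongrightarrow>
     (\<Sum>\<^sub>\<infinity>j::int. p powi (j * j) * x powi j) / (\<Prod>n. 1 - (p\<^sup>2) ^ Suc n)"
proof -
  define q where "q = p\<^sup>2"
  have q: "norm q < 1" using p power_strict_mono [of "norm p" 1 2] by (simp add: q_def norm_power)
  define Q where "Q = (\<Prod>n. 1 - q ^ Suc n)"
  note Q = qfact_limit [OF q, folded Q_def]
  have lim_inv: "(\<lambda>n. 1 / qfact q n) \<longlonglongrightarrow> 1 / Q" by (intro tendsto_intros Q)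
  obtain C1 where C1: "C1 > 0" "\<And>n. norm (qfact q n) \<le> C1"
    using convergent_imp_Bseq [OF convergentI [OF Q(1)]] unfolding Bseq_def by blast
  obtain C2 where C2: "C2 > 0" "\<And>n. norm (1 / qfact q n) \<le> C2"
    using convergent_imp_Bseq [OF convergentI [OF lim_inv]] unfolding Bseq_def by blast
  have C2': "norm (inv_qfact q m) \<le> C2" for m using C2 by (simp add: inv_qfact_def)
  have ne: "p ^ (2 * Suc n) \<noteq> 1" for n using Q(3) [of n] unfolding q_def power_mult [symmetric] .
  have lim_inv1: "(\<lambda>N. inv_qfact q (int N + j)) \<longlonglongrightarrow> 1 / Q" for j
  proof (rule Lim_transform_eventually)
    have "filterlim (\<lambda>N. nat (int N + j)) sequentially sequentially"
      unfolding filterlim_at_top eventually_sequentially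
    proof
      show "\<exists>N. \<forall>n\<ge>N. Z \<le> nat (int n + j)" for Z
        by (rule exI [of _ "nat (int Z - j)"]) auto
    qed
    from filterlim_compose [OF lim_inv this] show "(\<lambda>N. 1 / qfact q (nat (int N + j))) \<longlonglongrightarrow> 1 / Q" .
    show "\<forall>\<^sub>F N in sequentially. 1 / qfact q (nat (int N + j)) = inv_qfact q (int N + j)"
      unfolding eventually_sequentially by (rule exI [of _ "nat (- j)"]) (auto simp: inv_qfact_def)
  qed
  have lim2: "(\<lambda>N. qfact q (2 * N)) \<longlonglongrightarrow> Q"
    by (rule filterlim_compose [OF Q(1) filterlim_subseq]) (auto simp: strict_mono_def)
  define f where "f = (\<lambda>N j. qfact q (2 * N) * (inv_qfact q (int N - j) * inv_qfact q (int N + j)) * (p powi (j * j) * x powi j))"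
  have "(\<lambda>N. \<Sum>\<^sub>\<infinity>j. f N j) \<longlonglongrightarrow> (\<Sum>\<^sub>\<infinity>j. 1 / Q * (p powi (j * j) * x powi j))"
  proof (rule infsum_dominated_convergence)
    fix j
    have "(\<lambda>N. f N j) \<longlonglongrightarrow> Q * (1 / Q * (1 / Q)) * (p powi (j * j) * x powi j)"
      unfolding f_def using lim_inv1 [of "- j"] by (intro tendsto_intros lim2 lim_inv1) simp
    then show "(\<lambda>N. f N j) \<longlonglongrightarrow> 1 / Q * (p powi (j * j) * x powi j)" using Q(2) by simp
    show "norm (f N j) \<le> C1 * (C2 * C2) * norm (p powi (j * j) * x powi j)" for N
      unfolding f_def norm_mult [of "_ * _" "p powi (j * j) * x powi j"] norm_mult [of "qfact q (2 * N)"] norm_mult [of "inv_qfact q _"]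
      using C1 C2 C2' by (intro mult_right_mono mult_mono) (auto intro: less_imp_le)
  next
    show "(\<lambda>j. C1 * (C2 * C2) * norm (p powi (j * j) * x powi j)) summable_on UNIV"
      by (intro summable_on_cmult_right sm)
  qed
  moreover have "(\<Sum>\<^sub>\<infinity>j. f N j) = (\<Prod>k<N. (1 + p ^ (2 * k + 1) * x) * (1 + p ^ (2 * k + 1) / x))" for N
    unfolding f_def q_def by (rule infsumI [OF finite_triple_product [OF p(1) ne x]])
  ultimately show ?thesis unfolding infsum_cmult_right' by (simp add: Q_def q_def)
qed

section \<open>The denominators and the main theorem\<close>

lemma ee_power_int: "ee x powi n = ee (of_int n * x)"
  by (simp add: ee_def exp_power_int mult_ac)

lemma theta_triple_product:
  assumes y: "Im \<tau> > 0"
  shows "(\<lambda>N. \<Prod>k<N. (1 + ee (\<tau> / 2) ^ (2 * k + 1) * ee u) * (1 + ee (\<tau> / 2) ^ (2 * k + 1) / ee u)) \<longlonglongrightarrow>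
     theta_char 0 0 \<tau> u / (\<Prod>n. 1 - ee \<tau> ^ Suc n)"
proof -
  define p where "p = ee (\<tau> / 2)"
  have p: "p \<noteq> 0" "norm p < 1" using y by (simp_all add: p_def norm_ee)
  have q: "p\<^sup>2 = ee \<tau>" by (simp add: p_def ee_power)
  have trm: "p powi (j * j) * ee u powi j = ee (of_int j ^ 2 / 2 * \<tau> + of_int j * u)" for j :: int
    unfolding p_def ee_power_int ee_add [symmetric]
    by (rule arg_cong [where f = ee]) (simp add: power2_eq_square)
  have "(\<lambda>j::int. norm (p powi (j * j) * ee u powi j)) summable_on UNIV"
    unfolding trm
    by (rule summable_on_comparison_test [OF summable_exp_neg_abs_int_cmult norm_theta_term_le [OF y order_refl order_refl]]) simp
  from jacobi_triple_product_limit [OF p ee_nonzero this] show ?thesis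
    unfolding trm q unfolding p_def by (simp add: theta_char_def)
qed

text \<open>On the level of partial products, \<open>E\<close> and \<open>F\<close> belong to the
  characteristics (0, 0) and (0, 1/2), and \<open>G\<close>, \<open>H\<close> to (1/2, 0). There
  p^(2 k + 1) / p = q^k makes \<open>H\<close> start with 1 + q^0, the source of the factor 2.
  Everything else cancels by the finite form of Euler's identity, E F G (q; q)_N = (q; q)_(2
  N).\<close>

lemma theta_null_product:
  assumes y: "Im \<tau> > 0"
  shows "theta_char 0 0 \<tau> 0 * theta_char 0 (1 / 2) \<tau> 0 * theta_char (1 / 2) 0 \<tau> 0 = 2 * dedekind_eta \<tau> ^ 3"
proof -
  define p q where "p = ee (\<tau> / 2)" and "q = ee \<tau>"
  define Q where "Q = (\<Prod>n. 1 - q ^ Suc n)"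
  have pq: "p\<^sup>2 = q" by (simp add: p_def q_def ee_power)
  have q: "norm q < 1" using y by (simp add: q_def norm_ee)
  note Q = qfact_limit [OF q, folded Q_def]
  define E F G H where "E = (\<lambda>N. \<Prod>k<N. 1 + p ^ (2 * k + 1))" and "F = (\<lambda>N. \<Prod>k<N. 1 - p ^ (2 * k + 1))"
    and "G = (\<lambda>N. \<Prod>k<N. 1 + q ^ Suc k)" and "H = (\<lambda>N. \<Prod>k<N. 1 + q ^ k)"
  have l1: "(\<lambda>N. E N * E N) \<longlonglongrightarrow> theta_char 0 0 \<tau> 0 / Q"
    using theta_triple_product [OF y, of 0] by (simp add: E_def p_def Q_def q_def prod.distrib)
  have l2: "(\<lambda>N. F N * F N) \<longlonglongrightarrow> theta_char 0 0 \<tau> (1 / 2) / Q"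
    using theta_triple_product [OF y, of "1 / 2"] by (simp add: F_def p_def Q_def q_def prod.distrib ee_half)
  have l3: "(\<lambda>N. G N * H N) \<longlonglongrightarrow> theta_char 0 0 \<tau> (\<tau> / 2) / Q"
  proof -
    have "(1 + p ^ (2 * k + 1) * p) * (1 + p ^ (2 * k + 1) / p) = (1 + q ^ Suc k) * (1 + q ^ k)" for k
    proof -
      have "p ^ (2 * k + 1) * p = q ^ Suc k" "p ^ (2 * k + 1) / p = q ^ k"
        unfolding pq [symmetric] power_mult [symmetric] by (simp_all add: p_def)
      then show ?thesis by simp
    qed
    then show ?thesis
      using theta_triple_product [OF y, of "\<tau> / 2"] by (simp add: G_def H_def Q_def q_def p_def prod.distrib)
  qed
  have EFG: "E N * F N * G N * qfact q N = qfact q (2 * N)" for N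
  proof (induction N)
    case 0
    show ?case by (simp add: E_def F_def G_def qfact_def)
  next
    case (Suc N)
    have "(1 + p ^ (2 * N + 1)) * (1 - p ^ (2 * N + 1)) = 1 - q ^ (2 * N + 1)"
    proof -
      have "(1 + p ^ (2 * N + 1)) * (1 - p ^ (2 * N + 1)) = 1 - (p ^ (2 * N + 1))\<^sup>2"
        by (simp add: algebra_simps power2_eq_square)
      also have "(p ^ (2 * N + 1))\<^sup>2 = q ^ (2 * N + 1)"
        unfolding pq [symmetric] by (simp only: power_mult [symmetric] mult.commute)
      finally show ?thesis .
    qed
    moreover have "(1 + q ^ Suc N) * (1 - q ^ Suc N) = 1 - q ^ (2 * N + 2)"
      by (simp add: algebra_simps flip: power_add mult_2)
    moreover have "E (Suc N) * F (Suc N) * G (Suc N) * qfact q (Suc N) = (E N * F N * G N * qfact q N) *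
       (((1 + p ^ (2 * N + 1)) * (1 - p ^ (2 * N + 1))) * ((1 + q ^ Suc N) * (1 - q ^ Suc N)))"
      by (simp only: E_def F_def G_def qfact_def prod.lessThan_Suc mult_ac)
    ultimately show ?case unfolding Suc.IH by (simp add: qfact_def)
  qed
  have GH: "H N * (1 + q ^ N) = 2 * G N" for N
  proof -
    have "H N * (1 + q ^ N) = (\<Prod>k<Suc N. 1 + q ^ k)" by (simp add: H_def)
    also have "\<dots> = 2 * G N" unfolding prod.lessThan_Suc_shift by (simp add: G_def)
    finally show ?thesis .
  qed
  have eq: "(E N * E N) * (F N * F N) * (G N * H N) * (1 + q ^ N) * (qfact q N * qfact q N) = 2 * (qfact q (2 * N) * qfact q (2 * N))" for N
  proof -
    have "(E N * E N) * (F N * F N) * (G N * H N) * (1 + q ^ N) * (qfact q N * qfact q N) =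
      (E N * E N) * (F N * F N) * (G N * (H N * (1 + q ^ N))) * (qfact q N * qfact q N)" by (simp only: mult.assoc)
    also have "\<dots> = 2 * ((E N * F N * G N * qfact q N) * (E N * F N * G N * qfact q N))"
      unfolding GH by (simp only: mult_ac)
    finally show ?thesis unfolding EFG .
  qed
  have "(\<lambda>N. (E N * E N) * (F N * F N) * (G N * H N) * (1 + q ^ N) * (qfact q N * qfact q N)) \<longlonglongrightarrow>
     theta_char 0 0 \<tau> 0 / Q * (theta_char 0 0 \<tau> (1 / 2) / Q) * (theta_char 0 0 \<tau> (\<tau> / 2) / Q) * (1 + 0) * (Q * Q)"
    by (intro tendsto_mult tendsto_add tendsto_const l1 l2 l3 Q(1) LIMSEQ_power_zero q)
  moreover have "(\<lambda>N. 2 * (qfact q (2 * N) * qfact q (2 * N))) \<longlonglongrightarrow> 2 * (Q * Q)"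
  proof -
    have "(\<lambda>N. qfact q (2 * N)) \<longlonglongrightarrow> Q"
      by (rule filterlim_compose [OF Q(1) filterlim_subseq]) (auto simp: strict_mono_def)
    then show ?thesis by (intro tendsto_intros)
  qed
  ultimately have "theta_char 0 0 \<tau> 0 / Q * (theta_char 0 0 \<tau> (1 / 2) / Q) * (theta_char 0 0 \<tau> (\<tau> / 2) / Q) * (1 + 0) * (Q * Q) = 2 * (Q * Q)"
    unfolding eq by (rule LIMSEQ_unique)
  then have "theta_char 0 0 \<tau> 0 * theta_char 0 0 \<tau> (1 / 2) * theta_char 0 0 \<tau> (\<tau> / 2) = 2 * Q ^ 3"
    using Q(2) by (simp add: field_simps power3_eq_cube)
  moreover have "theta_char 0 (1 / 2) \<tau> 0 = theta_char 0 0 \<tau> (1 / 2)"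
    by (subst theta_char_eq) simp
  moreover have "theta_char (1 / 2) 0 \<tau> 0 = ee (\<tau> / 8) * theta_char 0 0 \<tau> (\<tau> / 2)"
    by (subst theta_char_eq) (simp add: power2_eq_square)
  moreover have "dedekind_eta \<tau> ^ 3 = ee (\<tau> / 8) * Q ^ 3"
  proof -
    have "dedekind_eta \<tau> = ee (\<tau> / 24) * Q"
      unfolding dedekind_eta_def Q_def q_def ee_power ..
    then show ?thesis by (simp add: power_mult_distrib ee_power)
  qed
  ultimately show ?thesis by (simp only: mult_ac)
qed

lemma Im_minus_inverse_pos: "Im \<tau> > 0 \<Longrightarrow> Im (- 1 / \<tau>) > 0"
  unfolding Im_minus_inverse by (auto intro!: divide_pos_pos)

text \<open>S fixes one of the three theta nulls and exchanges the other two. Each acquires csqrt(-i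
  \<tau>) and no further phase, since the product a b of its characteristics is 0.\<close>

lemma dedekind_eta_cubed_S:
  assumes y: "Im \<tau> > 0"
  shows "dedekind_eta (- 1 / \<tau>) ^ 3 = csqrt (- \<i> * \<tau>) ^ 3 * dedekind_eta \<tau> ^ 3"
proof -
  have t: "theta_char a b (- 1 / \<tau>) 0 = csqrt (- \<i> * \<tau>) * ee (of_real (a * b)) * theta_char b (- a) \<tau> 0" for a b
    using theta_char_S [OF y, of a b 0] by simp
  have "theta_char 0 (- (1 / 2)) \<tau> 0 = theta_char 0 (1 / 2) \<tau> 0"
    using theta_char_add_1_right [of 0 "- (1 / 2)" \<tau> 0] by simp
  then have "2 * dedekind_eta (- 1 / \<tau>) ^ 3 = csqrt (- \<i> * \<tau>) ^ 3 * (2 * dedekind_eta \<tau> ^ 3)"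
    unfolding theta_null_product [OF Im_minus_inverse_pos [OF y], symmetric] theta_null_product [OF y, symmetric] t
    by (simp add: power3_eq_cube)
  then show ?thesis by simp
qed

lemma dedekind_eta_cubed_T: "dedekind_eta (\<tau> + 1) ^ 3 = ee (1 / 8) * dedekind_eta \<tau> ^ 3"
proof -
  have 1: "ee (of_nat (Suc n) * (\<tau> + 1)) = ee (of_nat (Suc n) * \<tau>)" for n
  proof -
    have "of_nat (Suc n) * (\<tau> + 1) = of_nat (Suc n) * \<tau> + of_int (int (Suc n))" by (simp add: algebra_simps)
    then show ?thesis by (simp only: ee_add ee_of_int mult_1_right)
  qed
  have 2: "ee ((\<tau> + 1) / 24) ^ 3 = ee (1 / 8) * ee (\<tau> / 24) ^ 3"
    unfolding ee_power ee_add [symmetric] by (rule arg_cong [where f = ee]) (simp add: field_simps)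
  show ?thesis unfolding dedekind_eta_def 1 power_mult_distrib 2 by simp
qed

text \<open>A phase arises only for a = b = 1: ee(1/4) = i from the product of the characteristics,
  and -1 from bringing the characteristic -1/2 back to 1/2.\<close>

lemma vartheta_S:
  assumes y: "Im \<tau> > 0" and ab: "a = 0 \<or> a = 1" "b = 0 \<or> b = 1"
  shows "vartheta a b (- 1 / \<tau>) (z / \<tau>) =
    csqrt (- \<i> * \<tau>) * ee (z\<^sup>2 / (2 * \<tau>)) * (if a = 1 \<and> b = 1 then - \<i> else 1) * vartheta b a \<tau> z"
proof -
  have neg: "theta_char (b / 2) (1 / 2) \<tau> z = ee (of_real (b / 2)) * theta_char (b / 2) (- (1 / 2)) \<tau> z"
    using theta_char_add_1_right [of "b / 2" "- (1 / 2)" \<tau> z] by simp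
  note th = vartheta_eq_theta_char [OF Im_minus_inverse_pos [OF y] ab] vartheta_eq_theta_char [OF y ab(2,1)]
    theta_char_S [OF y]
  consider "a = 0" | "a = 1" "b = 0" | "a = 1" "b = 1" using ab by blast
  then show ?thesis
  proof cases
    case 1
    then show ?thesis unfolding th by simp
  next
    case 2
    then show ?thesis unfolding th using neg by simp
  next
    case 3
    have "theta_char (1 / 2) (- (1 / 2)) \<tau> z = - theta_char (1 / 2) (1 / 2) \<tau> z"
      using neg 3 by (simp add: ee_half)
    then show ?thesis unfolding th using 3 by (simp add: ee_quarter)
  qed
qed

lemma vartheta_T:
  assumes y: "Im \<tau> > 0" and b: "b = 0 \<or> b = 1"
  shows "vartheta 1 b (\<tau> + 1) z = ee (1 / 8) * vartheta 1 b \<tau> z"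
    and "vartheta 0 b (\<tau> + 1) z = vartheta 0 (1 - b) \<tau> z"
proof -
  have y': "Im (\<tau> + 1) > 0" using y by simp
  have "ee (of_real (- ((1 / 2)\<^sup>2 + 1 / 2) / 2)) * ee (of_real (1 / 2)) = ee (1 / 8)"
    unfolding ee_add [symmetric] by (rule arg_cong [where f = ee]) (simp add: power2_eq_square)
  then show "vartheta 1 b (\<tau> + 1) z = ee (1 / 8) * vartheta 1 b \<tau> z"
    using theta_char_T [of "1 / 2" "b / 2" \<tau> z] theta_char_add_1_right [of "1 / 2" "b / 2" \<tau> z] b
    by (simp add: vartheta_eq_theta_char [OF y'] vartheta_eq_theta_char [OF y] mult.assoc [symmetric] add.assoc del: of_real_divide)
  show "vartheta 0 b (\<tau> + 1) z = vartheta 0 (1 - b) \<tau> z"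
    using theta_char_T [of 0 "b / 2" \<tau> z] theta_char_add_1_right [of 0 0 \<tau> z] b
    by (auto simp: vartheta_eq_theta_char [OF y'] vartheta_eq_theta_char [OF y])
qed

text \<open>Count powers of s = csqrt(-i \<tau>): three from the eta cube, one from the odd theta
  function, two in the denominator. This leaves s^2, and -i s^2 = -\<tau>. The phase
  \<open>u\<close> of the denominator squares to -1 exactly when \<epsilon> = \<epsilon>' = 0, which
  is the sign in the statement, and of the exponentials X^4 / X^2 = X^2 remains.\<close>

lemma denom_R_S:
  assumes y: "Im \<tau> > 0" and e: "\<epsilon> = 0 \<or> \<epsilon> = 1 / 2" "\<epsilon>' = 0 \<or> \<epsilon>' = 1 / 2"
  shows "denom_R \<epsilon> \<epsilon>' (- 1 / \<tau>) (z / \<tau>) =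
    - ((- 1) powr of_real ((1 - 2 * \<epsilon>) * (1 - 2 * \<epsilon>'))) * \<tau> * ee (z\<^sup>2 / \<tau>) * denom_R \<epsilon>' \<epsilon> \<tau> z"
proof -
  define s where "s = csqrt (- \<i> * \<tau>)"
  define u where "u = (if 1 - 2 * \<epsilon>' = 1 \<and> 1 - 2 * \<epsilon> = 1 then - \<i> else 1)"
  define X where "X = ee (z\<^sup>2 / (2 * \<tau>))"
  define V where "V = vartheta (1 - 2 * \<epsilon>) (1 - 2 * \<epsilon>') \<tau> z"
  define N where "N = dedekind_eta \<tau> ^ 3 * vartheta 1 1 \<tau> (2 * z)"
  have ab: "1 - 2 * \<epsilon>' = 0 \<or> 1 - 2 * \<epsilon>' = 1" "1 - 2 * \<epsilon> = 0 \<or> 1 - 2 * \<epsilon> = 1" using e by auto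
  have \<tau>: "\<tau> \<noteq> 0" using y by auto
  have s2: "s * s = - \<i> * \<tau>" unfolding s_def by (rule csqrt_square)
  have s0: "s \<noteq> 0" using s2 \<tau> by auto
  have X4: "ee ((2 * z)\<^sup>2 / (2 * \<tau>)) = X ^ 4"
    unfolding X_def ee_power by (rule arg_cong [where f = ee]) (simp add: power2_eq_square)
  have X2: "ee (z\<^sup>2 / \<tau>) = X\<^sup>2" unfolding X_def ee_power by (rule arg_cong [where f = ee]) simp
  have X0: "X \<noteq> 0" by (simp add: X_def)
  have v11: "vartheta 1 1 (- 1 / \<tau>) (2 * (z / \<tau>)) = s * X ^ 4 * (- \<i>) * vartheta 1 1 \<tau> (2 * z)"
    using vartheta_S [OF y, of 1 1 "2 * z"] unfolding X4 s_def by simp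
  have "denom_R \<epsilon> \<epsilon>' (- 1 / \<tau>) (z / \<tau>) = (s ^ 3 * dedekind_eta \<tau> ^ 3 * (s * X ^ 4 * (- \<i>) * vartheta 1 1 \<tau> (2 * z))) / (s * X * u * V)\<^sup>2"
    unfolding denom_R_def v11 dedekind_eta_cubed_S [OF y] vartheta_S [OF y ab] V_def s_def X_def u_def ..
  \<comment> \<open>For \<open>V = 0\<close> both sides are 0 by the convention for
    division.\<close>
  also have "\<dots> = (s * s) * (- \<i>) / u\<^sup>2 * X\<^sup>2 * (N / V\<^sup>2)"
    using s0 X0 by (cases "V = 0") (auto simp: N_def u_def field_simps power2_eq_square power3_eq_cube eval_nat_numeral)
  also have "(s * s) * (- \<i>) / u\<^sup>2 = - ((- 1) powr of_real ((1 - 2 * \<epsilon>) * (1 - 2 * \<epsilon>'))) * \<tau>"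
  proof -
    have "s * s * (- \<i>) = - \<tau>" unfolding s2 by (simp add: complex_eq_iff)
    then show ?thesis unfolding u_def using e by (elim disjE; (simp only:); simp)
  qed
  also have "N / V\<^sup>2 = denom_R \<epsilon>' \<epsilon> \<tau> z" by (simp add: denom_R_def N_def V_def)
  finally show ?thesis unfolding X2 .
qed

text \<open>The numerator acquires ee(1/8)^2 = i. For \<epsilon>' = 0 the squared theta function in
  the denominator acquires the same factor; for \<epsilon>' = 1/2 T exchanges the two theta
  functions with a = 0 without a factor, and i = exp(pi i / 2) remains.\<close>

lemma denom_R_T:
  assumes y: "Im \<tau> > 0" and e: "\<epsilon> = 0 \<or> \<epsilon> = 1 / 2" "\<epsilon>' = 0 \<or> \<epsilon>' = 1 / 2"
  shows "denom_R \<epsilon> \<epsilon>' (\<tau> + 1) z = exp (of_real pi * \<i> * of_real \<epsilon>') * denom_R \<bar>\<epsilon> - \<epsilon>'\<bar> \<epsilon>' \<tau> z"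
proof -
  have q: "ee (1 / 8) * ee (1 / 8) = \<i>" by (simp add: ee_quarter flip: ee_add)
  have N: "dedekind_eta (\<tau> + 1) ^ 3 * vartheta 1 1 (\<tau> + 1) (2 * z) = \<i> * (dedekind_eta \<tau> ^ 3 * vartheta 1 1 \<tau> (2 * z))"
    unfolding dedekind_eta_cubed_T q [symmetric] using vartheta_T(1) [OF y, of 1 "2 * z"] by simp
  show ?thesis
  proof (cases "\<epsilon>' = 0")
    case True
    have "(vartheta 1 (1 - 2 * \<epsilon>) (\<tau> + 1) z)\<^sup>2 = \<i> * (vartheta 1 (1 - 2 * \<epsilon>) \<tau> z)\<^sup>2"
      using vartheta_T(1) [OF y, of "1 - 2 * \<epsilon>" z] e by (auto simp: power2_eq_square q [symmetric])
    moreover have "\<bar>\<epsilon>\<bar> = \<epsilon>" using e by auto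
    ultimately show ?thesis using True unfolding denom_R_def N by simp
  next
    case False
    then have e': "\<epsilon>' = 1 / 2" using e by simp
    have "1 - 2 * \<bar>\<epsilon> - 1 / 2\<bar> = 1 - (1 - 2 * \<epsilon>)" "1 - 2 * \<epsilon> = 0 \<or> 1 - 2 * \<epsilon> = 1"
      using e(1) by (elim disjE; (simp only:); simp)+
    then have "vartheta 0 (1 - 2 * \<epsilon>) (\<tau> + 1) z = vartheta 0 (1 - 2 * \<bar>\<epsilon> - 1 / 2\<bar>) \<tau> z"
      using vartheta_T(2) [OF y, of "1 - 2 * \<epsilon>" z] by (simp only:)
    moreover have "exp (of_real pi * \<i> * of_real (1 / 2)) = \<i>"
      using cis_pi_half by (simp add: cis_conv_exp mult.commute)
    ultimately show ?thesis unfolding denom_R_def N unfolding e' by simp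
  qed
qed

section \<open>Transformation of the numerators\<close>

text \<open>The second lattice sum in \<open>Psi_tilde_eq_lat_sum\<close> has parameters (-k, -j,
  -\<epsilon>), so its inversion runs over reflected and swapped representatives.\<close>

lemma coset_representatives_neg_swap:
  assumes "coset_representatives M \<epsilon> S"
  shows "coset_representatives M (- \<epsilon>) ((\<lambda>(a, b). (- b, - a)) ` S)"
proof -
  have neg: "- x \<in> int_shift \<epsilon>" if "x \<in> int_shift (- \<epsilon>)" for x \<epsilon>
  proof -
    from that obtain n :: int where "x = - \<epsilon> + of_int n" by (auto simp: int_shift_def)
    then have "- x = \<epsilon> + of_int (- n)" by simp
    then show ?thesis unfolding int_shift_def by blast
  qed
  have neg': "- x \<in> int_shift (- \<epsilon>)" if "x \<in> int_shift \<epsilon>" for x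
    using neg [of x "- \<epsilon>"] that by simp
  have diff: "(- x - y) / of_nat M \<in> \<int> \<longleftrightarrow> (x - - y) / of_nat M \<in> \<int>" for x y :: real
  proof -
    have "(- x - y) / of_nat M = - ((x - - y) / of_nat M)" by (simp add: minus_divide_left)
    then show ?thesis by (simp only: minus_in_Ints_iff)
  qed
  have "\<exists>!p. p \<in> (\<lambda>(a, b). (- b, - a)) ` S \<and> (x - fst p) / of_nat M \<in> \<int> \<and> (y - snd p) / of_nat M \<in> \<int>"
    if "x \<in> int_shift (- \<epsilon>)" "y \<in> int_shift (- \<epsilon>)" for x y
  proof -
    have "(- y, - x) \<in> int_shift \<epsilon> \<times> int_shift \<epsilon>" using neg that by simp
    with assms have "\<exists>!p. p \<in> S \<and> (- y - fst p) / of_nat M \<in> \<int> \<and> (- x - snd p) / of_nat M \<in> \<int>"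
      unfolding coset_representatives_def by blast
    then obtain p where p: "p \<in> S" "(- y - fst p) / of_nat M \<in> \<int>" "(- x - snd p) / of_nat M \<in> \<int>"
      and uniq: "\<And>r. r \<in> S \<Longrightarrow> (- y - fst r) / of_nat M \<in> \<int> \<Longrightarrow> (- x - snd r) / of_nat M \<in> \<int> \<Longrightarrow> r = p"
      by blast
    show ?thesis
    proof (rule ex1I [of _ "(- snd p, - fst p)"])
      show "(- snd p, - fst p) \<in> (\<lambda>(a, b). (- b, - a)) ` S \<and> (x - fst (- snd p, - fst p)) / of_nat M \<in> \<int> \<and>
          (y - snd (- snd p, - fst p)) / of_nat M \<in> \<int>"
        using p unfolding diff by (auto simp: image_iff case_prod_unfold)
    next
      fix r assume r: "r \<in> (\<lambda>(a, b). (- b, - a)) ` S \<and> (x - fst r) / of_nat M \<in> \<int> \<and> (y - snd r) / of_nat M \<in> \<int>"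
      then obtain t where t: "t \<in> S" "r = (- snd t, - fst t)" by auto
      have "t = p" by (rule uniq) (use r t in \<open>simp_all only: diff fst_conv snd_conv\<close>)
      then show "r = (- snd p, - fst p)" using t by simp
    qed
  qed
  moreover have "(\<lambda>(a, b). (- b, - a)) ` S \<subseteq> int_shift (- \<epsilon>) \<times> int_shift (- \<epsilon>)"
  proof -
    have "S \<subseteq> int_shift \<epsilon> \<times> int_shift \<epsilon>" using assms unfolding coset_representatives_def by blast
    then show ?thesis using neg' by auto
  qed
  ultimately show ?thesis unfolding coset_representatives_def by auto
qed

text \<open>Both lattice sums invert with the same index factor, since (-z2)(-z1) = z1 z2, and with
  the same characters once the reflected representatives are relabelled by (a, b) -> (-b, -a). They
  therefore recombine into \<open>Psi_tilde\<close> with \<epsilon>' in place of \<epsilon>.\<close>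

lemma Psi_tilde_S:
  assumes M: "M > 0" and m: "m < 0" and co: "coprime m (int M)" and y: "Im \<tau> > 0"
    and \<epsilon>: "2 * \<epsilon> \<in> \<int>" and \<epsilon>': "2 * \<epsilon>' \<in> \<int>" and j: "j - \<epsilon>' \<in> \<int>" and k: "k - \<epsilon>' \<in> \<int>"
    and reg: "regular_point \<tau> z1" "regular_point \<tau> z2" and S: "coset_representatives M \<epsilon> S"
  shows "Psi_tilde M m \<epsilon> j k (- 1 / \<tau>) (z1 / \<tau>) (z2 / \<tau>) =
    \<tau> / of_nat M * ee (- (of_int m / of_nat M) / \<tau> * z1 * z2) *
    (\<Sum>p\<in>S. ee (of_real (real_of_int m / real M * (fst p * k + snd p * j))) * Psi_tilde M m \<epsilon>' (fst p) (snd p) \<tau> z1 z2)"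
proof -
  define l where "l = nat (- m)"
  have l: "l > 0" "int l = - m" using m by (auto simp: l_def)
  have lm: "- (real l / real M) = real_of_int m / real M"
  proof -
    have "real l = - real_of_int m" using l(2) by (metis of_int_minus of_int_of_nat_eq)
    then show ?thesis by simp
  qed
  have co': "coprime l M"
    using co l(2) by (metis coprime_int_iff coprime_minus_left_iff)
  have \<tau>: "\<tau> \<noteq> 0" using y by auto
  have j2: "2 * j \<in> \<int>" "2 * k \<in> \<int>"
  proof -
    have "2 * j = (j - \<epsilon>') + (j - \<epsilon>') + 2 * \<epsilon>'" "2 * k = (k - \<epsilon>') + (k - \<epsilon>') + 2 * \<epsilon>'" by simp_all
    then show "2 * j \<in> \<int>" "2 * k \<in> \<int>" using j k \<epsilon>' by (metis Ints_add)+
  qed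
  have neg: "2 * - \<epsilon> \<in> \<int>" "2 * - \<epsilon>' \<in> \<int>" "- k - - \<epsilon>' \<in> \<int>" "- j - - \<epsilon>' \<in> \<int>"
    using \<epsilon> \<epsilon>' Ints_minus [OF j] Ints_minus [OF k] by simp_all
  define E where "E = ee (of_real (real l / real M) * z1 * z2 / \<tau>)"
  have E: "ee (- (of_int m / of_nat M) / \<tau> * z1 * z2) = E"
  proof -
    have "of_real (real l / real M) = (- (of_int m / of_nat M) :: complex)"
      using lm by (metis minus_minus of_real_divide of_real_minus of_real_of_int_eq of_real_of_nat_eq)
    then show ?thesis by (simp add: E_def)
  qed
  have 1: "lat_sum l M j k \<epsilon> (- 1 / \<tau>) (z1 / \<tau>) (z2 / \<tau>) = \<tau> / of_nat M * E *
     (\<Sum>p\<in>S. ee (of_real (real_of_int m / real M * (fst p * k + snd p * j))) * lat_sum l M (fst p) (snd p) \<epsilon>' \<tau> z1 z2)"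
    unfolding lat_sum_S [OF l(1) M co' y \<epsilon> \<epsilon>' j k reg(1) S] lm E_def case_prod_unfold ..
  have "lat_sum l M (- k) (- j) (- \<epsilon>) (- 1 / \<tau>) ((- z2) / \<tau>) ((- z1) / \<tau>) = \<tau> / of_nat M * E *
     (\<Sum>p\<in>(\<lambda>(a, b). (- b, - a)) ` S. ee (of_real (real_of_int m / real M * (fst p * - j + snd p * - k))) *
        lat_sum l M (fst p) (snd p) (- \<epsilon>') \<tau> (- z2) (- z1))"
  proof -
    have "of_real (real l / real M) * - z2 * - z1 / \<tau> = of_real (real l / real M) * z1 * z2 / \<tau>"
      by (simp add: mult_ac)
    then show ?thesis
      unfolding lat_sum_S [OF l(1) M co' y neg regular_point_uminus [OF reg(2)] coset_representatives_neg_swap [OF S]] lm E_def case_prod_unfold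
      by (simp only:)
  qed
  also have "(\<Sum>p\<in>(\<lambda>(a, b). (- b, - a)) ` S. ee (of_real (real_of_int m / real M * (fst p * - j + snd p * - k))) *
        lat_sum l M (fst p) (snd p) (- \<epsilon>') \<tau> (- z2) (- z1)) =
     (\<Sum>p\<in>S. ee (of_real (real_of_int m / real M * (fst p * k + snd p * j))) * lat_sum l M (- snd p) (- fst p) (- \<epsilon>') \<tau> (- z2) (- z1))"
    by (subst sum.reindex) (auto simp: inj_on_def case_prod_unfold prod_eq_iff add.commute)
  finally have 2: "lat_sum l M (- k) (- j) (- \<epsilon>) (- 1 / \<tau>) (- (z2 / \<tau>)) (- (z1 / \<tau>)) = \<tau> / of_nat M * E *
     (\<Sum>p\<in>S. ee (of_real (real_of_int m / real M * (fst p * k + snd p * j))) * lat_sum l M (- snd p) (- fst p) (- \<epsilon>') \<tau> (- z2) (- z1))"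
    by (simp only: minus_divide_left)
  have half: "2 * fst p \<in> \<int>" "2 * snd p \<in> \<int>" if "p \<in> S" for p
  proof -
    have "2 * x \<in> \<int>" if "x \<in> int_shift \<epsilon>" for x using that \<epsilon> by (auto simp: int_shift_def distrib_left)
    moreover have "fst p \<in> int_shift \<epsilon>" "snd p \<in> int_shift \<epsilon>" using S that unfolding coset_representatives_def by auto
    ultimately show "2 * fst p \<in> \<int>" "2 * snd p \<in> \<int>" by auto
  qed
  have "(\<Sum>p\<in>S. ee (of_real (real_of_int m / real M * (fst p * k + snd p * j))) * Psi_tilde M m \<epsilon>' (fst p) (snd p) \<tau> z1 z2) =
     (\<Sum>p\<in>S. ee (of_real (real_of_int m / real M * (fst p * k + snd p * j))) * lat_sum l M (fst p) (snd p) \<epsilon>' \<tau> z1 z2) -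
     (\<Sum>p\<in>S. ee (of_real (real_of_int m / real M * (fst p * k + snd p * j))) * lat_sum l M (- snd p) (- fst p) (- \<epsilon>') \<tau> (- z2) (- z1))"
    unfolding sum_subtractf [symmetric] right_diff_distrib [symmetric]
    by (rule sum.cong) (simp_all add: Psi_tilde_eq_lat_sum [OF M m y \<epsilon>' half reg] l_def)
  then show ?thesis
    unfolding Psi_tilde_eq_lat_sum [OF M m Im_minus_inverse_pos [OF y] \<epsilon> j2 regular_point_S [OF \<tau> reg(1)] regular_point_S [OF \<tau> reg(2)]]
      l_def [symmetric] 1 2 E by (simp add: right_diff_distrib)
qed

text \<open>For \<epsilon>, \<epsilon>' in {0, 1/2} the value |\<epsilon> - \<epsilon>'| is
  congruent to \<epsilon> + \<epsilon>' modulo 1, hence to j + \<epsilon> and k + \<epsilon>. This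
  provides the integer column shift in each of the two lattice sums.\<close>

lemma Psi_tilde_T:
  assumes M: "M > 0" and m: "m < 0" and y: "Im \<tau> > 0"
    and e: "\<epsilon> = 0 \<or> \<epsilon> = 1 / 2" "\<epsilon>' = 0 \<or> \<epsilon>' = 1 / 2" and j: "j - \<epsilon>' \<in> \<int>" and k: "k - \<epsilon>' \<in> \<int>"
    and reg: "regular_point \<tau> z1" "regular_point \<tau> z2"
  shows "Psi_tilde M m \<epsilon> j k (\<tau> + 1) z1 z2 =
    ee (of_real (- (real_of_int m / real M) * j * k)) * Psi_tilde M m \<bar>\<epsilon> - \<epsilon>'\<bar> j k \<tau> z1 z2"
proof -
  define l where "l = nat (- m)"
  define \<delta> where "\<delta> = \<bar>\<epsilon> - \<epsilon>'\<bar>"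
  have lm: "real l / real M = - (real_of_int m / real M)" using m by (simp add: l_def)
  have h: "2 * \<epsilon> \<in> \<int>" "2 * \<epsilon>' \<in> \<int>" "2 * \<delta> \<in> \<int>" "\<epsilon> + \<epsilon>' - \<delta> \<in> \<int>" "- \<epsilon> - \<epsilon>' + \<delta> \<in> \<int>"
    unfolding \<delta>_def using e by (elim disjE; (simp only:); simp)+
  have jk: "2 * j \<in> \<int>" "2 * k \<in> \<int>" "j + k \<in> \<int>" "- k + - j \<in> \<int>"
  proof -
    have "2 * j = (j - \<epsilon>') + (j - \<epsilon>') + 2 * \<epsilon>'" "2 * k = (k - \<epsilon>') + (k - \<epsilon>') + 2 * \<epsilon>'" "j + k = (j - \<epsilon>') + (k - \<epsilon>') + 2 * \<epsilon>'"
      by simp_all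
    then show *: "2 * j \<in> \<int>" "2 * k \<in> \<int>" "j + k \<in> \<int>" using j k h(2) by (metis Ints_add)+
    have "- k + - j = - (j + k)" by simp
    then show "- k + - j \<in> \<int>" using *(3) by (simp only: minus_in_Ints_iff)
  qed
  obtain n1 where n1: "j + \<epsilon> = \<delta> + of_int n1"
  proof -
    have "(j - \<epsilon>') + (\<epsilon> + \<epsilon>' - \<delta>) \<in> \<int>" using j h(4) by (rule Ints_add)
    then obtain n where "(j - \<epsilon>') + (\<epsilon> + \<epsilon>' - \<delta>) = of_int n" by (rule Ints_cases)
    then show ?thesis using that [of n] by simp
  qed
  obtain n2 where n2: "- k + - \<epsilon> = - \<delta> + of_int n2"
  proof -
    have "- (k - \<epsilon>') + (- \<epsilon> - \<epsilon>' + \<delta>) \<in> \<int>" using Ints_minus [OF k] h(5) by (rule Ints_add)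
    then obtain n where "- (k - \<epsilon>') + (- \<epsilon> - \<epsilon>' + \<delta>) = of_int n" by (rule Ints_cases)
    then show ?thesis using that [of n] by simp
  qed
  have y': "Im (\<tau> + 1) > 0" using y by simp
  show ?thesis
    unfolding Psi_tilde_eq_lat_sum [OF M m y' h(1) jk(1,2) regular_point_T [OF reg(1)] regular_point_T [OF reg(2)]]
      Psi_tilde_eq_lat_sum [OF M m y h(3) jk(1,2) reg, unfolded \<delta>_def] l_def [symmetric]
      lat_sum_T [OF M jk(3) n1] lat_sum_T [OF M jk(4) n2] lm \<delta>_def right_diff_distrib
    by (simp add: mult_ac)
qed

theorem theorem9p7:
  fixes M \<alpha> :: nat and m :: int and \<epsilon> \<epsilon>' j k :: real and \<tau> z :: complex
    and S :: "(real \<times> real) set"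
  assumes "(M > 0 \<and> m = -1) \<or> (M > 0 \<and> odd M \<and> m \<le> -2 \<and> coprime m (int M))"
    and "\<epsilon> \<in> {0, 1/2}" and "\<epsilon>' \<in> {0, 1/2}"
    and "j \<in> int_shift \<epsilon>'" and "k \<in> int_shift \<epsilon>'"
    and "\<alpha> = 0 \<or> \<alpha> = 1"
    and "Im \<tau> > 0" and "regular_point \<tau> z"
    and "coset_representatives M \<epsilon> S"
  shows "(chi \<alpha> M m \<epsilon> \<epsilon>' j k (- 1 / \<tau>) (z / \<tau>) =
           - ((- 1) powr of_real ((1 - 2 * \<epsilon>) * (1 - 2 * \<epsilon>'))) * (\<tau> ^ \<alpha> / of_nat M) *
           exp (- (2 * of_real pi * \<i> / \<tau>) * (of_int m / of_nat M + 1) * z ^ 2) *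
           (\<Sum>(a, b) \<in> S.
              exp (2 * of_real pi * \<i> * of_int m / of_nat M * (of_real a * of_real k + of_real b * of_real j)) *
              chi \<alpha> M m \<epsilon>' \<epsilon> a b \<tau> z))
         \<and> (chi \<alpha> M m \<epsilon> \<epsilon>' j k (\<tau> + 1) z =
           exp (- (2 * of_real pi * \<i> * of_int m / of_nat M * of_real j * of_real k)
                - of_real pi * \<i> * of_real \<epsilon>') *
           chi \<alpha> M m \<bar>\<epsilon> - \<epsilon>'\<bar> \<epsilon>' j k \<tau> z)"
proof
  \<comment> \<open>In the case m = -1 coprimality is automatic.\<close>
  have M: "M > 0" and m: "m < 0" and co: "coprime m (int M)" using assms(1) by auto
  have e: "\<epsilon> = 0 \<or> \<epsilon> = 1 / 2" "\<epsilon>' = 0 \<or> \<epsilon>' = 1 / 2" using assms(2,3) by auto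
  have h: "2 * \<epsilon> \<in> \<int>" "2 * \<epsilon>' \<in> \<int>" "2 * \<bar>\<epsilon> - \<epsilon>'\<bar> \<in> \<int>"
    using e by (elim disjE; (simp only:); simp)+
  have jk: "j - \<epsilon>' \<in> \<int>" "k - \<epsilon>' \<in> \<int>" using assms(4,5) by (auto simp: int_shift_def)
  note y = assms(7) and reg = assms(8) and S = assms(9)
  have \<tau>: "\<tau> \<noteq> 0" using y by auto
  define U where "U = {z. regular_point \<tau> z}"
  have U: "open U" "z \<in> U" using open_regular_points [OF y] reg by (auto simp: U_def)
  have half: "2 * x \<in> \<int>" if "x \<in> int_shift c" "2 * c \<in> \<int>" for x c :: real
    using that by (auto simp: int_shift_def distrib_left)
  have half_S: "2 * fst p \<in> \<int>" "2 * snd p \<in> \<int>" if "p \<in> S" for p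
    using S that h(1) half [of _ \<epsilon>] unfolding coset_representatives_def by auto
  define N where "N = (\<lambda>\<epsilon> a b \<tau> z. if \<alpha> = 0 then Psi_tilde M m \<epsilon> a b \<tau> z z else Pfun M m \<epsilon> a b \<tau> z z)"
  have chi: "chi \<alpha> M m \<epsilon> \<epsilon>' a b \<tau> z = N \<epsilon> a b \<tau> z / denom_R \<epsilon> \<epsilon>' \<tau> z" for \<epsilon> \<epsilon>' a b \<tau> z
    by (simp add: chi_def N_def)
  have Pfun: "Pfun M m \<epsilon> a b \<tau> z z = D0 (Psi_tilde M m \<epsilon> a b \<tau>) z z" for \<epsilon> a b \<tau> z
    by (simp add: Pfun_def)
  define w where "w = (\<lambda>p. ee (of_real (real_of_int m / real M * (fst p * k + snd p * j))))"
  define K where "K = - (of_int m / of_nat M) / \<tau>"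
  \<comment> \<open>The factor \<tau>^\<alpha> stems from \<open>D0\<close>: a derivative taken at z
    / \<tau> is \<tau> times the derivative of the rescaled function at z.\<close>
  have "N \<epsilon> j k (- 1 / \<tau>) (z / \<tau>) = \<tau> ^ \<alpha> * (\<tau> / of_nat M) * ee (K * z * z) * (\<Sum>p\<in>S. w p * N \<epsilon>' (fst p) (snd p) \<tau> z)"
  proof (cases "\<alpha> = 0")
    case True
    then show ?thesis
      using Psi_tilde_S [OF M m co y h(1,2) jk reg reg S] by (simp add: N_def K_def w_def)
  next
    case False
    have "D0 (Psi_tilde M m \<epsilon> j k (- 1 / \<tau>)) (z / \<tau>) (z / \<tau>) =
       \<tau> * (\<tau> / of_nat M) * ee (K * z * z) * (\<Sum>p\<in>S. w p * D0 (Psi_tilde M m \<epsilon>' (fst p) (snd p) \<tau>) z z)"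
    proof (rule D0_diagonal_transform [OF U \<tau>])
      show "Psi_tilde M m \<epsilon> j k (- 1 / \<tau>) (z1 / \<tau>) (z2 / \<tau>) = \<tau> / of_nat M * ee (K * z1 * z2) *
          (\<Sum>p\<in>S. w p * Psi_tilde M m \<epsilon>' (fst p) (snd p) \<tau> z1 z2)" if "z1 \<in> U" "z2 \<in> U" for z1 z2
        unfolding K_def w_def by (rule Psi_tilde_S [OF M m co y h(1,2) jk _ _ S]) (use that in \<open>auto simp: U_def\<close>)
    qed (rule Psi_tilde_differentiable [OF M m y h(2) half_S reg reg], assumption, assumption)+
    then show ?thesis using False assms(6) by (simp add: N_def Pfun)
  qed
  moreover define \<sigma> where "\<sigma> = ((- 1) powr of_real ((1 - 2 * \<epsilon>) * (1 - 2 * \<epsilon>')) :: complex)"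
  have \<sigma>: "\<sigma> = 1 \<or> \<sigma> = - 1" unfolding \<sigma>_def using e by (elim disjE; (simp only:); simp)
  ultimately have "chi \<alpha> M m \<epsilon> \<epsilon>' j k (- 1 / \<tau>) (z / \<tau>) =
     (\<tau> ^ \<alpha> * (\<tau> / of_nat M) * ee (K * z * z) * (\<Sum>p\<in>S. w p * N \<epsilon>' (fst p) (snd p) \<tau> z)) /
     (- \<sigma> * \<tau> * ee (z\<^sup>2 / \<tau>) * denom_R \<epsilon>' \<epsilon> \<tau> z)"
    unfolding chi denom_R_S [OF y e] \<sigma>_def by simp
  also have "\<dots> = - \<sigma> * (\<tau> ^ \<alpha> / of_nat M) * (ee (K * z * z) / ee (z\<^sup>2 / \<tau>)) * (\<Sum>p\<in>S. w p * (N \<epsilon>' (fst p) (snd p) \<tau> z / denom_R \<epsilon>' \<epsilon> \<tau> z))"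
  proof -
    \<comment> \<open>\<sigma> is its own inverse and \<tau> is nonzero; for \<open>D\<close> the
      convention for division covers the value 0.\<close>
    have gen: "(A * (\<tau> / B) * X * Y) / (- \<sigma> * \<tau> * X' * D) = - \<sigma> * (A / B) * (X / X') * (Y / D)" for A B X Y X' D
      using \<sigma> \<tau> by (auto simp: mult.assoc)
    have "(\<Sum>p\<in>S. w p * (N \<epsilon>' (fst p) (snd p) \<tau> z / denom_R \<epsilon>' \<epsilon> \<tau> z)) =
        (\<Sum>p\<in>S. w p * N \<epsilon>' (fst p) (snd p) \<tau> z) / denom_R \<epsilon>' \<epsilon> \<tau> z"
      by (simp add: sum_divide_distrib)
    then show ?thesis unfolding gen by (simp only:)
  qed
  also have "ee (K * z * z) / ee (z\<^sup>2 / \<tau>) = exp (- (2 * of_real pi * \<i> / \<tau>) * (of_int m / of_nat M + 1) * z ^ 2)"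
    unfolding ee_diff [symmetric] unfolding ee_def K_def
    by (rule arg_cong [where f = exp]) (simp add: field_simps power2_eq_square add_divide_distrib)
  also have "(\<Sum>p\<in>S. w p * (N \<epsilon>' (fst p) (snd p) \<tau> z / denom_R \<epsilon>' \<epsilon> \<tau> z)) =
     (\<Sum>(a, b) \<in> S. exp (2 * of_real pi * \<i> * of_int m / of_nat M * (of_real a * of_real k + of_real b * of_real j)) *
              chi \<alpha> M m \<epsilon>' \<epsilon> a b \<tau> z)"
    unfolding chi w_def ee_def case_prod_unfold by (simp add: mult_ac)
  finally show "chi \<alpha> M m \<epsilon> \<epsilon>' j k (- 1 / \<tau>) (z / \<tau>) =
           - ((- 1) powr of_real ((1 - 2 * \<epsilon>) * (1 - 2 * \<epsilon>'))) * (\<tau> ^ \<alpha> / of_nat M) *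
           exp (- (2 * of_real pi * \<i> / \<tau>) * (of_int m / of_nat M + 1) * z ^ 2) *
           (\<Sum>(a, b) \<in> S.
              exp (2 * of_real pi * \<i> * of_int m / of_nat M * (of_real a * of_real k + of_real b * of_real j)) *
              chi \<alpha> M m \<epsilon>' \<epsilon> a b \<tau> z)"
    unfolding \<sigma>_def .
  define C where "C = ee (of_real (- (real_of_int m / real M) * j * k))"
  define \<delta> where "\<delta> = \<bar>\<epsilon> - \<epsilon>'\<bar>"
  note h3 = h(3) [folded \<delta>_def]
  note T = Psi_tilde_T [OF M m y e jk, folded C_def \<delta>_def]
  have "N \<epsilon> j k (\<tau> + 1) z = C * N \<delta> j k \<tau> z"
  proof (cases "\<alpha> = 0")
    case True
    then show ?thesis using T [OF reg reg] by (simp add: N_def)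
  next
    case False
    have j2: "2 * j \<in> \<int>" "2 * k \<in> \<int>" using assms(4,5) half h(2) by auto
    \<comment> \<open>The diagonal rule with t = 1, K = 0 and a single summand: T neither rescales z
      nor produces an index factor.\<close>
    have "D0 (Psi_tilde M m \<epsilon> j k (\<tau> + 1)) (z / 1) (z / 1) =
       1 * 1 * ee (0 * z * z) * (\<Sum>p\<in>{()}. C * D0 (Psi_tilde M m \<delta> j k \<tau>) z z)"
    proof (rule D0_diagonal_transform [OF U])
      show "Psi_tilde M m \<epsilon> j k (\<tau> + 1) (z1 / 1) (z2 / 1) = 1 * ee (0 * z1 * z2) *
          (\<Sum>p\<in>{()}. C * Psi_tilde M m \<delta> j k \<tau> z1 z2)" if "z1 \<in> U" "z2 \<in> U" for z1 z2
        using T [of z1 z2] that by (simp add: U_def)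
    qed (use Psi_tilde_differentiable [OF M m y h3 j2 reg reg] in auto)
    then show ?thesis using False by (simp add: N_def Pfun)
  qed
  then have "chi \<alpha> M m \<epsilon> \<epsilon>' j k (\<tau> + 1) z = C / exp (of_real pi * \<i> * of_real \<epsilon>') * chi \<alpha> M m \<delta> \<epsilon>' j k \<tau> z"
    unfolding chi denom_R_T [OF y e] \<delta>_def by simp
  also have "C / exp (of_real pi * \<i> * of_real \<epsilon>') = exp (- (2 * of_real pi * \<i> * of_int m / of_nat M * of_real j * of_real k)
                - of_real pi * \<i> * of_real \<epsilon>')"
    unfolding C_def ee_def exp_diff [symmetric] by (rule arg_cong [where f = exp]) simp
  finally show "chi \<alpha> M m \<epsilon> \<epsilon>' j k (\<tau> + 1) z =
           exp (- (2 * of_real pi * \<i> * of_int m / of_nat M * of_real j * of_real k)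
                - of_real pi * \<i> * of_real \<epsilon>') *
           chi \<alpha> M m \<bar>\<epsilon> - \<epsilon>'\<bar> \<epsilon>' j k \<tau> z"
    unfolding \<delta>_def .
qed

end
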